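(* Let $\pi$ be a convex polygon with $n$ vertices, let $T$ be a triangulation of $\pi$, and let $k$ be an integer with $k\leq n/2-2$. If some vertex of $\pi$ is incident to exactly $n-3-k$ interior edges of $T$, then the eccentricity of $T$ in the flip-graph of $\pi$ is exactly $n-3+k$.
   Context: Let $\pi$ be a convex polygon with $n$ vertices. An edge on $\pi$ is a set of exactly two vertices of $\pi$; two such edges cross when the relative interiors of the corresponding line segments intersect and the edges are distinct. The edges of $\pi$ itself are its $n$ sides. A triangulation of $\pi$ is an inclusion-maximal set of pairwise non-crossing edges on $\pi$; it contains all sides of $\pi$ (its boundary edges), and its remaining edges are called its interior edges (there are $n-3$ of them). A flip removes one interior edge from a triangulation and replaces it by the only other edge such that the result is again a triangulation of $\pi$. The flip-graph of $\pi$ is the graph whose vertices are the triangulations of $\pi$, two triangulations being adjacent when they differ by a single flip. The eccentricity of a vertex $v$ in a graph $G$ is the largest possible distance in $G$ from $v$ to any vertex of $G$. *)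

theory Defs
  imports "HOL-Analysis.Analysis" "Graph_Theory.Graph_Theory"
begin

text \<open>
  A convex polygon is the full (closed, two-dimensional) region in the plane. Its vertices are the
  extreme points, so there are at least three of them and no three are collinear.
\<close>

definition convex_polygon :: "(real^2) set \<Rightarrow> bool" where
  "convex_polygon \<pi> \<longleftrightarrow> polytope \<pi> \<and> aff_dim \<pi> = 2"

definition polygon_vertices :: "(real^2) set \<Rightarrow> (real^2) set" where
  "polygon_vertices \<pi> = {v. v extreme_point_of \<pi>}"

text \<open>
  An edge is its set of two endpoints; the corresponding segment is the convex hull of that set.
\<close>

definition edges_on :: "(real^2) set \<Rightarrow> (real^2) set set" where
  "edges_on \<pi> = {e. e \<subseteq> polygon_vertices \<pi> \<and> card e = 2}"

definition edges_cross :: "(real^2) set \<Rightarrow> (real^2) set \<Rightarrow> bool" where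
  "edges_cross e f \<longleftrightarrow>
     e \<noteq> f \<and> rel_interior (convex hull e) \<inter> rel_interior (convex hull f) \<noteq> {}"

definition boundary_edges :: "(real^2) set \<Rightarrow> (real^2) set set" where
  "boundary_edges \<pi> = {e \<in> edges_on \<pi>. (convex hull e) edge_of \<pi>}"

definition noncrossing :: "(real^2) set \<Rightarrow> (real^2) set set \<Rightarrow> bool" where
  "noncrossing \<pi> T \<longleftrightarrow> T \<subseteq> edges_on \<pi> \<and> pairwise (\<lambda>e f. \<not> edges_cross e f) T"

definition triangulation_of :: "(real^2) set set \<Rightarrow> (real^2) set \<Rightarrow> bool" where
  "triangulation_of T \<pi> \<longleftrightarrow>
     noncrossing \<pi> T \<and> (\<forall>T'. noncrossing \<pi> T' \<and> T \<subseteq> T' \<longrightarrow> T' = T)"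

definition interior_edges :: "(real^2) set \<Rightarrow> (real^2) set set \<Rightarrow> (real^2) set set" where
  "interior_edges \<pi> T = T - boundary_edges \<pi>"

definition flips_to :: "(real^2) set \<Rightarrow> (real^2) set set \<Rightarrow> (real^2) set set \<Rightarrow> bool" where
  "flips_to \<pi> T T' \<longleftrightarrow> triangulation_of T \<pi> \<and> triangulation_of T' \<pi> \<and>
     (\<exists>e \<in> interior_edges \<pi> T. \<exists>f \<in> edges_on \<pi>. f \<noteq> e \<and> T' = insert f (T - {e}))"

text \<open>
  Undirected graphs are represented as symmetric loop-free digraphs; the lemma
  \<open>graph_flip_graph\<close> below shows that the flip-graph is one.
\<close>

definition flip_graph :: "(real^2) set \<Rightarrow> (real^2) set set pair_pre_digraph" where
  "flip_graph \<pi> = \<lparr> pverts = {T. triangulation_of T \<pi>}, parcs = {(T, T'). flips_to \<pi> T T'} \<rparr>"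

text \<open>
  Shortest paths with unit arc weights give the usual graph distance, which is \<open>\<infinity>\<close> between
  vertices in different components.
\<close>

definition graph_distance :: "('a, 'b) pre_digraph \<Rightarrow> 'a \<Rightarrow> 'a \<Rightarrow> ereal" where
  "graph_distance G u v = wf_digraph.\<mu> G (\<lambda>_. 1) u v"

definition eccentricity :: "('a, 'b) pre_digraph \<Rightarrow> 'a \<Rightarrow> ereal" where
  "eccentricity G v = (SUP w \<in> verts G. graph_distance G v w)"


lemma finite_polygon_vertices: "convex_polygon \<pi> \<Longrightarrow> finite (polygon_vertices \<pi>)"
  unfolding convex_polygon_def polygon_vertices_def
  by (simp add: finite_polyhedron_extreme_points polytope_imp_polyhedron)

lemma boundary_edge_not_crossed:
  assumes f: "f \<in> boundary_edges \<pi>" and e: "e \<in> edges_on \<pi>"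
  shows "\<not> edges_cross e f"
proof
  assume cr: "edges_cross e f"
  obtain a b where ab: "e = {a, b}" "a \<noteq> b" "a extreme_point_of \<pi>" "b extreme_point_of \<pi>"
    using e by (auto simp: edges_on_def polygon_vertices_def card_2_iff)
  have fc: "card f = 2" "(convex hull f) face_of \<pi>"
    using f by (auto simp: boundary_edges_def edges_on_def edge_of_def)
  from cr obtain x where x: "x \<in> rel_interior (convex hull e)" "x \<in> rel_interior (convex hull f)"
    by (auto simp: edges_cross_def)
  have "x \<in> open_segment a b"
    using x(1) ab by (simp add: segment_convex_hull[symmetric] rel_interior_closed_segment)
  moreover have "x \<in> convex hull f"
    using x(2) rel_interior_subset by blast
  ultimately have "a \<in> convex hull f" "b \<in> convex hull f"
    using fc(2) ab(3,4) unfolding face_of_def extreme_point_of_def by blast+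
  then have "a extreme_point_of (convex hull f)" "b extreme_point_of (convex hull f)"
    using ab(3,4) fc(2) extreme_point_of_face by blast+
  then have "e \<subseteq> f"
    using ab(1) extreme_point_of_convex_hull by blast
  then have "e = f"
    using ab fc(1) by (metis card_2_iff card_subset_eq finite.emptyI finite_insert)
  then show False
    using cr by (simp add: edges_cross_def)
qed

lemma boundary_edges_subset_triangulation:
  assumes T: "triangulation_of T \<pi>"
  shows "boundary_edges \<pi> \<subseteq> T"
proof -
  have sub: "T \<subseteq> edges_on \<pi>" and pw: "pairwise (\<lambda>e f. \<not> edges_cross e f) T"
    using T by (auto simp: triangulation_of_def noncrossing_def)
  have b: "boundary_edges \<pi> \<subseteq> edges_on \<pi>"
    by (auto simp: boundary_edges_def)
  have sym: "edges_cross e f \<longleftrightarrow> edges_cross f e" for e f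
    by (auto simp: edges_cross_def)
  have "noncrossing \<pi> (T \<union> boundary_edges \<pi>)"
    unfolding noncrossing_def
  proof (intro conjI pairwiseI)
    show "T \<union> boundary_edges \<pi> \<subseteq> edges_on \<pi>"
      using sub b by blast
    fix e f
    assume ef: "e \<in> T \<union> boundary_edges \<pi>" "f \<in> T \<union> boundary_edges \<pi>" "e \<noteq> f"
    show "\<not> edges_cross e f"
    proof (cases "e \<in> boundary_edges \<pi> \<or> f \<in> boundary_edges \<pi>")
      case True
      then show ?thesis
        using boundary_edge_not_crossed sub b ef sym by blast
    next
      case False
      then show ?thesis
        using ef pw by (auto simp: pairwise_def)
    qed
  qed
  then show ?thesis
    using T unfolding triangulation_of_def by blast
qed

lemma flips_to_sym:
  assumes "flips_to \<pi> T T'"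
  shows "flips_to \<pi> T' T" and "T \<noteq> T'"
proof -
  from assms obtain e f where
    T: "triangulation_of T \<pi>" and T': "triangulation_of T' \<pi>" and
    e: "e \<in> interior_edges \<pi> T" and f: "f \<in> edges_on \<pi>" "f \<noteq> e" and
    eq: "T' = insert f (T - {e})"
    by (auto simp: flips_to_def)
  have eT: "e \<in> T"
    using e by (simp add: interior_edges_def)
  have fT: "f \<notin> T"
  proof
    assume "f \<in> T"
    then have "T' = T - {e}"
      using eq f by auto
    moreover have "T = T'"
      using T T' \<open>T' = T - {e}\<close> unfolding triangulation_of_def by blast
    ultimately show False
      using eT by blast
  qed
  then have "f \<in> interior_edges \<pi> T'"
    using eq boundary_edges_subset_triangulation[OF T] by (auto simp: interior_edges_def)
  moreover have "e \<in> edges_on \<pi>"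
    using T eT by (auto simp: triangulation_of_def noncrossing_def)
  moreover have "T = insert e (T' - {f})"
    using eq fT eT by auto
  ultimately show "flips_to \<pi> T' T"
    using T T' f(2) unfolding flips_to_def by blast
  show "T \<noteq> T'"
    using eq fT by auto
qed

lemma graph_flip_graph:
  assumes "convex_polygon \<pi>"
  shows "pair_graph (flip_graph \<pi>)"
proof -
  have fin: "finite {T. triangulation_of T \<pi>}"
  proof (rule finite_subset)
    show "{T. triangulation_of T \<pi>} \<subseteq> Pow (Pow (polygon_vertices \<pi>))"
      by (auto simp: triangulation_of_def noncrossing_def edges_on_def)
    show "finite (Pow (Pow (polygon_vertices \<pi>)))"
      using finite_polygon_vertices[OF assms] by simp
  qed
  have sub: "{(T, T'). flips_to \<pi> T T'} \<subseteq> {T. triangulation_of T \<pi>} \<times> {T. triangulation_of T \<pi>}"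
    by (auto simp: flips_to_def)
  show ?thesis
    by unfold_locales
      (use fin subsetD[OF sub] finite_subset[OF sub] flips_to_sym in
        \<open>auto simp: flip_graph_def symmetric_def intro!: symI\<close>)
qed

end

theory Submission
  imports Defs
begin

text \<open>
Let \<open>v\<close> be the vertex of \<open>\<pi>\<close> that is incident to \<open>n - 3 - k\<close> interior edges of \<open>T\<close>. Call
it \<open>0\<close> and label the other vertices in the order in which a ray turning around \<open>v\<close> meets
them. Two edges then cross exactly when their labels interleave, so that the problem is
about maximal sets of non-interleaving pairs on a finite set \<open>V\<close> of natural numbers. Let \<open>N\<close>
be the set of neighbours of \<open>0\<close> in \<open>T\<close>, of size \<open>n - 1 - k\<close>. The \<open>k\<close> remaining vertices lie
in pockets: each pocket is cut off by an edge of \<open>T\<close> between two consecutive elements of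
\<open>N\<close>.

The upper bound is classical. A triangulation in which \<open>0\<close> does not see every vertex admits
a flip that gives \<open>0\<close> a further edge. Hence \<open>T\<close> is \<open>k\<close> flips away from the fan at \<open>0\<close>, and
every triangulation is at most \<open>n - 3\<close> flips away from that fan (\<open>reach_upper\<close>).

The lower bound rests on contracting a side \<open>pq\<close> of the polygon. Contraction maps
triangulations to triangulations and flips to flips, except that a flip which changes the
triangle on \<open>pq\<close> becomes trivial (\<open>flip_step_pull_trivial\<close>). So a path of flips loses at
least one step if the triangles on \<open>pq\<close> at its two ends differ. It loses two steps in the
following situation (\<open>reach_pull_ear\<close>): \<open>p\<close> is the tip of an ear of the first triangulation,
with \<open>q\<close> and \<open>r\<close> the vertices next to \<open>p\<close>, and in the last triangulation the triangles on
\<open>qp\<close> and \<open>pr\<close> have different third vertices, neither of which is \<open>q\<close> or \<open>r\<close>. The flip that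
destroys the ear changes the triangles on both sides at once, to triangles with the same
third vertex; so one of the two sides has to change again. This works for the contraction of
\<open>p\<close> into \<open>q\<close> or of \<open>p\<close> into \<open>r\<close>, but one cannot choose which.

To use this, suppose first that \<open>T\<close> has a single pocket, and let \<open>U\<close> be a triangulation that
contains the edge between the two polygon neighbours of \<open>0\<close>, and in which the sides along
the pocket have pairwise different third vertices, all outside the pocket. All pocket
vertices can then be contracted, at a gain of two steps each, and afterwards \<open>T\<close> has become
a fan with \<open>n - 3 - k\<close> interior edges, none of which is shared with \<open>U\<close>. The distance is
thus at least \<open>2 k + (n - 3 - k) = n - 3 + k\<close> (\<open>reach_collapse\<close>, \<open>remote_collapse\<close>,
\<open>remote_fan\<close>).

With several pockets, the collapse of one pocket alters \<open>U\<close> near the others in a way that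
depends on the choices made for us, so \<open>U\<close> is built in the reverse order, pocket by pocket.
One extends a polygon by a pocket vertex \<open>q\<close> together with a vertex \<open>b\<close> of \<open>N\<close> beside it
(\<open>grow\<close>). Whichever way the pocket collapses, contracting the side from \<open>b\<close> to its neighbour
in \<open>N\<close> afterwards restores what was there before (\<open>grow_collapse\<close>). Each pocket vertex
consumes one side of the polygon between elements of \<open>N\<close> next to its pocket. The assumption
\<open>k \<le> n / 2 - 2\<close> says that \<open>N\<close> has at least three elements more than there are pocket
vertices, and then some pocket always has enough such sides around it (\<open>pocket_exists\<close>).
\<close>

section \<open>Triangulations on a finite set of natural numbers\<close>

text \<open>
Labels increase along the boundary of the polygon, so two edges cross when their end points
alternate.
\<close>

definition crosses :: "nat set \<Rightarrow> nat set \<Rightarrow> bool" where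
  "crosses e f \<longleftrightarrow> (\<exists>a b c d. a < b \<and> b < c \<and> c < d \<and>
     (e = {a, c} \<and> f = {b, d} \<or> e = {b, d} \<and> f = {a, c}))"

lemma crosses_iff:
  "crosses {a, b} {c, d} \<longleftrightarrow>
     a < c \<and> c < b \<and> b < d \<or> a < d \<and> d < b \<and> b < c \<or>
     b < c \<and> c < a \<and> a < d \<or> b < d \<and> d < a \<and> a < c \<or>
     c < a \<and> a < d \<and> d < b \<or> d < a \<and> a < c \<and> c < b \<or>
     c < b \<and> b < d \<and> d < a \<or> d < b \<and> b < c \<and> c < a" (is "?l \<longleftrightarrow> ?r")
proof
  show "?l \<Longrightarrow> ?r" by (auto simp: crosses_def doubleton_eq_iff)
  have base: "crosses {w, y} {x, z} \<and> crosses {x, z} {w, y}" if "w < x" "x < y" "y < z" for w x y z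
    using that unfolding crosses_def by blast
  show "?r \<Longrightarrow> ?l"
    using base[of a c b d] base[of a d b c] base[of b c a d] base[of b d a c]
      base[of c a d b] base[of d a c b] base[of c b d a] base[of d b c a]
    by (auto simp: insert_commute)
qed

lemma crosses_sorted:
  assumes "a < b"
  shows "crosses {a, b} {s, t} \<longleftrightarrow> a < s \<and> s < b \<and> (t < a \<or> b < t) \<or> a < t \<and> t < b \<and> (s < a \<or> b < s)"
    "crosses {b, a} {s, t} \<longleftrightarrow> a < s \<and> s < b \<and> (t < a \<or> b < t) \<or> a < t \<and> t < b \<and> (s < a \<or> b < s)"
  using assms unfolding crosses_iff by auto

lemma crosses_sym: "crosses e f \<longleftrightarrow> crosses f e"
  unfolding crosses_def by blast

definition chords :: "nat set \<Rightarrow> nat set set" where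
  "chords V = {e. e \<subseteq> V \<and> card e = 2}"

lemma chords_iff [simp]: "{a, b} \<in> chords V \<longleftrightarrow> a \<in> V \<and> b \<in> V \<and> a \<noteq> b"
  by (auto simp: chords_def card_2_iff doubleton_eq_iff)

lemma chordsE:
  assumes "e \<in> chords V"
  obtains a b where "e = {a, b}" "a < b" "a \<in> V" "b \<in> V"
proof -
  obtain a b where ab: "e = {a, b}" "a \<noteq> b" "a \<in> V" "b \<in> V"
    using assms by (auto simp: chords_def card_2_iff)
  show thesis
    using that[of a b] that[of b a] ab by (metis insert_commute linorder_neqE_nat)
qed

lemma chords_mono: "V \<subseteq> W \<Longrightarrow> chords V \<subseteq> chords W"
  by (auto simp: chords_def)

lemma finite_chords: "finite V \<Longrightarrow> finite (chords V)"
  by (rule finite_subset[of _ "Pow V"]) (auto simp: chords_def)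

text \<open>
The comparison of an edge with itself is harmless, since no edge interleaves with itself.
\<close>

definition plane :: "nat set set \<Rightarrow> bool" where
  "plane T \<longleftrightarrow> (\<forall>e\<in>T. \<forall>f\<in>T. \<not> crosses e f)"

definition triang :: "nat set \<Rightarrow> nat set set \<Rightarrow> bool" where
  "triang V T \<longleftrightarrow> T \<subseteq> chords V \<and> plane T \<and>
     (\<forall>e\<in>chords V. (\<forall>f\<in>T. \<not> crosses e f) \<longrightarrow> e \<in> T)"

lemma triangD:
  assumes "triang V T"
  shows "T \<subseteq> chords V" "plane T"
  using assms by (auto simp: triang_def)

lemma plane_notcross: "plane T \<Longrightarrow> e \<in> T \<Longrightarrow> f \<in> T \<Longrightarrow> \<not> crosses e f"
  by (auto simp: plane_def)

lemma triang_verts: "triang V T \<Longrightarrow> {a, b} \<in> T \<Longrightarrow> a \<in> V \<and> b \<in> V \<and> a \<noteq> b"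
  using triangD(1) chords_iff by blast

lemma triang_edge: "triang V T \<Longrightarrow> e \<in> T \<Longrightarrow> \<exists>a b. e = {a, b} \<and> a < b \<and> a \<in> V \<and> b \<in> V"
  by (meson chordsE subsetD triangD(1))

text \<open>
The form in which maximality is used: what crosses no edge of a triangulation belongs to it.
\<close>

lemma triang_mem:
  assumes "triang V T" "a \<in> V" "b \<in> V" "a \<noteq> b"
    and "\<And>c d. {c, d} \<in> T \<Longrightarrow> c < d \<Longrightarrow> \<not> crosses {a, b} {c, d}"
  shows "{a, b} \<in> T"
proof -
  have "{a, b} \<in> chords V" using assms by simp
  moreover have "\<not> crosses {a, b} f" if f: "f \<in> T" for f
    using f triangD(1)[OF assms(1)] assms(5) by (metis chordsE subsetD)
  ultimately show ?thesis using assms(1) by (auto simp: triang_def)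
qed

text \<open>
One side of the polygon is left out, the one between the least and the greatest label; it is
never contracted.
\<close>

definition side :: "nat set \<Rightarrow> nat \<Rightarrow> nat \<Rightarrow> bool" where
  "side V p q \<longleftrightarrow> p \<in> V \<and> q \<in> V \<and> p < q \<and> (\<forall>x\<in>V. x \<le> p \<or> q \<le> x)"

lemma sideD: "side V p q \<Longrightarrow> x \<in> V \<Longrightarrow> x \<le> p \<or> q \<le> x"
  by (auto simp: side_def)

lemma side_mem: "triang V T \<Longrightarrow> side V p q \<Longrightarrow> {p, q} \<in> T"
  apply (rule triang_mem)
      apply (auto simp: side_def)[4]
  subgoal for c d using triang_verts[of V T c d] sideD[of V p q c] sideD[of V p q d]
    by (auto simp: crosses_iff side_def)
  done

lemma outer_mem:
  assumes "triang V T" "a \<in> V" "b \<in> V" "a < b" "\<And>x. x \<in> V \<Longrightarrow> a \<le> x \<and> x \<le> b"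
  shows "{a, b} \<in> T"
  apply (rule triang_mem[OF assms(1-3)])
  using assms(4) apply simp
  subgoal for c d using triang_verts[of V T c d] assms(1,4) assms(5)[of c] assms(5)[of d]
    by (auto simp: crosses_iff)
  done

text \<open>
The third vertex of the triangle below \<open>ab\<close>: take the largest \<open>p\<close> below \<open>b\<close> that is joined
to \<open>a\<close>. An edge crossing \<open>pb\<close> would cross \<open>ab\<close> or \<open>ap\<close>, or join \<open>a\<close> to a vertex beyond \<open>p\<close>.
\<close>

lemma inner_apex:
  assumes T: "triang V T" and fin: "finite V" and ab: "{a, b} \<in> T" "a < b"
    and c: "c \<in> V" "a < c" "c < b"
  obtains p where "p \<in> V" "a < p" "p < b" "{a, p} \<in> T" "{p, b} \<in> T"
proof -
  define S where "S = {x\<in>V. a < x \<and> x < b \<and> {a, x} \<in> T}"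
  have finS: "finite S" using fin by (simp add: S_def)
  define s where "s = Min {x\<in>V. a < x}"
  have "s \<in> {x\<in>V. a < x}"
    unfolding s_def by (rule Min_in) (use fin c in auto)
  moreover have "\<And>x. x \<in> V \<Longrightarrow> a < x \<Longrightarrow> s \<le> x"
    unfolding s_def using fin c by simp
  ultimately have "side V a s" "s \<le> c"
    using ab T c triang_verts[of V T a b] by (auto simp: side_def not_le) (metis not_le)
  then have "s \<in> S" using side_mem[OF T] c by (auto simp: S_def side_def)
  define p where "p = Max S"
  have pS: "p \<in> S" and pmax: "\<And>x. x \<in> S \<Longrightarrow> x \<le> p"
    unfolding p_def using finS \<open>s \<in> S\<close> by (auto intro: Max_in)
  have p: "p \<in> V" "a < p" "p < b" "{a, p} \<in> T" using pS by (auto simp: S_def)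
  have "{p, b} \<in> T"
  proof (rule triang_mem[OF T])
    show "p \<in> V" "b \<in> V" "p \<noteq> b" using p ab triang_verts[OF T ab(1)] by auto
    fix s t assume st: "{s, t} \<in> T" "s < t"
    have v: "s \<in> V" "t \<in> V" using triang_verts[OF T st(1)] by auto
    have 1: "\<not> crosses {a, b} {s, t}" "\<not> crosses {a, p} {s, t}"
      using T ab st p by (auto simp: triang_def plane_def)
    have 2: "t \<le> p" if "s = a" "t < b" using that pmax[of t] st v by (auto simp: S_def)
    show "\<not> crosses {p, b} {s, t}"
      using 1 2 p st(2) by (auto simp: crosses_iff)
  qed
  then show thesis using that p by blast
qed

text \<open>
Descending through the triangles below \<open>ab\<close>, one ends in a triangle two of whose edges are
sides.
\<close>

lemma ear_exists:
  assumes T: "triang V T" and fin: "finite V" and ab: "{a, b} \<in> T" "a < b"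
    and c: "c \<in> V" "a < c" "c < b"
  shows "\<exists>q p r. a \<le> q \<and> r \<le> b \<and> side V q p \<and> side V p r \<and> {q, r} \<in> T"
  using ab c
proof (induction "b - a" arbitrary: a b c rule: less_induct)
  case less
  obtain p where p: "p \<in> V" "a < p" "p < b" "{a, p} \<in> T" "{p, b} \<in> T"
    using inner_apex[OF T fin less.prems] .
  have ab: "a \<in> V" "b \<in> V" using triang_verts[OF T less.prems(1)] by auto
  show ?case
  proof (cases "side V a p \<and> side V p b")
    case True
    then show ?thesis using less.prems(1) by blast
  next
    case False
    then obtain c' where "c' \<in> V" "a < c' \<and> c' < p \<or> p < c' \<and> c' < b"
      using p ab by (auto simp: side_def not_le)
    then consider "a < c'" "c' < p" | "p < c'" "c' < b" by blast
    then show ?thesis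
    proof cases
      case 1
      have "\<exists>q p' r. a \<le> q \<and> r \<le> p \<and> side V q p' \<and> side V p' r \<and> {q, r} \<in> T"
        by (rule less.hyps[of p a c']) (use 1 p \<open>c' \<in> V\<close> in auto)
      then show ?thesis using p by (meson less_imp_le order_trans)
    next
      case 2
      have "\<exists>q p' r. p \<le> q \<and> r \<le> b \<and> side V q p' \<and> side V p' r \<and> {q, r} \<in> T"
        by (rule less.hyps[of b p c']) (use 2 p \<open>c' \<in> V\<close> in auto)
      then show ?thesis using p by (meson less_imp_le order_trans)
    qed
  qed
qed

lemma ear_only:
  assumes T: "triang V T" and c: "side V q p" "side V p r" and qr: "{q, r} \<in> T" and px: "{p, x} \<in> T"
  shows "x = q \<or> x = r"
proof -
  have "x \<in> V" "x \<noteq> p" using triang_verts[OF T px] by auto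
  then have "x \<le> q \<or> r \<le> x" using sideD[OF c(1), of x] sideD[OF c(2), of x] by auto
  then show ?thesis
    using plane_notcross[OF triangD(2)[OF T] qr px] c by (auto simp: crosses_iff side_def)
qed

lemma crosses_consec:
  assumes "side V q p" "side V p r" "s \<in> V" "t \<in> V"
  shows "\<not> crosses {q, p} {s, t}" "\<not> crosses {p, r} {s, t}"
  using sideD[OF assms(1), of s] sideD[OF assms(1), of t] sideD[OF assms(2), of s] sideD[OF assms(2), of t]
    assms by (auto simp: crosses_iff side_def)

text \<open>
The sides at the tip of an ear are crossed by nothing, so removing them keeps the set of
edges maximal.
\<close>

lemma triang_delete_ear:
  assumes T: "triang V T" and c: "side V q p" "side V p r" and qr: "{q, r} \<in> T"
  shows "triang (V - {p}) (T - {{q, p}, {p, r}})"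
  unfolding triang_def
proof (intro conjI ballI impI)
  show "T - {{q, p}, {p, r}} \<subseteq> chords (V - {p})"
  proof
    fix e assume e: "e \<in> T - {{q, p}, {p, r}}"
    then obtain s t where st: "e = {s, t}" "s < t" "s \<in> V" "t \<in> V"
      using triangD(1)[OF T] by (metis DiffD1 chordsE subsetD)
    have "s \<noteq> p" using ear_only[OF T c qr, of t] e st by (auto simp: insert_commute)
    moreover have "t \<noteq> p" using ear_only[OF T c qr, of s] e st by (auto simp: insert_commute)
    ultimately show "e \<in> chords (V - {p})" using st by auto
  qed
  show "plane (T - {{q, p}, {p, r}})" using triangD(2)[OF T] by (auto simp: plane_def)
  fix e assume e: "e \<in> chords (V - {p})" and nc: "\<forall>f\<in>T - {{q, p}, {p, r}}. \<not> crosses e f"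
  obtain s t where st: "e = {s, t}" "s \<in> V" "t \<in> V" "s \<noteq> p" "t \<noteq> p"
    using e by (auto elim!: chordsE)
  have "\<not> crosses e {q, p}" "\<not> crosses e {p, r}"
    using crosses_consec[OF c st(2,3)] st(1) crosses_sym by auto
  then have "\<forall>f\<in>T. \<not> crosses e f" using nc by blast
  moreover have "e \<in> chords V" using e chords_mono[of "V - {p}" V] by blast
  ultimately have "e \<in> T" using T by (auto simp: triang_def)
  then show "e \<in> T - {{q, p}, {p, r}}" using st by (auto simp: doubleton_eq_iff)
qed

text \<open>
By induction: cutting off an ear removes one vertex and two edges.
\<close>

lemma card_triang:
  assumes "triang V T" "finite V" "card V \<ge> 2"
  shows "card T + 3 = 2 * card V"
  using assms
proof (induction "card V" arbitrary: V T rule: less_induct)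
  case less
  define a b where "a = Min V" and "b = Max V"
  have ne: "V \<noteq> {}" using less.prems(3) by auto
  have ab: "a \<in> V" "b \<in> V" "\<And>x. x \<in> V \<Longrightarrow> a \<le> x \<and> x \<le> b"
    using less.prems(2) ne by (auto simp: a_def b_def)
  have "a \<noteq> b"
  proof
    assume "a = b"
    then have "V \<subseteq> {a}" using ab by force
    then have "card V \<le> card {a}" by (intro card_mono) auto
    then show False using less.prems(3) by simp
  qed
  then have "a < b" using ab(3)[OF ab(2)] by auto
  have abT: "{a, b} \<in> T" by (rule outer_mem[OF less.prems(1) ab(1,2) \<open>a < b\<close> ab(3)])
  show ?case
  proof (cases "V = {a, b}")
    case True
    have "T = {{a, b}}" using abT triangD(1)[OF less.prems(1)] True
      by (auto simp: chords_def card_2_iff doubleton_eq_iff)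
    then show ?thesis using True \<open>a < b\<close> by simp
  next
    case False
    then obtain c where "c \<in> V" "c \<noteq> a" "c \<noteq> b" using ab by blast
    then have c: "c \<in> V" "a < c" "c < b" using ab(3)[of c] by auto
    obtain q p r where e: "side V q p" "side V p r" "{q, r} \<in> T"
      using ear_exists[OF less.prems(1,2) abT \<open>a < b\<close> c] by blast
    have sub: "{{q, p}, {p, r}} \<subseteq> T" using side_mem[OF less.prems(1)] e by auto
    have "{q, p} \<noteq> {p, r}" using e by (auto simp: side_def doubleton_eq_iff)
    then have c2: "card {{q, p}, {p, r}} = 2" by simp
    have finT: "finite T" using finite_subset[OF triangD(1)[OF less.prems(1)] finite_chords[OF less.prems(2)]] .
    have "card (T - {{q, p}, {p, r}}) = card T - 2" "2 \<le> card T"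
      using card_Diff_subset[of "{{q, p}, {p, r}}" T] card_mono[OF finT sub] c2 sub by auto
    moreover have "card {a, b, c} \<le> card V" using ab c less.prems(2) by (intro card_mono) auto
    then have "3 \<le> card V" using c \<open>a < b\<close> by simp
    moreover have "card (V - {p}) = card V - 1" using e by (simp add: side_def)
    ultimately have "card (T - {{q, p}, {p, r}}) + 3 = 2 * card (V - {p})"
      using less.hyps[OF _ triang_delete_ear[OF less.prems(1) e]] less.prems(2) by simp
    then show ?thesis
      using \<open>card (T - {{q, p}, {p, r}}) = card T - 2\<close> \<open>2 \<le> card T\<close> \<open>3 \<le> card V\<close>
        \<open>card (V - {p}) = card V - 1\<close> by linarith
  qed
qed

lemma finite_triang: "triang V T \<Longrightarrow> finite V \<Longrightarrow> finite T"
  using finite_subset[OF triangD(1) finite_chords] .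

lemma plane_extends:
  assumes "finite V" "S \<subseteq> chords V" "plane S"
  obtains T where "triang V T" "S \<subseteq> T"
proof -
  let ?F = "{T. S \<subseteq> T \<and> T \<subseteq> chords V \<and> plane T}"
  have "finite ?F" by (rule finite_subset[of _ "Pow (chords V)"]) (use assms(1) finite_chords in auto)
  moreover have "S \<in> ?F" using assms by auto
  ultimately obtain T where T: "T \<in> ?F" "\<And>T'. T' \<in> ?F \<Longrightarrow> T \<subseteq> T' \<Longrightarrow> T = T'"
    by (metis (no_types, lifting) finite_has_maximal2)
  have "triang V T" unfolding triang_def
  proof (intro conjI ballI impI)
    show "T \<subseteq> chords V" "plane T" using T(1) by auto
    fix e assume e: "e \<in> chords V" "\<forall>f\<in>T. \<not> crosses e f"
    have "\<not> crosses e e" by (auto simp: crosses_def doubleton_eq_iff)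
    then have "plane (insert e T)" using e T(1) by (auto simp: plane_def crosses_sym)
    then have "T = insert e T" using T(1) e by (intro T(2)) auto
    then show "e \<in> T" by blast
  qed
  then show thesis using that T(1) by auto
qed

lemma card_plane_le:
  assumes "finite V" "card V \<ge> 2" "S \<subseteq> chords V" "plane S"
  shows "card S + 3 \<le> 2 * card V"
proof -
  obtain T where T: "triang V T" "S \<subseteq> T" using plane_extends assms by blast
  then show ?thesis
    using card_triang[OF T(1) assms(1,2)] card_mono[OF finite_triang[OF T(1) assms(1)] T(2)] by simp
qed

text \<open>
Together with the previous facts this makes counting edges a test for being a triangulation,
by which the triangulations constructed below are recognised.
\<close>

lemma triang_of_card:
  assumes "finite V" "card V \<ge> 2" "S \<subseteq> chords V" "plane S" "2 * card V \<le> card S + 3"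
  shows "triang V S"
proof -
  obtain T where T: "triang V T" "S \<subseteq> T" using plane_extends assms by blast
  have "S = T"
    using card_triang[OF T(1) assms(1,2)] card_seteq[OF finite_triang[OF T(1) assms(1)] T(2)] assms(5) by simp
  then show ?thesis using T by simp
qed

lemma triang_subset_eq:
  assumes "triang V S" "triang V T" "S \<subseteq> T"
  shows "S = T"
  using assms unfolding triang_def plane_def by blast

section \<open>Contracting a side of the polygon\<close>

definition edge_image :: "(nat \<Rightarrow> nat) \<Rightarrow> nat set set \<Rightarrow> nat set set" where
  "edge_image f T = {f ` e |e. e \<in> T \<and> card (f ` e) = 2}"

lemma edge_image_mem: "{a, b} \<in> T \<Longrightarrow> f a \<noteq> f b \<Longrightarrow> {f a, f b} \<in> edge_image f T"
  by (auto simp: edge_image_def intro!: exI[of _ "{a, b}"])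

lemma edge_imageE:
  assumes "e \<in> edge_image f T" "T \<subseteq> chords V"
  obtains a b where "e = {f a, f b}" "{a, b} \<in> T" "a \<in> V" "b \<in> V" "f a \<noteq> f b"
proof -
  obtain e' where e': "e = f ` e'" "e' \<in> T" "card (f ` e') = 2"
    using assms(1) by (auto simp: edge_image_def)
  obtain a b where "e' = {a, b}" "a \<in> V" "b \<in> V"
    using e'(2) assms(2) by (meson chordsE subsetD)
  then show thesis using that[of a b] e' by (cases "f a = f b") auto
qed

lemma edge_image_comp:
  assumes "T \<subseteq> chords V"
  shows "edge_image f (edge_image g T) = edge_image (\<lambda>x. f (g x)) T"
proof (intro equalityI subsetI)
  fix e assume e: "e \<in> edge_image f (edge_image g T)"
  have "edge_image g T \<subseteq> chords UNIV" using assms by (auto elim!: edge_imageE[OF _ assms])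
  then obtain a b where ab: "e = {f a, f b}" "{a, b} \<in> edge_image g T" "f a \<noteq> f b" using edge_imageE[OF e] by metis
  obtain c d where "{a, b} = {g c, g d}" "{c, d} \<in> T" using edge_imageE[OF ab(2) assms] by metis
  then show "e \<in> edge_image (\<lambda>x. f (g x)) T"
    using ab edge_image_mem[of c d T "\<lambda>x. f (g x)"] by (auto simp: doubleton_eq_iff insert_commute)
next
  fix e assume "e \<in> edge_image (\<lambda>x. f (g x)) T"
  then obtain a b where "e = {f (g a), f (g b)}" "{a, b} \<in> T" "f (g a) \<noteq> f (g b)"
    using edge_imageE[OF _ assms] by metis
  then show "e \<in> edge_image f (edge_image g T)" by (metis edge_image_mem)
qed

lemma edge_image_cong:
  assumes "T \<subseteq> chords V" "\<And>x. x \<in> V \<Longrightarrow> f x = g x"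
  shows "edge_image f T = edge_image g T"
proof -
  have "f ` e = g ` e" if "e \<in> T" for e
    using that assms by (intro image_cong) (auto simp: chords_def)
  then show ?thesis unfolding edge_image_def by (metis (no_types, lifting))
qed

lemma edge_image_id:
  assumes "T \<subseteq> chords V" "\<And>x. x \<in> V \<Longrightarrow> f x = x"
  shows "edge_image f T = T"
proof -
  have "edge_image f T = edge_image (\<lambda>x. x) T" using edge_image_cong[OF assms(1), of f "\<lambda>x. x"] assms(2) by simp
  also have "\<dots> = T" using assms(1) by (auto simp: edge_image_def chords_def)
  finally show ?thesis .
qed

text \<open>
Contracting sides, one after the other, amounts to a monotone map onto the surviving
vertices that fixes them.
\<close>

definition mono_retract :: "nat set \<Rightarrow> nat set \<Rightarrow> (nat \<Rightarrow> nat) \<Rightarrow> bool" where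
  "mono_retract V W f \<longleftrightarrow> W \<subseteq> V \<and> mono_on V f \<and> f ` V \<subseteq> W \<and> (\<forall>x\<in>W. f x = x)"

text \<open>
A monotone map reflects strict inequalities, hence it creates no crossings.
\<close>

lemma crosses_image:
  assumes "mono_on V f" "a \<in> V" "b \<in> V" "c \<in> V" "d \<in> V" "crosses {f a, f b} {f c, f d}"
  shows "crosses {a, b} {c, d}"
proof -
  have m: "x < y" if "f x < f y" "x \<in> V" "y \<in> V" for x y
    using mono_onD[OF assms(1) that(3,2)] that(1) by linarith
  note ms = m[OF _ assms(2,4)] m[OF _ assms(4,2)] m[OF _ assms(2,5)] m[OF _ assms(5,2)]
      m[OF _ assms(3,4)] m[OF _ assms(4,3)] m[OF _ assms(3,5)] m[OF _ assms(5,3)]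
  show ?thesis
    using assms(6) unfolding crosses_iff by (elim disjE conjE) (simp_all add: ms)
qed

lemma edge_image_plane:
  assumes f: "mono_retract V W f" and T: "T \<subseteq> chords V" "plane T"
  shows "edge_image f T \<subseteq> chords W" "plane (edge_image f T)"
proof -
  show "edge_image f T \<subseteq> chords W"
    using f by (auto elim!: edge_imageE[OF _ T(1)] simp: mono_retract_def image_subset_iff)
  show "plane (edge_image f T)" unfolding plane_def
  proof (intro ballI notI)
    fix d e assume de: "d \<in> edge_image f T" "e \<in> edge_image f T" "crosses d e"
    obtain a b where ab: "d = {f a, f b}" "{a, b} \<in> T" "a \<in> V" "b \<in> V" using edge_imageE[OF de(1) T(1)] .
    obtain c c' where c: "e = {f c, f c'}" "{c, c'} \<in> T" "c \<in> V" "c' \<in> V" using edge_imageE[OF de(2) T(1)] .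
    have "mono_on V f" using f by (simp add: mono_retract_def)
    then have "crosses {a, b} {c, c'}" using crosses_image ab c de(3) by metis
    then show False using T(2) ab(2) c(2) by (auto simp: plane_def)
  qed
qed

definition pull :: "nat \<Rightarrow> nat \<Rightarrow> nat \<Rightarrow> nat" where
  "pull p q x = (if x = p then q else x)"

lemma pull_simps [simp]: "pull p q p = q" "pull p q q = q" "x \<noteq> p \<Longrightarrow> pull p q x = x"
  by (simp_all add: pull_def)

text \<open>
The unordered version of a side, since a vertex may be contracted to either side.
\<close>

definition nextto :: "nat set \<Rightarrow> nat \<Rightarrow> nat \<Rightarrow> bool" where
  "nextto V p q \<longleftrightarrow> side V p q \<or> side V q p"

lemma mono_retract_pull: "nextto V p q \<Longrightarrow> mono_retract V (V - {p}) (pull p q)"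
  unfolding mono_retract_def nextto_def side_def pull_def
  by (auto intro!: mono_onI)

lemma nextto_mem: "triang V T \<Longrightarrow> nextto V p q \<Longrightarrow> {p, q} \<in> T"
  using side_mem[of V T p q] side_mem[of V T q p] by (auto simp: nextto_def insert_commute)

lemma nexttoD: "nextto V p q \<Longrightarrow> p \<in> V \<and> q \<in> V \<and> p \<noteq> q"
  by (auto simp: nextto_def side_def)

text \<open>
Two triangles on the same side of the polygon would overlap: \<open>px\<close> crosses \<open>qy\<close> or \<open>py\<close>
crosses \<open>qx\<close>.
\<close>

lemma apex_unique:
  assumes "plane T" "T \<subseteq> chords V" "nextto V p q"
    and "{p, x} \<in> T" "{q, x} \<in> T" "{p, y} \<in> T" "{q, y} \<in> T"
  shows "x = y"
proof -
  have V: "x \<in> V" "y \<in> V" "x \<noteq> p" "x \<noteq> q" "y \<noteq> p" "y \<noteq> q"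
    using assms(2,4-7) chords_iff by blast+
  have nc: "\<not> crosses {p, x} {q, y}" "\<not> crosses {p, y} {q, x}"
    using assms by (auto simp: plane_def)
  have "x \<noteq> y \<Longrightarrow> False" if "p < q" "x < p \<or> q < x" "y < p \<or> q < y"
    using that nc by (auto simp: crosses_iff)
  moreover have "x \<noteq> y \<Longrightarrow> False" if "q < p" "x < q \<or> p < x" "y < q \<or> p < y"
    using that nc by (auto simp: crosses_iff)
  moreover have "p < q \<and> (x < p \<or> q < x) \<and> (y < p \<or> q < y)" if "side V p q"
    using sideD[OF that V(1)] sideD[OF that V(2)] V that by (auto simp: side_def)
  moreover have "q < p \<and> (x < q \<or> p < x) \<and> (y < q \<or> p < y)" if "side V q p"
    using sideD[OF that V(1)] sideD[OF that V(2)] V that by (auto simp: side_def)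
  ultimately show ?thesis using assms(3) unfolding nextto_def by blast
qed

text \<open>
Both claims come from counting. The contraction removes the edge \<open>pq\<close>, and it identifies
\<open>pz\<close> with \<open>qz\<close> exactly when \<open>z\<close> is a common neighbour. The image is plane on one vertex
less, so it has at least two edges less than the original; therefore a common neighbour
exists. As it is unique, the image has exactly two edges less and is a triangulation.
\<close>

lemma pull_triang:
  assumes T: "triang V T" and fin: "finite V" and n: "3 \<le> card V" and pq: "nextto V p q"
  shows "triang (V - {p}) (edge_image (pull p q) T)" (is ?A)
    and "\<exists>x. {p, x} \<in> T \<and> {q, x} \<in> T" (is ?B)
proof -
  let ?I = "edge_image (pull p q) T"
  note TV = triangD(1)[OF T]
  have pqV: "p \<in> V" "q \<in> V" "p \<noteq> q" using nexttoD[OF pq] by auto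
  have I: "?I \<subseteq> chords (V - {p})" "plane ?I"
    using edge_image_plane[OF mono_retract_pull[OF pq] triangD[OF T]] .
  have cV: "card (V - {p}) = card V - 1" using pqV by simp
  have finI: "finite ?I" using finite_subset[OF I(1)] finite_chords fin by blast
  have finT: "finite T" using finite_triang[OF T fin] .
  have pqT: "{p, q} \<in> T" using nextto_mem[OF T pq] .
  have cT: "card T + 3 = 2 * card V" using card_triang[OF T fin] n by simp
  define g where "g = (\<lambda>e. pull p q ` e)"
  have ge: "g {a, b} = {pull p q a, pull p q b}" for a b by (auto simp: g_def)
  have gI: "g ` (T - {{p, q}}) \<subseteq> ?I"
  proof
    fix e assume "e \<in> g ` (T - {{p, q}})"
    then obtain d where d: "d \<in> T" "d \<noteq> {p, q}" "e = g d" by blast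
    then obtain a b where ab: "{a, b} \<in> T" "{a, b} \<noteq> {p, q}" "e = g {a, b}"
      using triang_edge[OF T d(1)] by blast
    have "a \<noteq> b" using triang_verts[OF T ab(1)] by auto
    then have "pull p q a \<noteq> pull p q b" using ab(2) by (auto simp: insert_commute pull_def split: if_splits)
    then show "e \<in> ?I" using edge_image_mem[OF ab(1), of "pull p q"] ab(3) ge by simp
  qed
  have fib: "\<exists>z. (d = {p, z} \<and> e = {q, z} \<or> d = {q, z} \<and> e = {p, z})"
    if fb: "d \<in> T - {{p, q}}" "e \<in> T - {{p, q}}" "g d = g e" "d \<noteq> e" for d e
  proof -
    have avoid: "g e = e" if "p \<notin> e" for e
      using that unfolding g_def pull_def by (auto simp: image_iff)
    have at_p: "\<exists>z. e = {p, z} \<and> z \<noteq> q \<and> g e = {q, z}" if e: "e \<in> T - {{p, q}}" "p \<in> e" for e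
    proof -
      obtain a b where ab: "e = {a, b}" "a < b" using triang_edge[OF T, of e] e(1) by auto
      then have "\<exists>z. e = {p, z} \<and> z \<noteq> p" using e(2) by (metis insert_commute insertE order_less_irrefl singletonD)
      then obtain z where z: "e = {p, z}" "z \<noteq> p" by blast
      then show ?thesis using e(1) ge[of p z] by auto
    qed
    show ?thesis
    proof (cases "p \<in> d"; cases "p \<in> e")
      assume "p \<in> d" "p \<in> e"
      then obtain y z where "d = {p, y}" "g d = {q, y}" "e = {p, z}" "y \<noteq> q" "g e = {q, z}"
        using at_p[OF fb(1)] at_p[OF fb(2)] by metis
      then show ?thesis using fb(3,4) by (metis doubleton_eq_iff)
    next
      assume "p \<in> d" "p \<notin> e"
      then show ?thesis using at_p[OF fb(1)] avoid[of e] fb(3) by metis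
    next
      assume "p \<notin> d" "p \<in> e"
      then show ?thesis using at_p[OF fb(2)] avoid[of d] fb(3) by metis
    next
      assume "p \<notin> d" "p \<notin> e"
      then show ?thesis using avoid[of d] avoid[of e] fb(3,4) by metis
    qed
  qed
  have B: ?B
  proof (rule ccontr)
    assume "\<not> ?B"
    then have "inj_on g (T - {{p, q}})" using fib unfolding inj_on_def by (metis DiffD1)
    then have "card (T - {{p, q}}) \<le> card ?I" using card_mono[OF finI gI] by (simp add: card_image)
    moreover have "card (T - {{p, q}}) = card T - 1" using pqT by simp
    moreover have "card ?I + 3 \<le> 2 * card (V - {p})"
      by (rule card_plane_le) (use fin cV n I in auto)
    ultimately show False using cT cV n by simp
  qed
  then show ?B .
  then obtain x where x: "{p, x} \<in> T" "{q, x} \<in> T" by blast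
  have "inj_on g (T - {{p, q}, {p, x}})"
  proof (rule inj_onI, rule ccontr)
    fix d e assume de: "d \<in> T - {{p, q}, {p, x}}" "e \<in> T - {{p, q}, {p, x}}" "g d = g e" "d \<noteq> e"
    obtain z where z: "d = {p, z} \<and> e = {q, z} \<or> d = {q, z} \<and> e = {p, z}"
      using fib[of d e] de by blast
    then have "{p, z} \<in> T" "{q, z} \<in> T" using de by auto
    then have "z = x" using apex_unique[OF triangD(2)[OF T] TV pq] x by blast
    then show False using z de by auto
  qed
  moreover have "g ` (T - {{p, q}, {p, x}}) \<subseteq> ?I" using gI by blast
  ultimately have "card (T - {{p, q}, {p, x}}) \<le> card ?I" by (metis card_image card_mono finI)
  moreover have "{p, q} \<noteq> {p, x}" using triang_verts[OF T x(2)] by (auto simp: doubleton_eq_iff)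
  then have "card (T - {{p, q}, {p, x}}) = card T - 2"
    using pqT x finT by (subst card_Diff_subset) auto
  ultimately show ?A
    using I cV n cT fin by (intro triang_of_card) auto
qed

section \<open>Flips under contraction\<close>

text \<open>
Each triangulation has at most one edge that the other lacks. This is a flip or an equality;
allowing the latter makes the relation stable under contraction.
\<close>

definition flip_step :: "nat set \<Rightarrow> nat set set \<Rightarrow> nat set set \<Rightarrow> bool" where
  "flip_step V T U \<longleftrightarrow> triang V T \<and> triang V U \<and> (\<exists>e f. U \<subseteq> insert f T \<and> T \<subseteq> insert e U)"

lemma edge_image_subset_insert: "U \<subseteq> insert f T \<Longrightarrow> edge_image g U \<subseteq> insert (g ` f) (edge_image g T)"
  unfolding edge_image_def by blast

lemma flip_step_sym: "flip_step V T U \<Longrightarrow> flip_step V U T"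
  by (auto simp: flip_step_def)

lemma flip_step_pull:
  assumes a: "flip_step V T U" and fin: "finite V" and n: "3 \<le> card V" and pq: "nextto V p q"
  shows "flip_step (V - {p}) (edge_image (pull p q) T) (edge_image (pull p q) U)"
proof -
  let ?g = "pull p q"
  obtain e f where ef: "U \<subseteq> insert f T" "T \<subseteq> insert e U" using a by (auto simp: flip_step_def)
  have "edge_image ?g U \<subseteq> insert (?g ` f) (edge_image ?g T)" "edge_image ?g T \<subseteq> insert (?g ` e) (edge_image ?g U)"
    by (rule edge_image_subset_insert[OF ef(1)], rule edge_image_subset_insert[OF ef(2)])
  moreover have "triang V T" "triang V U" using a by (auto simp: flip_step_def)
  ultimately show ?thesis
    unfolding flip_step_def by (intro conjI exI pull_triang(1)[OF _ fin n pq])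
qed

text \<open>
If the flip changes the triangle \<open>pqx\<close>, it removes \<open>px\<close> or \<open>qx\<close>. The contraction identifies
these two edges, so the removed edge keeps its image.
\<close>

lemma flip_step_pull_trivial:
  assumes a: "flip_step V T U" and fin: "finite V" and n: "3 \<le> card V" and pq: "nextto V p q"
    and x: "{p, x} \<in> T" "{q, x} \<in> T" "\<not> ({p, x} \<in> U \<and> {q, x} \<in> U)"
  shows "edge_image (pull p q) T = edge_image (pull p q) U"
proof -
  let ?g = "pull p q"
  have T: "triang V T" "triang V U" using a by (auto simp: flip_step_def)
  obtain e f where ef: "U \<subseteq> insert f T" "T \<subseteq> insert e U" using a by (auto simp: flip_step_def)
  have e: "e = {p, x} \<and> {q, x} \<in> U \<or> e = {q, x} \<and> {p, x} \<in> U"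
    using x ef(2) triang_verts[OF T(1) x(1)] triang_verts[OF T(1) x(2)] nexttoD[OF pq]
    by (auto simp: doubleton_eq_iff)
  have xp: "x \<noteq> p" "x \<noteq> q" using triang_verts[OF T(1) x(1)] triang_verts[OF T(1) x(2)] by auto
  have 1: "?g ` e = {q, x}" using e xp by auto
  have "{q, x} \<in> edge_image ?g U" using e xp edge_image_mem[of q x U ?g] edge_image_mem[of p x U ?g] by auto
  then have "edge_image ?g T \<subseteq> edge_image ?g U" using edge_image_subset_insert[OF ef(2), of ?g] unfolding 1 by blast
  then show ?thesis using triang_subset_eq pull_triang(1)[OF _ fin n pq] T by blast
qed

text \<open>
Paths of a given length in the flip graph, in which steps may be idle.
\<close>

inductive reach :: "nat set \<Rightarrow> nat \<Rightarrow> nat set set \<Rightarrow> nat set set \<Rightarrow> bool" for V where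
  reach_refl: "triang V T \<Longrightarrow> reach V 0 T T"
| reach_step: "flip_step V T U \<Longrightarrow> reach V L U W \<Longrightarrow> reach V (Suc L) T W"

lemma reach_triang: "reach V L T U \<Longrightarrow> triang V T \<and> triang V U"
  by (induction rule: reach.induct) (auto simp: flip_step_def)

lemma reach_pull:
  assumes "reach V L T U" "finite V" "3 \<le> card V" "nextto V p q"
  shows "reach (V - {p}) L (edge_image (pull p q) T) (edge_image (pull p q) U)"
  using assms
proof (induction rule: reach.induct)
  case (reach_refl T)
  then show ?case by (intro reach.reach_refl pull_triang(1))
next
  case (reach_step T U L W)
  show ?case
    by (rule reach.reach_step[OF flip_step_pull[OF reach_step.hyps(1)]]) (use reach_step in auto)
qed

text \<open>
Some step of the path is the first one at which the triangle \<open>pqx\<close> is lost, and this step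
becomes idle.
\<close>

lemma reach_pull_shorter:
  assumes "reach V L T U" and fin: "finite V" and n: "3 \<le> card V" and pq: "nextto V p q"
    and "{p, x} \<in> T" "{q, x} \<in> T" "\<not> ({p, x} \<in> U \<and> {q, x} \<in> U)"
  shows "\<exists>L'<L. reach (V - {p}) L' (edge_image (pull p q) T) (edge_image (pull p q) U)"
  using assms(1,5-7)
proof (induction rule: reach.induct)
  case (reach_refl T)
  then show ?case by blast
next
  case (reach_step T U L W)
  show ?case
  proof (cases "{p, x} \<in> U \<and> {q, x} \<in> U")
    case True
    then obtain L' where "L' < L" "reach (V - {p}) L' (edge_image (pull p q) U) (edge_image (pull p q) W)"
      using reach_step by blast
    then show ?thesis
      using reach.reach_step[OF flip_step_pull[OF reach_step.hyps(1) fin n pq]] by (metis Suc_mono)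
  next
    case False
    have "edge_image (pull p q) T = edge_image (pull p q) U"
      using flip_step_pull_trivial[OF reach_step.hyps(1) fin n pq _ _ False] reach_step.prems by blast
    then show ?thesis using reach_pull[OF reach_step.hyps(2) fin n pq] by auto
  qed
qed

text \<open>
As long as \<open>qr\<close> is present, \<open>p\<close> is the tip of an ear. The step that removes \<open>qr\<close> changes the
triangles on both \<open>qp\<close> and \<open>pr\<close>. It adds a single edge at \<open>p\<close>, so that the new triangles
share their third vertex. Since \<open>x \<noteq> y\<close>, at least one of the two sides has not yet
received its final triangle, and it will change once more. Contracting this side saves two
steps.
\<close>

lemma reach_pull_ear:
  assumes "reach V L T W" and fin: "finite V" and n: "3 \<le> card V"
    and c: "side V q p" "side V p r" and qr: "{q, r} \<in> T"
    and x: "{q, x} \<in> W" "{p, x} \<in> W" and y: "{p, y} \<in> W" "{r, y} \<in> W" and xy: "x \<noteq> y" "x \<noteq> r"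
  shows "\<exists>L' s. L' + 2 \<le> L \<and> (s = q \<or> s = r) \<and> reach (V - {p}) L' (edge_image (pull p s) T) (edge_image (pull p s) W)"
  using assms(1) qr x y
proof (induction rule: reach.induct)
  case (reach_refl T)
  note T = reach_refl(1)
  have "{p, r} \<in> T" using side_mem[OF T c(2)] .
  have n: "nextto V q p" using c by (simp add: nextto_def)
  have "x = r" using apex_unique[OF triangD(2,1)[OF T] n] reach_refl \<open>{p, r} \<in> T\<close> by blast
  then show ?case using xy by blast
next
  case (reach_step T U L W)
  have nx: "nextto V p q" "nextto V p r" using c by (auto simp: nextto_def)
  have T: "triang V T" "triang V U" using reach_step(1) by (auto simp: flip_step_def)
  have W: "triang V W" using reach_triang[OF reach_step(2)] by simp
  show ?case
  proof (cases "{q, r} \<in> U")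
    case True
    then obtain L' s where L': "L' + 2 \<le> L" "s = q \<or> s = r"
      "reach (V - {p}) L' (edge_image (pull p s) U) (edge_image (pull p s) W)"
      using reach_step by blast
    have "nextto V p s" using nx L'(2) by blast
    then have "reach (V - {p}) (Suc L') (edge_image (pull p s) T) (edge_image (pull p s) W)"
      using reach.reach_step[OF flip_step_pull[OF reach_step.hyps(1) fin n]] L'(3) by blast
    then show ?thesis using L' by (intro exI[of _ "Suc L'"] exI[of _ s]) auto
  next
    case False
    have bd: "{p, r} \<in> T" "{q, p} \<in> T" "{r, p} \<in> T" "{p, q} \<in> T"
      using side_mem[OF T(1) c(1)] side_mem[OF T(1) c(2)] by (simp_all add: insert_commute)
    have eq: "edge_image (pull p q) T = edge_image (pull p q) U" "edge_image (pull p r) T = edge_image (pull p r) U"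
      using flip_step_pull_trivial[OF reach_step.hyps(1) fin n nx(1), of r]
        flip_step_pull_trivial[OF reach_step.hyps(1) fin n nx(2), of q] bd reach_step.prems(1) False
      by (auto simp: insert_commute)
    obtain x' y' where x': "{p, x'} \<in> U" "{q, x'} \<in> U" and y': "{p, y'} \<in> U" "{r, y'} \<in> U"
      using pull_triang(2)[OF T(2) fin n] nx by metis
    \<comment> \<open>Besides the two sides, the added edge is the only one at \<open>p\<close>, so the new triangles share it.\<close>
    have "x' \<noteq> r" "y' \<noteq> q" using False x' y' by (auto simp: insert_commute)
    moreover have "x' \<noteq> q" "y' \<noteq> r" using triang_verts[OF T(2)] x' y' by blast+
    ultimately have "{p, x'} \<notin> T" "{p, y'} \<notin> T"
      using ear_only[OF T(1) c reach_step.prems(1)] by blast+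
    then have "{p, x'} = {p, y'}" using x' y' reach_step.hyps(1) by (auto simp: flip_step_def)
    then have xy': "x' = y'" by (auto simp: doubleton_eq_iff)
    obtain s where s: "s = q \<or> s = r" "{s, x'} \<in> U" "\<not> ({p, x'} \<in> W \<and> {s, x'} \<in> W)"
    proof (cases "x' = x")
      case True
      then have "\<not> ({p, x'} \<in> W \<and> {r, x'} \<in> W)"
        using apex_unique[OF triangD(2,1)[OF W] nx(2), of x y] reach_step.prems xy by auto
      then show ?thesis using that[of r] y' xy' by blast
    next
      case False
      then have "\<not> ({p, x'} \<in> W \<and> {q, x'} \<in> W)"
        using apex_unique[OF triangD(2,1)[OF W] nx(1), of x x'] reach_step.prems by auto
      then show ?thesis using that[of q] x' by blast
    qed
    have "nextto V p s" using nx s(1) by blast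
    then obtain L' where "L' < L" "reach (V - {p}) L' (edge_image (pull p s) U) (edge_image (pull p s) W)"
      using reach_pull_shorter[OF reach_step.hyps(2) fin n _ x'(1) s(2,3)] by blast
    then show ?thesis using eq s(1) by (intro exI[of _ L'] exI[of _ s]) auto
  qed
qed

section \<open>Collapsing a pocket\<close>

lemma predecessor_exists:
  assumes "finite V" "p \<in> V" "x \<in> V" "x < p"
  obtains q where "side V q p" "x \<le> q"
proof -
  let ?q = "Max {y\<in>V. y < p}"
  have "?q \<in> {y\<in>V. y < p}" by (rule Max_in) (use assms in auto)
  moreover have m: "y \<le> ?q" if "y \<in> V" "y < p" for y using that assms by simp
  moreover have "\<forall>y\<in>V. y \<le> ?q \<or> p \<le> y" using m by (meson not_le)
  ultimately have "side V ?q p" using assms(2) by (simp add: side_def)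
  then show thesis using that m[OF assms(3,4)] by blast
qed

lemma successor_exists:
  assumes "finite V" "p \<in> V" "x \<in> V" "p < x"
  obtains q where "side V p q" "q \<le> x"
proof -
  let ?q = "Min {y\<in>V. p < y}"
  have "?q \<in> {y\<in>V. p < y}" by (rule Min_in) (use assms in auto)
  moreover have m: "?q \<le> y" if "y \<in> V" "p < y" for y using that assms by simp
  moreover have "\<forall>y\<in>V. y \<le> p \<or> ?q \<le> y" using m by (meson not_le)
  ultimately have "side V p ?q" using assms(2) by (simp add: side_def)
  then show thesis using that m[OF assms(3,4)] by blast
qed

text \<open>
Monotonicity forces \<open>p\<close> to be identified with the next vertex on the way from \<open>p\<close> to its
image. A collapse thus splits off the contraction of a single side.
\<close>

lemma mono_retract_identifies:
  assumes f: "mono_retract V W f" and fin: "finite V" and p: "p \<in> V" "p \<notin> W"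
  obtains q where "nextto V p q" "f q = f p"
proof -
  have W: "W \<subseteq> V" "f p \<in> W" "f (f p) = f p" and mono: "mono_on V f"
    using f p unfolding mono_retract_def by auto
  have fpV: "f p \<in> V" using W by blast
  have "f p \<noteq> p" using W p by metis
  then consider "f p < p" | "p < f p" by linarith
  then show thesis
  proof cases
    case 1
    obtain q where q: "side V q p" "f p \<le> q" using predecessor_exists[OF fin p(1) fpV 1] .
    have qV: "q \<in> V" "q < p" using q(1) by (auto simp: side_def)
    have "f q = f p"
      using mono_onD[OF mono fpV qV(1) q(2)] mono_onD[OF mono qV(1) p(1)] qV(2) W(3) by simp
    then show thesis using that[of q] q(1) by (simp add: nextto_def)
  next
    case 2
    obtain q where q: "side V p q" "q \<le> f p" using successor_exists[OF fin p(1) fpV 2] .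
    have qV: "q \<in> V" "p < q" using q(1) by (auto simp: side_def)
    have "f q = f p"
      using mono_onD[OF mono qV(1) fpV q(2)] mono_onD[OF mono p(1) qV(1)] qV(2) W(3) by simp
    then show thesis using that[of q] q(1) by (simp add: nextto_def)
  qed
qed

text \<open>
The sides are contracted one at a time.
\<close>

lemma mono_retract_triang:
  assumes "mono_retract V W f" "finite V" "2 \<le> card W" "triang V T"
  shows "triang W (edge_image f T)"
  using assms
proof (induction "card (V - W)" arbitrary: V T)
  case 0
  have "V = W" using 0 by (auto simp: mono_retract_def)
  then have "edge_image f T = T" using edge_image_id[OF triangD(1)[OF 0(5)], of f] 0(2) by (auto simp: mono_retract_def)
  then show ?case using 0(5) \<open>V = W\<close> by simp
next
  case (Suc n)
  have WV: "W \<subseteq> V" using Suc.prems(1) by (simp add: mono_retract_def)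
  obtain p where p: "p \<in> V" "p \<notin> W" using Suc.hyps(2) by (metis DiffE card.empty ex_in_conv nat.simps(3))
  obtain q where q: "nextto V p q" "f q = f p" using mono_retract_identifies[OF Suc.prems(1,2) p] .
  have "insert p W \<subseteq> V" using WV p by auto
  then have "card (insert p W) \<le> card V" using Suc.prems(2) by (rule card_mono[rotated])
  then have n3: "3 \<le> card V" using p Suc.prems(2,3) finite_subset[OF WV] by simp
  have 1: "triang (V - {p}) (edge_image (pull p q) T)"
    by (rule pull_triang(1)[OF Suc.prems(4,2) n3 q(1)])
  have 2: "mono_retract (V - {p}) W f"
    using Suc.prems(1) p by (auto simp: mono_retract_def intro: mono_on_subset)
  have "V - {p} - W = V - W - {p}" by blast
  then have "n = card (V - {p} - W)" using Suc.hyps(2) p Suc.prems(2) by simp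
  then have "triang W (edge_image f (edge_image (pull p q) T))"
    using Suc.hyps(1)[OF _ 2 _ Suc.prems(3) 1] Suc.prems(2) by simp
  moreover have "edge_image f (edge_image (pull p q) T) = edge_image f T"
    unfolding edge_image_comp[OF triangD(1)[OF Suc.prems(4)]]
    by (rule edge_image_cong[OF triangD(1)[OF Suc.prems(4)]]) (auto simp: pull_def q(2))
  ultimately show ?case by simp
qed

lemma mono_retract_comp:
  assumes "mono_retract V V' g" "mono_retract V' W f"
  shows "mono_retract V W (\<lambda>x. f (g x))"
  unfolding mono_retract_def
proof (intro conjI)
  have g: "V' \<subseteq> V" "mono_on V g" "g ` V \<subseteq> V'" "\<forall>x\<in>V'. g x = x"
    and f: "W \<subseteq> V'" "mono_on V' f" "f ` V' \<subseteq> W" "\<forall>x\<in>W. f x = x"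
    using assms by (auto simp: mono_retract_def)
  show "W \<subseteq> V" using f g by blast
  show "(\<lambda>x. f (g x)) ` V \<subseteq> W" using f(3) g(3) by (simp add: image_subset_iff)
  show "\<forall>x\<in>W. f (g x) = x" using f g by auto
  show "mono_on V (\<lambda>x. f (g x))"
  proof (rule mono_onI)
    fix x y assume xy: "x \<in> V" "y \<in> V" "x \<le> y"
    have "g x \<le> g y" "g x \<in> V'" "g y \<in> V'" using mono_onD[OF g(2) xy] g(3) xy by auto
    then show "f (g x) \<le> f (g y)" using mono_onD[OF f(2)] by blast
  qed
qed

text \<open>
The sides of the polygon along the stretch from \<open>a\<close> to \<open>b\<close>.
\<close>

definition cpairs :: "nat set \<Rightarrow> nat \<Rightarrow> nat \<Rightarrow> nat set set" where
  "cpairs V a b = {{p, q} |p q. side V p q \<and> a \<le> p \<and> q \<le> b}"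

text \<open>
For a pocket between \<open>a\<close> and \<open>b\<close>, the function \<open>\<alpha>\<close> selects the third vertex of the
triangle of \<open>T\<close> on each side along the pocket. Being injective and avoiding the pocket are
exactly what two-step savings require, and both properties survive the contraction of a
pocket vertex into either of its neighbours.
\<close>

definition spread :: "nat set \<Rightarrow> nat \<Rightarrow> nat \<Rightarrow> (nat set \<Rightarrow> nat) \<Rightarrow> nat set set \<Rightarrow> bool" where
  "spread V a b \<alpha> T \<longleftrightarrow> inj_on \<alpha> (cpairs V a b) \<and>
     (\<forall>e\<in>cpairs V a b. (\<alpha> e < a \<or> b < \<alpha> e) \<and> (\<forall>u\<in>e. {u, \<alpha> e} \<in> T))"

lemma side_delete:
  assumes "side (V - {p}) u w" "side V q p" "side V p r"
  shows "side V u w \<or> u = q \<and> w = r"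
proof -
  have u: "u \<in> V" "w \<in> V" "u < w" "u \<noteq> p" "w \<noteq> p" and d: "\<And>x. x \<in> V \<Longrightarrow> x \<noteq> p \<Longrightarrow> x \<le> u \<or> w \<le> x"
    using assms(1) by (auto simp: side_def)
  show ?thesis
  proof (cases "u < p \<and> p < w")
    case True
    have "u \<le> q" "r \<le> w"
      using sideD[OF assms(2) u(1)] sideD[OF assms(3) u(2)] True by auto
    moreover have "q \<le> u \<or> w \<le> q" "r \<le> u \<or> w \<le> r" using d[of q] d[of r] assms(2,3) by (auto simp: side_def)
    ultimately show ?thesis using assms(2,3) True by (auto simp: side_def)
  next
    case False
    then show ?thesis using u d unfolding side_def by force
  qed
qed

text \<open>
Contracting \<open>p\<close> into \<open>s\<close> destroys the side \<open>ps\<close>. The new side \<open>qr\<close> inherits the triangle of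
the other side at \<open>p\<close>.
\<close>

lemma spread_pull:
  assumes sp: "spread V a b \<alpha> U" and c: "side V q p" "side V p r" and ab: "a \<le> q" "r \<le> b"
    and s: "s = q \<or> s = r"
  shows "\<exists>\<alpha>'. spread (V - {p}) a b \<alpha>' (edge_image (pull p s) U)"
proof -
  let ?P = "cpairs V a b"
  \<comment> \<open>the side at \<open>p\<close> that survives and takes over the role of \<open>qr\<close>\<close>
  define h where "h = (if s = q then {p, r} else {q, p})"
  define \<alpha>' where "\<alpha>' = \<alpha>({q, r} := \<alpha> h)"
  have lt: "q < p" "p < r" using c by (auto simp: side_def)
  have P: "{q, p} \<in> ?P" "{p, r} \<in> ?P" using c ab lt by (auto simp: cpairs_def) (metis le_trans less_imp_le)+
  then have hP: "h \<in> ?P" by (simp add: h_def)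
  have inj: "inj_on \<alpha> ?P" and out: "\<And>e. e \<in> ?P \<Longrightarrow> \<alpha> e < a \<or> b < \<alpha> e"
    and ed: "\<And>e u. e \<in> ?P \<Longrightarrow> u \<in> e \<Longrightarrow> {u, \<alpha> e} \<in> U"
    using sp by (auto simp: spread_def)
  have sub: "e = {q, r} \<or> e \<in> ?P - {h} \<and> p \<notin> e" if e: "e \<in> cpairs (V - {p}) a b" for e
  proof -
    obtain u w where uw: "e = {u, w}" "side (V - {p}) u w" "a \<le> u" "w \<le> b"
      using e by (auto simp: cpairs_def)
    have "p \<notin> e" using uw by (auto simp: side_def)
    moreover have "p \<in> h" by (simp add: h_def)
    ultimately show ?thesis using side_delete[OF uw(2) c] uw unfolding cpairs_def by auto
  qed
  have qr: "{q, r} \<notin> ?P"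
    using lt by (auto simp: cpairs_def side_def doubleton_eq_iff) (use c in \<open>auto simp: side_def\<close>)
  have \<alpha>'_other: "\<alpha>' e = \<alpha> e" if "e \<in> ?P" for e using that qr by (auto simp: \<alpha>'_def)
  have inP: "a \<le> u \<and> u \<le> b" if "e \<in> ?P" "u \<in> e" for e u
    using that by (auto simp: cpairs_def side_def)
  have img: "{pull p s u, pull p s (\<alpha> e)} \<in> edge_image (pull p s) U" "\<alpha> e \<noteq> p" if e: "e \<in> ?P" "u \<in> e" for e u
  proof -
    show p: "\<alpha> e \<noteq> p" using out[OF e(1)] lt ab by auto
    have "pull p s u \<noteq> \<alpha> e"
      using out[OF e(1)] inP[OF e] lt ab s by (auto simp: pull_def)
    then show "{pull p s u, pull p s (\<alpha> e)} \<in> edge_image (pull p s) U"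
      using edge_image_mem[OF ed[OF e], of "pull p s"] p by simp
  qed
  have "spread (V - {p}) a b \<alpha>' (edge_image (pull p s) U)" unfolding spread_def
  proof (intro conjI ballI)
    show "inj_on \<alpha>' (cpairs (V - {p}) a b)"
    proof (rule inj_onI)
      fix d e assume de: "d \<in> cpairs (V - {p}) a b" "e \<in> cpairs (V - {p}) a b" "\<alpha>' d = \<alpha>' e"
      have key: "\<alpha> d' \<noteq> \<alpha> h" if "d' \<in> ?P - {h}" for d' using that inj hP by (auto dest: inj_onD)
      have hq: "\<alpha>' {q, r} = \<alpha> h" by (simp add: \<alpha>'_def)
      from sub[OF de(1)] sub[OF de(2)] show "d = e"
        using de(3) \<alpha>'_other key hq inj by (metis DiffD1 inj_onD)
    qed
    fix e assume e: "e \<in> cpairs (V - {p}) a b"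
    consider "e = {q, r}" | "e \<in> ?P" "p \<notin> e" using sub[OF e] by blast
    then show "\<alpha>' e < a \<or> b < \<alpha>' e" using out hP \<alpha>'_other by cases (auto simp: \<alpha>'_def)
    fix u assume u: "u \<in> e"
    show "{u, \<alpha>' e} \<in> edge_image (pull p s) U"
    proof (cases "e = {q, r}")
      case True
      have "\<exists>u'\<in>h. pull p s u' = u"
        using u True s lt by (auto simp: h_def)
      then obtain u' where "u' \<in> h" "pull p s u' = u" by blast
      then show ?thesis using img[OF hP] True by (fastforce simp: \<alpha>'_def)
    next
      case False
      then have "e \<in> ?P" "p \<notin> e" using sub[OF e] by auto
      then show ?thesis using img[of e u] u \<alpha>'_other by (metis pull_simps(3))
    qed
  qed
  then show ?thesis by blast
qed

text \<open>
As long as the pocket has vertices, the edge \<open>ab\<close> lies over an ear of the first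
triangulation, and the tip of the ear can be contracted with a saving of two steps. The
direction of each contraction is imposed by the path, so nothing is known about the
resulting retraction.
\<close>

lemma reach_collapse:
  assumes "reach V L T U" "finite V" "{a, b} \<in> T" "a < b" "spread V a b \<alpha> U"
  shows "\<exists>f L'. mono_retract V (V - {a<..<b}) f \<and> L' + 2 * card (V \<inter> {a<..<b}) \<le> L \<and>
    reach (V - {a<..<b}) L' (edge_image f T) (edge_image f U)"
  using assms
proof (induction "card (V \<inter> {a<..<b})" arbitrary: V T U L \<alpha>)
  case 0
  then have "V - {a<..<b} = V" "card (V \<inter> {a<..<b}) = 0" by auto
  moreover have "mono_retract V V (\<lambda>x. x)" by (auto simp: mono_retract_def mono_on_def)
  moreover have "edge_image (\<lambda>x. x) T = T" "edge_image (\<lambda>x. x) U = U"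
    using edge_image_id[OF triangD(1)[of V T], of "\<lambda>x. x"] edge_image_id[OF triangD(1)[of V U], of "\<lambda>x. x"]
      reach_triang[OF 0(2)] by simp_all
  ultimately show ?case using 0(2) by (intro exI[of _ "\<lambda>x. x"] exI[of _ L]) simp
next
  case (Suc n)
  note T = reach_triang[OF Suc.prems(1), THEN conjunct1]
  note U = reach_triang[OF Suc.prems(1), THEN conjunct2]
  note fin = Suc.prems(2)
  have "V \<inter> {a<..<b} \<noteq> {}" using Suc.hyps(2) by (metis card.empty nat.simps(3))
  then obtain c where c: "c \<in> V" "a < c" "c < b" by auto
  have abV: "a \<in> V" "b \<in> V" using triang_verts[OF T Suc.prems(3)] by auto
  have "card {a, b, c} \<le> card V" using abV c fin by (intro card_mono) auto
  then have n3: "3 \<le> card V" using c by simp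
  obtain q p r where e: "a \<le> q" "r \<le> b" "side V q p" "side V p r" "{q, r} \<in> T"
    using ear_exists[OF T fin Suc.prems(3,4) c] by blast
  have lt: "q < p" "p < r" using e by (auto simp: side_def)
  have pab: "a < p" "p < b" using lt e by auto
  have P: "{q, p} \<in> cpairs V a b" "{p, r} \<in> cpairs V a b"
    unfolding cpairs_def using e lt by (fastforce)+
  let ?x = "\<alpha> {q, p}" and ?y = "\<alpha> {p, r}"
  have xy: "{q, ?x} \<in> U" "{p, ?x} \<in> U" "{p, ?y} \<in> U" "{r, ?y} \<in> U"
    using Suc.prems(5) P unfolding spread_def by blast+
  have "?x < a \<or> b < ?x" using Suc.prems(5) P unfolding spread_def by blast
  then have xr: "?x \<noteq> r" using lt e by auto
  have "{q, p} \<noteq> {p, r}" using lt by (auto simp: doubleton_eq_iff)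
  then have "?x \<noteq> ?y" using Suc.prems(5) P unfolding spread_def by (metis inj_onD)
  from reach_pull_ear[OF Suc.prems(1) fin n3 e(3-5) xy this xr]
  obtain L' s where L': "L' + 2 \<le> L" "s = q \<or> s = r"
    "reach (V - {p}) L' (edge_image (pull p s) T) (edge_image (pull p s) U)" by blast
  obtain \<alpha>' where \<alpha>': "spread (V - {p}) a b \<alpha>' (edge_image (pull p s) U)"
    using spread_pull[OF Suc.prems(5) e(3,4,1,2) L'(2)] by blast
  have abI: "{a, b} \<in> edge_image (pull p s) T"
    using edge_image_mem[OF Suc.prems(3), of "pull p s"] pab Suc.prems(4) by simp
  have eq: "V - {p} - {a<..<b} = V - {a<..<b}" "(V - {p}) \<inter> {a<..<b} = V \<inter> {a<..<b} - {p}"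
    using pab by auto
  have card: "card (V \<inter> {a<..<b} - {p}) = n"
    using Suc.hyps(2) pab fin e(3) by (auto simp: side_def)
  obtain f L'' where f: "mono_retract (V - {p}) (V - {a<..<b}) f" "L'' + 2 * n \<le> L'"
    "reach (V - {a<..<b}) L'' (edge_image f (edge_image (pull p s) T)) (edge_image f (edge_image (pull p s) U))"
    using Suc.hyps(1)[OF _ L'(3) _ abI Suc.prems(4) \<alpha>'] fin card unfolding eq by auto
  have "nextto V p s" using L'(2) e by (auto simp: nextto_def)
  then have "mono_retract V (V - {a<..<b}) (\<lambda>x. f (pull p s x))"
    using mono_retract_comp[OF mono_retract_pull f(1)] by blast
  moreover have "reach (V - {a<..<b}) L'' (edge_image (\<lambda>x. f (pull p s x)) T) (edge_image (\<lambda>x. f (pull p s x)) U)"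
    using f(3) edge_image_comp[OF triangD(1)[OF T]] edge_image_comp[OF triangD(1)[OF U]] by simp
  ultimately show ?case
    using f(2) L'(1) Suc.hyps(2) by (intro exI conjI) auto
qed

section \<open>Triangulations that are far from all those with given neighbours of 0\<close>

definition nbrs :: "nat set set \<Rightarrow> nat set" where
  "nbrs T = {x. {0, x} \<in> T}"

text \<open>
The edge between the two polygon neighbours of \<open>0\<close> separates \<open>0\<close> from everything else.
\<close>

definition sealed :: "nat set \<Rightarrow> nat set set \<Rightarrow> bool" where
  "sealed V T \<longleftrightarrow> (\<exists>l h. {l, h} \<in> T \<and> 0 < l \<and> l < h \<and> (\<forall>x\<in>V - {0}. l \<le> x \<and> x \<le> h))"

text \<open>
The inequality is the lower bound \<open>n - 3 + k\<close> for the distance, written without subtraction: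
here \<open>card V = n\<close> and \<open>card N = n - 1 - k\<close>.
\<close>

definition remote :: "nat set \<Rightarrow> nat set \<Rightarrow> nat set set \<Rightarrow> bool" where
  "remote V N U \<longleftrightarrow> triang V U \<and> sealed V U \<and>
     (\<forall>T L. triang V T \<longrightarrow> nbrs T = N \<longrightarrow> reach V L T U \<longrightarrow> 2 * card V \<le> L + 4 + card N)"

lemma nbrs_im:
  assumes "T \<subseteq> chords V" "g 0 = 0" "\<And>x. x \<in> V \<Longrightarrow> g x = 0 \<Longrightarrow> x = 0"
  shows "nbrs (edge_image g T) = g ` nbrs T"
proof (intro equalityI subsetI)
  fix x assume "x \<in> nbrs (edge_image g T)"
  then have "{0, x} \<in> edge_image g T" by (simp add: nbrs_def)
  then obtain a b where ab: "{0, x} = {g a, g b}" "{a, b} \<in> T" "a \<in> V" "b \<in> V" "g a \<noteq> g b"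
    using edge_imageE[OF _ assms(1)] by metis
  then consider "g a = 0" "x = g b" | "g b = 0" "x = g a" by (auto simp: doubleton_eq_iff)
  then show "x \<in> g ` nbrs T"
  proof cases
    case 1
    then have "a = 0" using assms(3) ab by blast
    then show ?thesis using ab 1 by (auto simp: nbrs_def)
  next
    case 2
    then have "b = 0" using assms(3) ab by blast
    then show ?thesis using ab 2 by (auto simp: nbrs_def insert_commute)
  qed
next
  fix x assume "x \<in> g ` nbrs T"
  then obtain y where y: "x = g y" "{0, y} \<in> T" by (auto simp: nbrs_def)
  then have "{0, y} \<in> chords V" using assms(1) by blast
  then have "y \<noteq> 0" "y \<in> V" by auto
  then have "g 0 \<noteq> g y" using assms(2,3) by metis
  then show "x \<in> nbrs (edge_image g T)" using edge_image_mem[OF y(2), of g] assms(2) y(1) by (simp add: nbrs_def)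
qed

lemma nbrs_subset: "triang V T \<Longrightarrow> nbrs T \<subseteq> V - {0}"
  using triang_verts by (auto simp: nbrs_def)

text \<open>
In a sealed triangulation \<open>0\<close> lies in a single triangle, none of whose sides is a
consecutive pair of positive labels unless the polygon is a triangle.
\<close>

lemma sealed_not_apex:
  assumes U: "triang V U" "sealed V U" and n: "4 \<le> card V" and pq: "nextto V p q"
  shows "\<not> ({p, 0} \<in> U \<and> {q, 0} \<in> U)"
proof
  assume pq0: "{p, 0} \<in> U \<and> {q, 0} \<in> U"
  obtain l h where lh: "{l, h} \<in> U" "0 < l" "l < h" "\<And>x. x \<in> V - {0} \<Longrightarrow> l \<le> x \<and> x \<le> h"
    using U(2) by (auto simp: sealed_def)
  have nc: "\<not> crosses {l, h} {p, 0}" "\<not> crosses {l, h} {q, 0}"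
    using plane_notcross[OF triangD(2)[OF U(1)] lh(1)] pq0 by auto
  have V: "p \<in> V" "q \<in> V" "p \<noteq> 0" "q \<noteq> 0" using pq0 triang_verts[OF U(1)] by blast+
  have "p = l \<or> p = h" "q = l \<or> q = h"
    using nc lh(2,3) lh(4)[of p] lh(4)[of q] V by (auto simp: crosses_iff)
  moreover have "p \<noteq> q" using nexttoD[OF pq] by simp
  ultimately have "side V l h" using pq lh(3) by (auto simp: nextto_def side_def)
  have "V \<subseteq> {0, l, h}"
  proof
    fix x assume x: "x \<in> V"
    then show "x \<in> {0, l, h}" using lh(4)[of x] sideD[OF \<open>side V l h\<close> x] by auto
  qed
  then have "card V \<le> card {0, l, h}" by (intro card_mono) auto
  also have "\<dots> \<le> 3" by (simp add: card_insert_if)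
  finally show False using n by simp
qed

lemma sealed_im:
  assumes U: "triang V U" "sealed V U" and f: "mono_retract V W f" and pos: "\<And>x. x \<in> V \<Longrightarrow> f x = 0 \<Longrightarrow> x = 0"
    and x: "x \<in> W" "y \<in> W" "0 < x" "x < y"
  shows "sealed W (edge_image f U)"
proof -
  obtain l h where lh: "{l, h} \<in> U" "0 < l" "l < h" "\<And>x. x \<in> V - {0} \<Longrightarrow> l \<le> x \<and> x \<le> h"
    using U(2) by (auto simp: sealed_def)
  have V: "l \<in> V" "h \<in> V" using triang_verts[OF U(1) lh(1)] by auto
  have W: "W \<subseteq> V" "\<And>x. x \<in> W \<Longrightarrow> f x = x" and mono: "mono_on V f" using f by (auto simp: mono_retract_def)
  have b: "f l \<le> z \<and> z \<le> f h" if "z \<in> W - {0}" for z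
  proof -
    have "z \<in> V" "f z = z" "l \<le> z" "z \<le> h" using that W lh(4)[of z] by auto
    then show ?thesis using mono_onD[OF mono, of l z] mono_onD[OF mono, of z h] V by simp
  qed
  have "f l < f h" using b[of x] b[of y] x by simp
  moreover have "0 < f l" using pos[OF V(1)] lh(2) by auto
  moreover have "{f l, f h} \<in> edge_image f U" using edge_image_mem[OF lh(1)] \<open>f l < f h\<close> by simp
  ultimately show ?thesis using b unfolding sealed_def by blast
qed

text \<open>
By monotonicity, vertices above a fixed positive vertex cannot be moved to \<open>0\<close>.
\<close>

lemma mono_retract_pos:
  assumes f: "mono_retract V W f" and W: "x \<in> W" "\<And>y. y \<in> V \<Longrightarrow> 0 < y \<Longrightarrow> y \<notin> W \<Longrightarrow> x \<le> y" "0 < x" and "y \<in> V" "f y = 0"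
  shows "y = 0"
proof (rule ccontr)
  assume "y \<noteq> 0"
  then have "y \<notin> W" using f assms(6) by (auto simp: mono_retract_def)
  then have "x \<le> y" using W(2) assms(5) \<open>y \<noteq> 0\<close> by simp
  moreover have "x \<in> V" "mono_on V f" "f x = x" using f W(1) by (auto simp: mono_retract_def)
  ultimately have "x \<le> f y" using mono_onD[of V f x y] assms(5) by simp
  then show False using assms(6) W(3) by simp
qed

text \<open>
If \<open>T\<close> is the fan at \<open>0\<close>, then its interior edges all cross the edge that seals \<open>U\<close>, and
every step removes at most one of them.
\<close>

lemma remote_fan:
  assumes fin: "finite V" and "0 \<in> V" and U: "triang V U" "sealed V U" and N: "N = V - {0}"
  shows "remote V N U"
  unfolding remote_def
proof (intro conjI allI impI U)
  fix T L assume T: "triang V T" "nbrs T = N" and r: "reach V L T U"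
  have le: "card (T - U) \<le> L" using r
  proof (induction rule: reach.induct)
    case (reach_step T U L W)
    then obtain e where e: "T \<subseteq> insert e U" by (auto simp: flip_step_def)
    have "finite U" using reach_triang[OF reach_step.hyps(2)] finite_triang fin by blast
    have "T - W \<subseteq> insert e (U - W)" using e by blast
    then have "card (T - W) \<le> card (insert e (U - W))" using \<open>finite U\<close> by (intro card_mono) auto
    also have "\<dots> \<le> Suc (card (U - W))" using \<open>finite U\<close> by (simp add: card_insert_if)
    finally show ?case using reach_step.IH by simp
  qed simp
  obtain l h where lh: "{l, h} \<in> U" "0 < l" "l < h" "\<And>x. x \<in> V - {0} \<Longrightarrow> l \<le> x \<and> x \<le> h"
    using U(2) by (auto simp: sealed_def)
  have V: "l \<in> V" "h \<in> V" using triang_verts[OF U(1) lh(1)] by auto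
  \<comment> \<open>the interior edges of the fan\<close>
  let ?F = "(\<lambda>x. {0, x}) ` (V - {0, l, h})"
  have "?F \<subseteq> T - U"
  proof
    fix e assume "e \<in> ?F"
    then obtain x where x: "e = {0, x}" "x \<in> V" "x \<noteq> 0" "x \<noteq> l" "x \<noteq> h" by auto
    have "crosses {l, h} {0, x}" using x lh(2,3) lh(4)[of x] by (auto simp: crosses_iff)
    then have "e \<notin> U" using plane_notcross[OF triangD(2)[OF U(1)] lh(1)] x(1) by auto
    moreover have "x \<in> nbrs T" using T(2) N x by auto
    ultimately show "e \<in> T - U" using x(1) by (simp add: nbrs_def)
  qed
  then have "card ?F \<le> card (T - U)" using finite_triang[OF T(1) fin] by (intro card_mono) auto
  moreover have "card ?F = card (V - {0, l, h})"
    by (rule card_image) (auto simp: inj_on_def doubleton_eq_iff)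
  moreover have "card (V - {0, l, h}) = card V - 3"
    using V \<open>0 \<in> V\<close> lh(2,3) fin by (subst card_Diff_subset) auto
  moreover have "card N = card V - 1" using N \<open>0 \<in> V\<close> by simp
  ultimately show "2 * card V \<le> L + 4 + card N" using le by linarith
qed

text \<open>
The contracted side spans a triangle with \<open>0\<close> in every triangulation whose neighbours of \<open>0\<close>
include \<open>p\<close> and \<open>q\<close>, but not in a sealed one. So one step is saved, while \<open>V\<close> and \<open>N\<close> both
lose one vertex.
\<close>

lemma remote_contract:
  assumes fin: "finite V" and n: "4 \<le> card V" and U: "triang V U" "sealed V U"
    and pq: "nextto V p q" "p \<in> N" "q \<in> N" "0 \<notin> N"
    and g: "remote (V - {p}) (N - {p}) (edge_image (pull p q) U)"
  shows "remote V N U"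
  unfolding remote_def
proof (intro conjI allI impI U)
  fix T L assume T: "triang V T" "nbrs T = N" and r: "reach V L T U"
  have pq': "p \<in> V" "q \<in> V" "p \<noteq> q" using nexttoD[OF pq(1)] by auto
  have pq0: "p \<noteq> 0" "q \<noteq> 0" using pq by metis+
  have "{p, 0} \<in> T" "{q, 0} \<in> T" using T(2) pq by (auto simp: nbrs_def insert_commute)
  then obtain L' where L': "L' < L" "reach (V - {p}) L' (edge_image (pull p q) T) (edge_image (pull p q) U)"
    using reach_pull_shorter[OF r fin _ pq(1) _ _ sealed_not_apex[OF U n pq(1)]] n by auto
  have "nbrs (edge_image (pull p q) T) = pull p q ` nbrs T"
    by (rule nbrs_im[OF triangD(1)[OF T(1)]]) (use pq0 in \<open>auto simp: pull_def split: if_splits\<close>)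
  also have "\<dots> = N - {p}" unfolding T(2) using pq pq' by (auto simp: pull_def image_iff)
  finally have nb: "nbrs (edge_image (pull p q) T) = N - {p}" .
  have "triang (V - {p}) (edge_image (pull p q) T)" using reach_triang[OF L'(2)] by simp
  then have "2 * card (V - {p}) \<le> L' + 4 + card (N - {p})"
    using g nb L'(2) unfolding remote_def by blast
  moreover have "card (V - {p}) = card V - 1" "card (N - {p}) = card N - 1" using pq pq' by auto
  moreover have "finite N" using nbrs_subset[OF T(1)] T(2) fin finite_subset by blast
  then have "0 < card N" using pq(2) card_gt_0_iff by blast
  ultimately show "2 * card V \<le> L + 4 + card N" using L'(1) n by linarith
qed

text \<open>
Pockets are closed: an edge leaving the interval from \<open>a\<close> to \<open>b\<close> would have to cross \<open>0a\<close> or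
\<open>0b\<close>, or to end in \<open>0\<close>.
\<close>

lemma nbrs_chord:
  assumes T: "triang V T" and ab: "a \<in> nbrs T" "b \<in> nbrs T" "a < b" and gap: "\<And>x. x \<in> nbrs T \<Longrightarrow> x \<le> a \<or> b \<le> x"
  shows "{a, b} \<in> T"
proof (rule triang_mem[OF T])
  have e: "{0, a} \<in> T" "{0, b} \<in> T" using ab by (auto simp: nbrs_def)
  show "a \<in> V" "b \<in> V" "a \<noteq> b" using triang_verts[OF T] e ab(3) by auto
  fix s t assume st: "{s, t} \<in> T" "s < t"
  have nc: "\<not> crosses {0, a} {s, t}" "\<not> crosses {0, b} {s, t}"
    using plane_notcross[OF triangD(2)[OF T] _ st(1)] e by auto
  have "s = 0 \<Longrightarrow> t \<le> a \<or> b \<le> t" using gap[of t] st by (auto simp: nbrs_def)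
  moreover have "0 < a" using triang_verts[OF T e(1)] by auto
  ultimately show "\<not> crosses {a, b} {s, t}" using nc ab(3) st(2) by (auto simp: crosses_iff)
qed

text \<open>
Since the retraction in \<open>reach_collapse\<close> cannot be controlled, the result of every possible
collapse has to be remote.
\<close>

lemma remote_collapse:
  assumes fin: "finite V" and U: "triang V U" "sealed V U"
    and N: "a \<in> N" "b \<in> N" "0 < a" "a < b" "\<And>x. x \<in> N \<Longrightarrow> x \<le> a \<or> b \<le> x"
    and sp: "spread V a b \<alpha> U"
    and g: "\<And>f. mono_retract V (V - {a<..<b}) f \<Longrightarrow> remote (V - {a<..<b}) N (edge_image f U)"
  shows "remote V N U"
  unfolding remote_def
proof (intro conjI allI impI U)
  fix T L assume T: "triang V T" "nbrs T = N" and r: "reach V L T U"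
  let ?W = "V - {a<..<b}"
  have abT: "{a, b} \<in> T" by (rule nbrs_chord[OF T(1)]) (use T(2) N in auto)
  obtain f L' where f: "mono_retract V ?W f" "L' + 2 * card (V \<inter> {a<..<b}) \<le> L" "reach ?W L' (edge_image f T) (edge_image f U)"
    using reach_collapse[OF r fin abT N(4) sp] by blast
  have NV: "N \<subseteq> V - {0}" using nbrs_subset[OF T(1)] T(2) by simp
  have NW: "N \<subseteq> ?W" using N(5) NV by force
  have "0 \<in> V" using N(1) T triang_verts[OF T(1), of 0 a] by (auto simp: nbrs_def)
  then have f0: "f 0 = 0" using f(1) by (auto simp: mono_retract_def)
  have "nbrs (edge_image f T) = f ` nbrs T"
  proof (rule nbrs_im[OF triangD(1)[OF T(1)], of f])
    show "f 0 = 0" by (rule f0)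
  next
    fix x assume "x \<in> V" "f x = 0"
    moreover have "a \<in> ?W" using N(1) NW by blast
    moreover have "\<And>y. y \<in> V \<Longrightarrow> 0 < y \<Longrightarrow> y \<notin> ?W \<Longrightarrow> a \<le> y" by auto
    ultimately show "x = 0" using mono_retract_pos[OF f(1)] N(3) by blast
  qed
  also have "\<dots> = (\<lambda>x. x) ` N"
    unfolding T(2) using NW f(1) by (intro image_cong) (auto simp: mono_retract_def)
  also have "\<dots> = N" by simp
  finally have nb: "nbrs (edge_image f T) = N" .
  have "2 * card ?W \<le> L' + 4 + card N"
    using g[OF f(1)] nb f(3) reach_triang[OF f(3)] unfolding remote_def by blast
  moreover have "card V = card ?W + card (V \<inter> {a<..<b})"
    using card_Int_Diff[OF fin, of "{a<..<b}"] by simp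
  ultimately show "2 * card V \<le> L + 4 + card N" using f(2) by linarith
qed

section \<open>Inserting a pocket vertex together with a neighbour of 0\<close>

text \<open>
A triangulation with a side \<open>cd\<close> whose triangle is \<open>cdy\<close> is extended by two vertices that
lie between \<open>c\<close> and \<open>d\<close>, in the order \<open>c, q, b, d\<close>. The triangle \<open>cdy\<close> is replaced by \<open>cqy\<close>,
\<open>qdy\<close> and \<open>qbd\<close>, so that \<open>b\<close> becomes the tip of an ear.
\<close>

definition grow :: "nat set set \<Rightarrow> nat \<Rightarrow> nat \<Rightarrow> nat \<Rightarrow> nat \<Rightarrow> nat \<Rightarrow> nat set set" where
  "grow T c q b d y = (T - {{c, d}}) \<union> {{c, q}, {q, y}, {q, d}, {q, b}, {b, d}}"

text \<open>
The stretch may run upwards or downwards, because pockets have to be extended at either end.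
\<close>

definition between4 :: "nat \<Rightarrow> nat \<Rightarrow> nat \<Rightarrow> nat \<Rightarrow> bool" where
  "between4 c q b d \<longleftrightarrow> c < q \<and> q < b \<and> b < d \<or> d < b \<and> b < q \<and> q < c"

lemma not_crosses_outside:
  assumes "s \<le> lo \<or> hi \<le> s" "t \<le> lo \<or> hi \<le> t" "lo \<le> u" "u \<le> hi" "lo \<le> v" "v \<le> hi"
  shows "\<not> crosses {u, v} {s, t}"
  using assms by (elim disjE; simp add: crosses_iff)

text \<open>
Seen from outside the gap between \<open>lo\<close> and \<open>hi\<close>, a vertex \<open>q\<close> in the gap behaves like \<open>lo\<close>
or like \<open>hi\<close>; only the edge joining these two tells the difference.
\<close>

lemma not_crosses_between:
  assumes "{s, t} \<noteq> {lo, hi}" "\<not> crosses {lo, y} {s, t}" "\<not> crosses {hi, y} {s, t}" "lo < q" "q < hi"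
    and "s \<le> lo \<or> hi \<le> s" "t \<le> lo \<or> hi \<le> t" "y \<le> lo \<or> hi \<le> y" "y \<noteq> lo" "y \<noteq> hi"
  shows "\<not> crosses {q, y} {s, t}"
proof
  assume c: "crosses {q, y} {s, t}"
  have st: "\<not> (s = lo \<and> t = hi)" "\<not> (s = hi \<and> t = lo)" using assms(1) by auto
  consider "y < lo" | "hi < y" using assms(8-10) by linarith
  then show False
  proof cases
    case 1
    then have o: "y < q" "y < lo" "y < hi" using assms(4,5) by auto
    have False
      if h: "y < u" "u < q" "v < y \<or> q < v" "u \<le> lo \<or> hi \<le> u" "v \<le> lo \<or> hi \<le> v" "\<not> (u = lo \<and> v = hi)"
        "\<not> (y < u \<and> u < lo \<and> (v < y \<or> lo < v))" "\<not> (y < u \<and> u < hi \<and> (v < y \<or> hi < v))" for u v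
    proof -
      have u: "u \<le> lo" "u < hi" using h(2,4) assms(4,5) by auto
      have v: "v < y \<or> lo < v" using h(3,5) assms(4,5) by auto
      have "u = lo" using h(1,7) u v by auto
      moreover have "\<not> v < y" "\<not> hi < v" using h(1,8) u by auto
      ultimately show False using h(3,5,6) assms(4) by auto
    qed
    then show ?thesis
      using c assms(2,3,6,7) st unfolding crosses_sorted[OF o(1)] crosses_sorted[OF o(2)] crosses_sorted[OF o(3)]
      by metis
  next
    case 2
    then have o: "q < y" "lo < y" "hi < y" using assms(4,5) by auto
    have False
      if h: "q < u" "u < y" "v < q \<or> y < v" "u \<le> lo \<or> hi \<le> u" "v \<le> lo \<or> hi \<le> v" "\<not> (u = hi \<and> v = lo)"
        "\<not> (lo < u \<and> u < y \<and> (v < lo \<or> y < v))" "\<not> (hi < u \<and> u < y \<and> (v < hi \<or> y < v))" for u v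
    proof -
      have u: "hi \<le> u" "lo < u" using h(1,4) assms(4,5) by auto
      have v: "v < hi \<or> y < v" using h(3,5) assms(4,5) by auto
      have "u = hi" using h(2,8) u v by auto
      moreover have "\<not> v < lo" "\<not> y < v" using h(2,7) u by auto
      ultimately show False using h(3,5,6) assms(5) by auto
    qed
    then show ?thesis
      using c assms(2,3,6,7) st unfolding crosses_sorted[OF o(1)] crosses_sorted[OF o(2)] crosses_sorted[OF o(3)]
      by metis
  qed
qed

lemma grow_triang:
  assumes T: "triang V T" and fin: "finite V" and n: "2 \<le> card V"
    and cd: "nextto V c d" and o: "between4 c q b d" and y: "{c, y} \<in> T" "{d, y} \<in> T"
  shows "triang (insert q (insert b V)) (grow T c q b d y)"
proof -
  let ?U = "grow T c q b d y"
  define lo hi where "lo = min c d" and "hi = max c d"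
  have out: "x \<le> lo \<or> hi \<le> x" if "x \<in> V" for x
    using cd that sideD[of V c d x] sideD[of V d c x] by (auto simp: nextto_def side_def lo_def hi_def)
  have qb_in: "lo < q" "q < hi" "lo < b" "b < hi" using o by (auto simp: between4_def lo_def hi_def)
  have lohi: "lo = c \<and> hi = d \<or> lo = d \<and> hi = c" by (auto simp: lo_def hi_def)
  have cV: "c \<in> V" "d \<in> V" "c \<noteq> d" using nexttoD[OF cd] by auto
  have yV: "y \<in> V" "y \<noteq> c" "y \<noteq> d" using triang_verts[OF T y(1)] triang_verts[OF T y(2)] by auto
  have qb: "q \<notin> V" "b \<notin> V" "q \<noteq> b" using out[of q] out[of b] qb_in o by (auto simp: between4_def)
  have ch: "?U \<subseteq> chords (insert q (insert b V))"
    using triangD(1)[OF T] chords_mono[of V "insert q (insert b V)"] cV yV qb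
    by (auto simp: grow_def)
  have cdT: "{c, d} \<in> T" using nextto_mem[OF T cd] .
  \<comment> \<open>Two new vertices have to bring a net gain of four edges: five are added and \<open>cd\<close> is lost.\<close>
  have new: "card {{c, q}, {q, y}, {q, d}, {q, b}, {b, d}} = 5"
    using cV yV qb by (auto simp: card_insert_if doubleton_eq_iff)
  have dis: "(T - {{c, d}}) \<inter> {{c, q}, {q, y}, {q, d}, {q, b}, {b, d}} = {}"
    using triang_verts[OF T] qb by (auto simp: insert_commute)
  have finT: "finite T" using finite_triang[OF T fin] .
  have "card ?U = card (T - {{c, d}}) + 5"
    unfolding grow_def by (subst card_Un_disjoint[OF _ _ dis]) (use finT new in auto)
  moreover have "card (T - {{c, d}}) + 1 = card T"
    using cdT finT by (metis Suc_eq_plus1 card.remove)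
  moreover have "card (insert q (insert b V)) = card V + 2" using qb fin by simp
  ultimately have card: "2 * card (insert q (insert b V)) \<le> card ?U + 3"
    using card_triang[OF T fin n] by linarith
  have inner: "\<not> crosses {u, v} {s, t}"
    if "s \<in> V" "t \<in> V" "u \<in> {c, q, b, d}" "v \<in> {c, q, b, d}" for s t u v
  proof -
    have "lo \<le> u" "u \<le> hi" "lo \<le> v" "v \<le> hi"
      using that(3,4) qb_in by (auto simp: lo_def hi_def)
    then show ?thesis using not_crosses_outside out that(1,2) by blast
  qed
  have qy: "\<not> crosses {q, y} {s, t}" if st: "{s, t} \<in> T" "{s, t} \<noteq> {c, d}" for s t
  proof -
    have "\<not> crosses {c, y} {s, t}" "\<not> crosses {d, y} {s, t}"
      using plane_notcross[OF triangD(2)[OF T]] y st(1) by auto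
    then have nc: "\<not> crosses {lo, y} {s, t}" "\<not> crosses {hi, y} {s, t}" using lohi by auto
    have "{s, t} \<noteq> {lo, hi}" using st(2) lohi by (auto simp: insert_commute)
    moreover have "s \<in> V" "t \<in> V" using triang_verts[OF T st(1)] by auto
    moreover have "y \<noteq> lo" "y \<noteq> hi" using yV lohi by auto
    ultimately show ?thesis
      using not_crosses_between[OF _ nc qb_in(1,2)] out yV by blast
  qed
  have old: "\<not> crosses e f" if e: "e \<in> {{c, q}, {q, y}, {q, d}, {q, b}, {b, d}}" and f: "f \<in> T - {{c, d}}" for e f
  proof -
    obtain s t where st: "f = {s, t}" "s \<in> V" "t \<in> V" using triang_edge[OF T, of f] f by auto
    show ?thesis using e f inner[OF st(2,3)] qy[of s t] st(1) by auto
  qed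
  have "y < lo \<or> hi < y" using out[OF yV(1)] yV lohi by auto
  then have pos: "s \<le> min u v \<or> max u v \<le> s"
    if "s \<in> {c, q, b, d, y}" "(u, v) \<in> {(c, q), (q, b), (b, d)}" for s u v
    using that o unfolding between4_def lo_def hi_def by auto
  have steps: "\<not> crosses {u, v} {s, t}"
    if "s \<in> {c, q, b, d, y}" "t \<in> {c, q, b, d, y}" "(u, v) \<in> {(c, q), (q, b), (b, d)}" for s t u v
    by (rule not_crosses_outside[OF pos[OF that(1,3)] pos[OF that(2,3)]]) auto
  have shared: "\<not> crosses {q, u} {q, v}" for u v by (auto simp: crosses_iff)
  have new2: "\<not> crosses e f"
    if "e \<in> {{c, q}, {q, y}, {q, d}, {q, b}, {b, d}}" "f \<in> {{c, q}, {q, y}, {q, d}, {q, b}, {b, d}}" for e f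
  proof -
    have split: "(\<exists>u v. g = {u, v} \<and> (u, v) \<in> {(c, q), (q, b), (b, d)}) \<or> (\<exists>v. g = {q, v})"
      and ends: "\<exists>s t. g = {s, t} \<and> s \<in> {c, q, b, d, y} \<and> t \<in> {c, q, b, d, y}"
      if "g \<in> {{c, q}, {q, y}, {q, d}, {q, b}, {b, d}}" for g
      using that by auto
    show ?thesis
      using split[OF that(1)] split[OF that(2)] ends[OF that(1)] ends[OF that(2)] steps shared crosses_sym
      by metis
  qed
  have "plane ?U" unfolding plane_def
  proof (intro ballI)
    fix e f assume ef: "e \<in> ?U" "f \<in> ?U"
    let ?N = "{{c, q}, {q, y}, {q, d}, {q, b}, {b, d}}"
    have "e \<in> T - {{c, d}} \<or> e \<in> ?N" "f \<in> T - {{c, d}} \<or> f \<in> ?N"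
      using ef unfolding grow_def Un_iff .
    then show "\<not> crosses e f"
    proof (elim disjE)
      assume "e \<in> T - {{c, d}}" "f \<in> T - {{c, d}}"
      then show ?thesis using plane_notcross[OF triangD(2)[OF T]] by blast
    next
      assume "e \<in> T - {{c, d}}" "f \<in> ?N"
      then show ?thesis using old[of f e] crosses_sym[of e f] by (simp only: simp_thms)
    next
      assume "e \<in> ?N" "f \<in> T - {{c, d}}"
      then show ?thesis by (rule old)
    next
      assume "e \<in> ?N" "f \<in> ?N"
      then show ?thesis by (rule new2)
    qed
  qed
  then show ?thesis using fin n qb card ch by (intro triang_of_card) auto
qed

lemma grow_mem: "e \<in> T \<Longrightarrow> e \<noteq> {c, d} \<Longrightarrow> e \<in> grow T c q b d y"
  by (simp add: grow_def)

lemma grow_new: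
  "{q, y} \<in> grow T c q b d y" "{q, d} \<in> grow T c q b d y" "{b, d} \<in> grow T c q b d y"
  by (simp_all add: grow_def)

lemma grow_sealed:
  assumes T: "triang V T" "sealed V T" and n: "4 \<le> card V" and V: "c \<in> V" "d \<in> V" "0 < c" "0 < d"
    and cd: "nextto V c d" and o: "between4 c q b d"
  shows "sealed (insert q (insert b V)) (grow T c q b d y)"
proof -
  obtain l h where lh: "{l, h} \<in> T" "0 < l" "l < h" "\<And>x. x \<in> V - {0} \<Longrightarrow> l \<le> x \<and> x \<le> h"
    using T(2) by (auto simp: sealed_def)
  have lhV: "l \<in> V" "h \<in> V" using triang_verts[OF T(1) lh(1)] by auto
  have "{l, h} \<noteq> {c, d}"
  proof
    assume "{l, h} = {c, d}"
    then have "side V l h" using cd lh(3) by (auto simp: nextto_def side_def doubleton_eq_iff)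
    have "V \<subseteq> {0, l, h}"
    proof
      fix x assume x: "x \<in> V"
      then show "x \<in> {0, l, h}" using lh(4)[of x] sideD[OF \<open>side V l h\<close> x] by auto
    qed
    then have "card V \<le> card {0, l, h}" by (intro card_mono) auto
    also have "\<dots> \<le> 3" by (simp add: card_insert_if)
    finally show False using n by simp
  qed
  then have "{l, h} \<in> grow T c q b d y" using grow_mem[OF lh(1)] by simp
  moreover have "l \<le> x \<and> x \<le> h" if "x \<in> insert q (insert b V) - {0}" for x
    using that lh(4)[of x] lh(4)[of c] lh(4)[of d] V o by (auto simp: between4_def)
  ultimately show ?thesis using lh(2,3) unfolding sealed_def by blast
qed

text \<open>
The side \<open>cq\<close> inherits the third vertex of \<open>cd\<close>, and \<open>qb\<close> gets \<open>d\<close>. The latter differs from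
all the other third vertices because it used to be an end of the pocket.
\<close>

lemma grow_spread:
  assumes sp: "spread V lo hi \<alpha> T" and T: "triang V T" and cd: "nextto V c d"
    and P: "{c, d} \<in> cpairs V lo hi"
    and sub: "cpairs V' lo' hi' \<subseteq> (cpairs V lo hi - {{c, d}}) \<union> {{c, q}, {q, b}}"
    and I: "lo \<le> lo'" "hi' \<le> hi" "d < lo' \<or> hi' < d"
    and qb: "q \<notin> V" "b \<notin> V" "q \<noteq> b"
    and y: "y = \<alpha> {c, d}"
  shows "\<exists>\<alpha>'. spread V' lo' hi' \<alpha>' (grow T c q b d y)"
proof -
  let ?P = "cpairs V lo hi"
  define \<alpha>' where "\<alpha>' = \<alpha>({c, q} := y, {q, b} := d)"
  have inj: "inj_on \<alpha> ?P" and out: "\<And>e. e \<in> ?P \<Longrightarrow> \<alpha> e < lo \<or> hi < \<alpha> e"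
    and ed: "\<And>e u. e \<in> ?P \<Longrightarrow> u \<in> e \<Longrightarrow> {u, \<alpha> e} \<in> T"
    using sp by (auto simp: spread_def)
  have inP: "u \<in> V \<and> lo \<le> u \<and> u \<le> hi" if "e \<in> ?P" "u \<in> e" for e u
    using that by (auto simp: cpairs_def side_def)
  have cdI: "lo \<le> c" "c \<le> hi" "lo \<le> d" "d \<le> hi" "c \<in> V" "d \<in> V" using inP[OF P] by auto
  have cq: "c \<noteq> b" "c \<noteq> q" using cdI qb by auto
  have notP: "{c, q} \<notin> ?P" "{q, b} \<notin> ?P" using inP[of "{c, q}" q] inP[of "{q, b}" q] qb by auto
  have a1: "\<alpha>' {c, q} = y" "\<alpha>' {q, b} = d" using cq by (auto simp: \<alpha>'_def doubleton_eq_iff)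
  have a2: "\<alpha>' e = \<alpha> e" if "e \<in> ?P" for e using that notP by (auto simp: \<alpha>'_def)
  have yout: "y < lo \<or> hi < y" using out[OF P] y by simp
  have yd: "y \<noteq> d" using yout cdI by auto
  have cases: "e \<in> ?P - {{c, d}} \<or> e = {c, q} \<or> e = {q, b}" if "e \<in> cpairs V' lo' hi'" for e
    using sub that by blast
  have k1: "\<alpha> e \<noteq> y" if "e \<in> ?P - {{c, d}}" for e using that inj P y by (auto dest: inj_onD)
  have k2: "\<alpha> e \<noteq> d" if "e \<in> ?P" for e using out[OF that] cdI by auto
  have "spread V' lo' hi' \<alpha>' (grow T c q b d y)" unfolding spread_def
  proof (intro conjI ballI)
    show "inj_on \<alpha>' (cpairs V' lo' hi')"
    proof (rule inj_onI)
      fix e f assume ef: "e \<in> cpairs V' lo' hi'" "f \<in> cpairs V' lo' hi'" "\<alpha>' e = \<alpha>' f"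
      show "e = f" using cases[OF ef(1)] cases[OF ef(2)]
      proof (elim disjE)
        assume "e \<in> ?P - {{c, d}}" "f \<in> ?P - {{c, d}}"
        then show ?thesis using ef(3) a2 inj by (metis DiffD1 inj_onD)
      qed (use ef(3) a1 a2 k1 k2 yd in \<open>auto\<close>)
    qed
    fix e assume e: "e \<in> cpairs V' lo' hi'"
    show "\<alpha>' e < lo' \<or> hi' < \<alpha>' e"
      using cases[OF e]
    proof (elim disjE)
      assume "e \<in> ?P - {{c, d}}"
      then show ?thesis using out[of e] a2[of e] I by auto
    qed (use a1 yout I in auto)
    fix u assume u: "u \<in> e"
    show "{u, \<alpha>' e} \<in> grow T c q b d y"
      using cases[OF e]
    proof (elim disjE)
      assume eP: "e \<in> ?P - {{c, d}}"
      then have "{u, \<alpha> e} \<noteq> {c, d}" using inP[of e u] out[of e] cdI u by (auto simp: doubleton_eq_iff)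
      then show ?thesis using grow_mem[OF ed[of e u]] a2[of e] eP u by simp
    next
      assume eq: "e = {c, q}"
      have "{c, y} \<in> T" using ed[OF P, of c] y by simp
      moreover have "{c, y} \<noteq> {c, d}" using yd by (auto simp: doubleton_eq_iff)
      ultimately have "{c, y} \<in> grow T c q b d y" by (intro grow_mem)
      moreover have "u = c \<or> u = q" using u eq by simp
      ultimately show ?thesis using grow_new(1)[of q y T c b d] a1(1) eq by metis
    next
      assume eq: "e = {q, b}"
      have "u = q \<or> u = b" using u eq by simp
      then show ?thesis using grow_new(2,3)[where T = T] a1(2) eq by metis
    qed
  qed
  then show ?thesis by blast
qed

text \<open>
The old pocket runs from \<open>A\<close> to \<open>d\<close> and the new one from \<open>A\<close> to \<open>b\<close>, in either orientation.
A collapse sends \<open>q\<close> to \<open>A\<close> or to \<open>b\<close>; in the first case \<open>c\<close> goes to \<open>A\<close> as well. Pulling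
\<open>b\<close> into \<open>d\<close> afterwards, one obtains a collapse of the old pocket under which all edges that
\<open>grow\<close> has added become degenerate or coincide with images of \<open>cy\<close>, \<open>dy\<close> or the side \<open>Ad\<close>.
It suffices to check one inclusion, as both edge sets are triangulations.
\<close>

lemma grow_collapse:
  assumes T: "triang V T" and fin: "finite V" and cd: "nextto V c d" and qb: "q \<notin> V" "b \<notin> V" "q \<noteq> b"
    and U: "triang (insert q (insert b V)) (grow T c q b d y)"
    and f: "mono_retract (insert q (insert b V)) W f"
    and W: "b \<in> W" "d \<in> W" "A \<in> W" "y \<in> W" "W - {b} \<subseteq> V" "nextto W b d" "2 \<le> card (W - {b})" "nextto (W - {b}) A d"
    and y: "{c, y} \<in> T" "{d, y} \<in> T" "y \<noteq> A"
    and fq: "f q = A \<or> f q = b" "f c = A \<or> f c = b" "f q = A \<Longrightarrow> f c = A"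
  shows "mono_retract V (W - {b}) (\<lambda>x. pull b d (f x))"
    and "edge_image (pull b d) (edge_image f (grow T c q b d y)) = edge_image (\<lambda>x. pull b d (f x)) T"
proof -
  let ?V = "insert q (insert b V)" and ?U = "grow T c q b d y" and ?f = "\<lambda>x. pull b d (f x)"
  have r: "mono_retract ?V (W - {b}) ?f" by (rule mono_retract_comp[OF f mono_retract_pull[OF W(6)]])
  have "mono_on V ?f" using r by (auto simp: mono_retract_def intro: mono_on_subset)
  moreover have "?f ` V \<subseteq> W - {b}" using r unfolding mono_retract_def by blast
  moreover have "\<forall>x\<in>W - {b}. ?f x = x" using r unfolding mono_retract_def by blast
  ultimately show r2: "mono_retract V (W - {b}) ?f" using W(5) unfolding mono_retract_def by blast
  have t2: "triang (W - {b}) (edge_image ?f T)" by (rule mono_retract_triang[OF r2 fin W(7) T])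
  have t1: "triang (W - {b}) (edge_image ?f ?U)" by (rule mono_retract_triang[OF r _ W(7) U]) (use fin in auto)
  have fx: "f b = b" "f d = d" "f y = y" using f W unfolding mono_retract_def by blast+
  have ne: "b \<noteq> d" "A \<noteq> d" "A \<noteq> b" using nexttoD[OF W(6)] nexttoD[OF W(8)] by auto
  have ynq: "y \<noteq> d" "y \<noteq> c" "y \<noteq> b" using triang_verts[OF T y(1)] triang_verts[OF T y(2)] qb by auto
  have F: "?f q = A \<or> ?f q = d" "?f c = A \<or> ?f c = d" "?f q = A \<Longrightarrow> ?f c = A" "?f b = d" "?f d = d" "?f y = y"
    using fq fx ne ynq by (auto simp: pull_def split: if_splits)
  have Ad: "{A, d} \<in> edge_image ?f T" using nextto_mem[OF t2 W(8)] .
  have yc: "{A, y} \<in> edge_image ?f T" if "?f c = A" using edge_image_mem[OF y(1), of ?f] F(6) that y(3) by simp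
  have yd: "{d, y} \<in> edge_image ?f T" using edge_image_mem[OF y(2), of ?f] F(5,6) ynq(1) by simp
  have "edge_image ?f ?U \<subseteq> edge_image ?f T"
  proof
    fix e assume "e \<in> edge_image ?f ?U"
    then obtain e' where e': "e = ?f ` e'" "e' \<in> ?U" "card e = 2" by (auto simp: edge_image_def)
    from e'(2) consider "e' \<in> T" | "e' = {c, q}" | "e' = {q, y}" | "e' = {q, d}" | "e' = {q, b}" | "e' = {b, d}"
      by (auto simp: grow_def)
    then show "e \<in> edge_image ?f T"
    proof cases
      case 1
      then show ?thesis using e'(1,3) by (auto simp: edge_image_def)
    next
      case 2
      then have "e = {?f c, ?f q}" using e'(1) by simp
      moreover have "?f c \<noteq> ?f q" using calculation e'(3) by auto
      ultimately show ?thesis using F(1,2) Ad by (metis insert_commute)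
    next
      case 3
      then have "e = {?f q, y}" using e'(1) F(6) by simp
      then show ?thesis using F(1,3) yc yd by metis
    next
      case 4
      then have e: "e = {?f q, d}" using e'(1) F(5) by simp
      then have "?f q \<noteq> d" using e'(3) by auto
      then show ?thesis using e F(1) Ad by metis
    next
      case 5
      then have e: "e = {?f q, d}" using e'(1) F(4) by simp
      then have "?f q \<noteq> d" using e'(3) by auto
      then show ?thesis using e F(1) Ad by metis
    next
      case 6
      then have "e = {d, d}" using e'(1) F(4,5) by simp
      then show ?thesis using e'(3) by simp
    qed
  qed
  then have "edge_image ?f ?U = edge_image ?f T" using triang_subset_eq[OF t1 t2] by simp
  then show "edge_image (pull b d) (edge_image f ?U) = edge_image ?f T" using edge_image_comp[OF triangD(1)[OF U]] by simp
qed

section \<open>Existence of a remote triangulation\<close>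

text \<open>
What \<open>remote_collapse\<close> asks of \<open>U\<close> for the pocket between \<open>a\<close> and \<open>b\<close>. It is also meaningful
for an empty pocket, which is where the construction of a pocket starts.
\<close>

definition primed :: "nat set \<Rightarrow> nat set \<Rightarrow> nat \<Rightarrow> nat \<Rightarrow> nat set set \<Rightarrow> bool" where
  "primed V N a b U \<longleftrightarrow> triang V U \<and> sealed V U \<and> (\<exists>\<alpha>. spread V a b \<alpha> U) \<and>
     (\<forall>f. mono_retract V (V - {a<..<b}) f \<longrightarrow> remote (V - {a<..<b}) N (edge_image f U))"

text \<open>
The first alternative in \<open>H\<close> extends the pocket at its upper end, the second one at its
lower end. In both cases \<open>b\<close> is the new end of the pocket, and the old end \<open>d\<close> becomes its
outer neighbour in \<open>N\<close>.
\<close>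

lemma primed_grow:
  assumes pr: "primed V N lo hi U"
    and H: "lo = A \<and> hi = d \<and> lo' = A \<and> hi' = b \<and> side V c d \<and> A \<le> c \<and> c < q \<and> q < b \<and> b < d \<or>
            lo = d \<and> hi = A \<and> lo' = b \<and> hi' = A \<and> side V d c \<and> c \<le> A \<and> d < b \<and> b < q \<and> q < c"
    and fin: "finite V" and N: "0 \<in> V" "N \<subseteq> V - {0}" "3 \<le> card N" "A \<in> N" "d \<in> N"
      "\<And>x. x \<in> N \<Longrightarrow> x \<le> lo \<or> hi \<le> x"
  shows "\<exists>U'. primed (insert q (insert b V)) (insert b N) lo' hi' U'"
proof -
  let ?V = "insert q (insert b V)"
  define W where "W = ?V - {lo'<..<hi'}"
  have U: "triang V U" "sealed V U"
    and g: "\<And>f. mono_retract V (V - {lo<..<hi}) f \<Longrightarrow> remote (V - {lo<..<hi}) N (edge_image f U)"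
    using pr by (auto simp: primed_def)
  obtain \<alpha> where sp: "spread V lo hi \<alpha> U" using pr by (auto simp: primed_def)
  have cd: "nextto V c d" and o: "between4 c q b d"
    using H by (auto simp: nextto_def between4_def)
  have V: "A \<in> V" "d \<in> V" "c \<in> V" "c \<noteq> d" "0 < A" "0 < d" "A \<noteq> d"
    using N(2,4,5) nexttoD[OF cd] H by auto
  have out: "x \<le> c \<or> d \<le> x" if "c < d" "x \<in> V" for x
    using H that sideD[of V c d x] by auto
  have out': "x \<le> d \<or> c \<le> x" if "d < c" "x \<in> V" for x
    using H that sideD[of V d c x] by auto
  have qb: "q \<notin> V" "b \<notin> V" "q \<noteq> b"
    using o out[of q] out[of b] out'[of q] out'[of b] by (auto simp: between4_def)
  have c0: "0 < c" using H V by auto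
  have finN: "finite N" using N(2) fin finite_subset by blast
  have "card (insert 0 N) \<le> card V" using N(1,2) fin by (intro card_mono) auto
  moreover have "card (insert 0 N) = card N + 1" using N(2) finN by (subst card_insert_disjoint) auto
  ultimately have n4: "4 \<le> card V" using N(3) by simp
  have P: "{c, d} \<in> cpairs V lo hi"
    using H unfolding cpairs_def by (auto simp: insert_commute intro: exI[of _ c] exI[of _ d])
  define y where "y = \<alpha> {c, d}"
  have y: "{c, y} \<in> U" "{d, y} \<in> U" "y < lo \<or> hi < y"
    using sp P unfolding spread_def y_def by blast+
  have yV: "y \<in> V" using triang_verts[OF U(1) y(1)] by simp
  let ?U = "grow U c q b d y"
  have tU: "triang ?V ?U" by (rule grow_triang[OF U(1) fin _ cd o y(1,2)]) (use n4 in simp)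
  have sU: "sealed ?V ?U" by (rule grow_sealed[OF U n4 V(3,2) c0 V(6) cd o])
  have sub: "cpairs ?V lo' hi' \<subseteq> (cpairs V lo hi - {{c, d}}) \<union> {{c, q}, {q, b}}"
  proof
    fix e assume "e \<in> cpairs ?V lo' hi'"
    then obtain p r where pr: "e = {p, r}" "side ?V p r" "lo' \<le> p" "r \<le> hi'" by (auto simp: cpairs_def)
    have prV: "p \<in> ?V" "r \<in> ?V" "p < r" using pr(2) by (auto simp: side_def)
    have gap: "q \<le> p \<or> r \<le> q" "b \<le> p \<or> r \<le> b" "c \<le> p \<or> r \<le> c" "d \<le> p \<or> r \<le> d"
      using sideD[OF pr(2)] V by auto
    show "e \<in> (cpairs V lo hi - {{c, d}}) \<union> {{c, q}, {q, b}}"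
    proof (cases "p \<in> V \<and> r \<in> V")
      case True
      then have "side V p r" using pr(2) by (auto simp: side_def)
      moreover have "lo \<le> p" "r \<le> hi" using H pr(3,4) by auto
      ultimately have "e \<in> cpairs V lo hi" using pr(1) by (auto simp: cpairs_def)
      moreover have "e \<noteq> {c, d}" using gap(1) H pr(1) prV(3) by (auto simp: doubleton_eq_iff)
      ultimately show ?thesis by blast
    next
      case False
      have "p = c \<and> r = q \<or> p = q \<and> r = b \<or> p = q \<and> r = c \<or> p = b \<and> r = q"
      proof (cases "c < d")
        case True
        then have h: "c < q" "q < b" "b < d" "hi' = b" using H by auto
        then have "r \<noteq> d" "r \<le> b" using pr(4) by auto
        then show ?thesis using False prV gap h out[OF True, of p] out[OF True, of r] by auto
      next
        case F: False
        then have h: "d < b" "b < q" "q < c" "lo' = b" "d < c" using H by auto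
        then show ?thesis using False prV gap h out'[OF h(5), of p] out'[OF h(5), of r] pr(3) by auto
      qed
      then show ?thesis using pr(1) by (auto simp: insert_commute)
    qed
  qed
  have I: "lo \<le> lo'" "hi' \<le> hi" "d < lo' \<or> hi' < d" using H by auto
  obtain \<alpha>' where \<alpha>': "spread ?V lo' hi' \<alpha>' ?U"
    using grow_spread[OF sp U(1) cd P sub I qb y_def] by blast
  have Wb: "W - {b} = V - {lo<..<hi}"
  proof (cases "c < d")
    case True
    then have h: "c < q" "q < b" "b < d" "hi' = b" "hi = d" "lo = A" "lo' = A" "A \<le> c" using H by auto
    then show ?thesis using out[OF True] qb unfolding W_def by (auto; force)
  next
    case F: False
    then have h: "d < b" "b < q" "q < c" "lo' = b" "d < c" "lo = d" "hi = A" "hi' = A" "c \<le> A" using H by auto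
    then show ?thesis using out'[OF h(5)] qb unfolding W_def by (auto; force)
  qed
  have bW: "b \<in> W" "q \<notin> W" using H by (auto simp: W_def)
  have dW: "d \<in> W" "A \<in> W" "lo' \<in> W" "hi' \<in> W" "lo' < hi'" "0 < lo'" using H V by (auto simp: W_def)
  have yW: "y \<in> W" "y \<noteq> A" using y(3) yV I H by (auto simp: W_def)
  have W_sub: "W - {b} \<subseteq> V" using Wb by auto
  have bd: "nextto W b d"
  proof (cases "c < d")
    case True
    then show ?thesis using H bW dW W_sub out[OF True] unfolding nextto_def side_def by fastforce
  next
    case F: False
    then have "d < c" using V(4) by simp
    then show ?thesis using H bW dW W_sub out'[OF \<open>d < c\<close>] unfolding nextto_def side_def by fastforce
  qed
  have Ad: "nextto (W - {b}) A d"
    using H V dW unfolding Wb nextto_def side_def by auto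
  have NW: "insert 0 N \<subseteq> W - {b}" 
  proof
    fix x assume x: "x \<in> insert 0 N"
    then have "x \<in> V" using N(1,2) by blast
    moreover have "x \<le> lo \<or> hi \<le> x" using x N(6)[of x] by auto
    ultimately show "x \<in> W - {b}" unfolding Wb by auto
  qed
  have finW: "finite W" using fin by (simp add: W_def)
  have "card (insert 0 N) \<le> card (W - {b})" using finW NW by (intro card_mono) auto
  then have cW: "4 \<le> card (W - {b})" using \<open>card (insert 0 N) = card N + 1\<close> N(3) by simp
  have "remote W (insert b N) (edge_image f ?U)" if f: "mono_retract ?V W f" for f
  proof -
    have fW: "f ` ?V \<subseteq> W" "mono_on ?V f" "\<And>x. x \<in> W \<Longrightarrow> f x = x" using f by (auto simp: mono_retract_def)
    have ends: "f x = A \<or> f x = b" if "x \<in> ?V" "lo' \<le> x" "x \<le> hi'" for x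
    proof -
      have "lo' \<in> ?V" "hi' \<in> ?V" using dW by (auto simp: W_def)
      then have "f lo' \<le> f x" "f x \<le> f hi'"
        using mono_onD[OF fW(2)] that by blast+
      then have "lo' \<le> f x" "f x \<le> hi'" using fW(3) dW by auto
      moreover have "f x \<in> W" using fW(1) that(1) by blast
      ultimately have "f x = lo' \<or> f x = hi'" by (auto simp: W_def)
      then show ?thesis using H by auto
    qed
    have fq: "f q = A \<or> f q = b" "f c = A \<or> f c = b" using ends[of q] ends[of c] H V(3) by auto
    have fqc: "f c = A" if "f q = A"
    proof -
      have fA: "f A = A" using fW(3) dW by simp
      have "A \<in> ?V" "c \<in> ?V" "q \<in> ?V" using V by auto
      then have "A \<le> c \<Longrightarrow> c \<le> q \<Longrightarrow> f A \<le> f c \<and> f c \<le> f q" "c \<le> A \<Longrightarrow> q \<le> c \<Longrightarrow> f q \<le> f c \<and> f c \<le> f A"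
        using mono_onD[OF fW(2)] by blast+
      then show ?thesis using H that fA by auto
    qed
    have 2: "2 \<le> card (W - {b})" using cW by simp
    note gc = grow_collapse[OF U(1) fin cd qb tU f bW(1) dW(1,2) yW(1) W_sub bd 2 Ad y(1,2) yW(2) fq fqc]
    have "remote (W - {b}) N (edge_image (\<lambda>x. pull b d (f x)) U)"
      using g gc(1) unfolding Wb by blast
    moreover have "insert b N - {b} = N" using N(2) qb(2) by auto
    ultimately have g': "remote (W - {b}) (insert b N - {b}) (edge_image (pull b d) (edge_image f ?U))"
      using gc(2) \<open>insert b N - {b} = N\<close> by simp
    have cWW: "card W = card (W - {b}) + 1" using card.remove[OF finW bW(1)] by simp
    have t: "triang W (edge_image f ?U)" by (rule mono_retract_triang[OF f _ _ tU]) (use fin cW cWW in auto)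
    have pos: "x = 0" if "x \<in> ?V" "f x = 0" for x
    proof (rule mono_retract_pos[OF f dW(3) _ dW(6) that])
      fix z assume "z \<in> ?V" "0 < z" "z \<notin> W"
      then show "lo' \<le> z" by (auto simp: W_def)
    qed
    have s: "sealed W (edge_image f ?U)" by (rule sealed_im[OF tU sU f pos dW(3,4,6,5)])
    show ?thesis
      by (rule remote_contract[OF finW _ t s bd _ _ _ g']) (use cW cWW N(2,5) c0 o V H in auto)
  qed
  then have "primed ?V (insert b N) lo' hi' ?U"
    unfolding primed_def using tU sU \<alpha>' W_def by blast
  then show ?thesis by blast
qed

lemma primed_side:
  assumes g: "remote V N U" and c: "side V a b" and fin: "finite V" and n: "3 \<le> card V"
  shows "primed V N a b U"
proof -
  have U: "triang V U" "sealed V U" using g by (auto simp: remote_def)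
  have "nextto V a b" using c by (simp add: nextto_def)
  then obtain x where x: "{a, x} \<in> U" "{b, x} \<in> U" using pull_triang(2)[OF U(1) fin n] by blast
  have ab: "a < b" using c by (simp add: side_def)
  have "x \<in> V" "x \<noteq> a" "x \<noteq> b" using triang_verts[OF U(1)] x by blast+
  then have xo: "x < a \<or> b < x" using sideD[OF c, of x] by auto
  have P: "e = {a, b}" if eP: "e \<in> cpairs V a b" for e
  proof -
    obtain p q where pq: "e = {p, q}" "side V p q" "a \<le> p" "q \<le> b" using eP by (auto simp: cpairs_def)
    have "p \<in> V" "q \<in> V" "p < q" using pq by (auto simp: side_def)
    then have "p = a" "q = b" using sideD[OF c, of p] sideD[OF c, of q] pq(3,4) by auto
    then show ?thesis using pq by simp
  qed
  have "spread V a b (\<lambda>_. x) U" unfolding spread_def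
    using P xo x by (auto simp: inj_on_def)
  moreover have W: "V - {a<..<b} = V" using sideD[OF c] by fastforce
  moreover have "remote V N (edge_image f U)" if "mono_retract V V f" for f
    using edge_image_id[OF triangD(1)[OF U(1)], of f] that g by (simp add: mono_retract_def)
  ultimately show ?thesis unfolding primed_def W using U by blast
qed

text \<open>
Besides the first and the last vertex being neighbours of \<open>0\<close>, as holds in every
triangulation, this says that \<open>N\<close> has at least three elements more than its complement in
\<open>V - {0}\<close>, which is the assumption \<open>k \<le> n / 2 - 2\<close>. The inequality is invariant under
removing one vertex from each of them.
\<close>

definition admissible :: "nat set \<Rightarrow> nat set \<Rightarrow> bool" where
  "admissible V N \<longleftrightarrow> finite V \<and> 0 \<in> V \<and> N \<subseteq> V - {0} \<and> (\<exists>l\<in>N. \<forall>x\<in>V - {0}. l \<le> x) \<and> (\<exists>h\<in>N. \<forall>x\<in>V. x \<le> h) \<and>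
     card V + 2 \<le> 2 * card N"

lemma admissible_delete:
  assumes "admissible V N" "b \<in> N" "q \<in> V" "q \<notin> N" "q \<noteq> 0" "x \<in> N" "x < b" "y \<in> N" "b < y"
  shows "admissible (V - {q, b}) (N - {b})"
proof -
  obtain l h where lh: "l \<in> N" "\<And>x. x \<in> V - {0} \<Longrightarrow> l \<le> x" "h \<in> N" "\<And>x. x \<in> V \<Longrightarrow> x \<le> h"
    and V: "finite V" "0 \<in> V" "N \<subseteq> V - {0}" "card V + 2 \<le> 2 * card N"
    using assms(1) unfolding admissible_def by blast
  have "l \<le> x" "y \<le> h" using lh V assms(6,8) by blast+
  then have "l \<in> N - {b}" "h \<in> N - {b}" using lh assms(7,9) by auto
  have bV: "b \<in> V" "b \<noteq> 0" "b \<noteq> q" using V assms by auto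
  have "card (V - {q, b}) = card V - 2" using bV assms V by (subst card_Diff_subset) auto
  moreover have "card (N - {b}) = card N - 1" using assms by simp
  moreover have "card N > 0" using assms(2) V finite_subset card_gt_0_iff by (metis empty_iff finite_Diff)
  moreover have "card {q, b} \<le> card V" using V assms(3) bV by (intro card_mono) auto
  then have "2 \<le> card V" using bV by simp
  ultimately have "card (V - {q, b}) + 2 \<le> 2 * card (N - {b})" using V(4) by linarith
  moreover have "\<exists>l\<in>N - {b}. \<forall>x\<in>V - {q, b} - {0}. l \<le> x"
    by (rule bexI[OF _ \<open>l \<in> N - {b}\<close>]) (use lh(2) in blast)
  moreover have "\<exists>h\<in>N - {b}. \<forall>x\<in>V - {q, b}. x \<le> h"
    by (rule bexI[OF _ \<open>h \<in> N - {b}\<close>]) (use lh(4) in blast)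
  moreover have "N - {b} \<subseteq> V - {q, b} - {0}" using V(3) assms(4) by blast
  ultimately show ?thesis unfolding admissible_def using V(1,2) bV(2) assms(5) by simp
qed

text \<open>
Here \<open>M\<close> consists of blocks of elements of \<open>N\<close> alternating with pockets. A pocket is
suitable if the two adjacent blocks together exceed it by two, that is, if they provide as
many consecutive pairs as the pocket has vertices. If the last pocket has at least as many
vertices as the block that follows it, both are cut off, which does not decrease the excess
of \<open>N\<close>. If no other pocket is left, the excess shows that the last pocket is suitable after
all.
\<close>

lemma pocket_exists:
  fixes M :: "nat set"
  assumes "finite M" "N \<subseteq> M" "l \<in> N" "h \<in> N" "\<forall>x\<in>M. l \<le> x \<and> x \<le> h" "M \<noteq> N"
    and "card (M - N) + 3 \<le> card N"
  shows "\<exists>a b x y. a \<in> N \<and> b \<in> N \<and> a < b \<and> (\<forall>n\<in>N. n \<le> a \<or> b \<le> n) \<and> M \<inter> {a<..<b} \<noteq> {} \<and>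
    M \<inter> {x..a} \<subseteq> N \<and> M \<inter> {b..y} \<subseteq> N \<and> l \<le> x \<and>
    card (M \<inter> {a<..<b}) \<le> card (M \<inter> {x..<a}) + card (M \<inter> {b<..y})"
  using assms
proof (induction "card M" arbitrary: M N h rule: less_induct)
  case less
  note fin = less.prems(1) and NM = less.prems(2) and lN = less.prems(3) and hN = less.prems(4) and lh = less.prems(5)[rule_format]
  have finN: "finite N" using fin NM finite_subset by blast
  \<comment> \<open>the last vertex of the last pocket, which then lies between \<open>a\<close> and \<open>b\<close>\<close>
  define z where "z = Max (M - N)"
  have "M - N \<noteq> {}" using NM less.prems(6) by blast
  then have z: "z \<in> M - N" "\<And>x. x \<in> M - N \<Longrightarrow> x \<le> z"
    using Max_in[of "M - N"] Max_ge[of "M - N"] fin unfolding z_def by (blast, meson finite_Diff)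
  have lM: "l \<in> M" "h \<in> M" using lN hN NM by auto
  have lz: "l < z" "z < h" using z(1) lh[of z] lN hN by (auto simp: order_less_le)
  obtain b where b: "side M z b" "b \<le> h" using successor_exists[OF fin _ lM(2) lz(2)] z(1) by blast
  have bz: "z < b" "b \<in> M" using b(1) by (auto simp: side_def)
  then have bN: "b \<in> N" using z(2)[of b] by auto
  define a where "a = Max {n\<in>N. n < z}"
  have "a \<in> {n\<in>N. n < z}" unfolding a_def by (rule Max_in) (use finN lN lz in auto)
  then have a: "a \<in> N" "a < z" by auto
  have amax: "n \<le> a" if "n \<in> N" "n < z" for n unfolding a_def by (rule Max_ge) (use finN that in auto)
  have gap: "n \<le> a \<or> b \<le> n" if "n \<in> N" for n
  proof (cases "n < z")
    case True
    then show ?thesis using amax that by blast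
  next
    case False
    then have "n \<noteq> z" using z(1) that by auto
    then show ?thesis using sideD[OF b(1), of n] NM that False by auto
  qed
  have zQ: "z \<in> M \<inter> {a<..<b}" using z a bz by auto
  have right: "M \<inter> {b..h} \<subseteq> N"
  proof
    fix x assume "x \<in> M \<inter> {b..h}"
    then show "x \<in> N" using z(2)[of x] bz by auto
  qed
  let ?Q = "M \<inter> {a<..<b}" and ?R = "M \<inter> {b<..h}"
  have aM: "a \<in> M" "a < b" using a NM bz by auto
  have QN: "?Q \<inter> N = {}" using gap by fastforce
  show ?case
  proof (cases "card ?Q \<le> card ?R")
    case True
    have "M \<inter> {a..a} \<subseteq> N" using a by auto
    moreover have "l \<le> a" using lh aM by simp
    ultimately show ?thesis
      using a bN aM gap zQ right True by (intro exI[of _ a] exI[of _ b] exI[of _ a] exI[of _ h]) auto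
  next
    case False
    define M' N' where "M' = M \<inter> {..a}" and "N' = N \<inter> {..a}"
    have splitM: "M - N = (M' - N') \<union> ?Q"
    proof (intro equalityI subsetI)
      fix x assume x: "x \<in> M - N"
      then have "x \<le> a \<or> a < x \<and> x < b" using z(2)[OF x] bz by auto
      then show "x \<in> (M' - N') \<union> ?Q" using x by (auto simp: M'_def N'_def)
    next
      fix x assume "x \<in> (M' - N') \<union> ?Q"
      then show "x \<in> M - N" using QN by (auto simp: M'_def N'_def)
    qed
    have cM: "card (M - N) = card (M' - N') + card ?Q"
      unfolding splitM by (rule card_Un_disjoint) (use fin in \<open>auto simp: M'_def\<close>)
    have splitN: "N = N' \<union> insert b ?R"
    proof (intro equalityI subsetI)
      fix x assume x: "x \<in> N"
      then have "x \<in> M" "x \<le> h" using NM lh by auto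
      then show "x \<in> N' \<union> insert b ?R" using gap[OF x] x by (auto simp: N'_def)
    next
      fix x assume "x \<in> N' \<union> insert b ?R"
      then show "x \<in> N" using right bN by (auto simp: N'_def)
    qed
    have "card N = card N' + card (insert b ?R)"
    proof -
      have "N' \<inter> insert b ?R = {}" using aM by (auto simp: N'_def)
      then show ?thesis using splitN finN fin by (metis card_Un_disjoint finite_Un)
    qed
    moreover have "card (insert b ?R) = card ?R + 1" using fin by (subst card_insert_disjoint) auto
    ultimately have cN: "card N = card N' + card ?R + 1" by simp
    have l': "l \<in> N'" "a \<in> N'" using lN a lh[of a] aM by (auto simp: N'_def)
    have N'M': "N' \<subseteq> M'" using NM by (auto simp: M'_def N'_def)
    show ?thesis
    proof (cases "M' = N'")
      case True
      have "M \<inter> {l..a} \<subseteq> M'" "N' \<subseteq> N" by (auto simp: M'_def N'_def)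
      then have left: "M \<inter> {l..a} \<subseteq> N" using True by blast
      have "insert a (M \<inter> {l..<a}) = M'"
      proof (intro equalityI subsetI)
        fix u assume "u \<in> M'"
        then show "u \<in> insert a (M \<inter> {l..<a})" using lh[of u] by (auto simp: M'_def)
      qed (use aM in \<open>auto simp: M'_def\<close>)
      then have "insert a (M \<inter> {l..<a}) = N'" using True by simp
      moreover have "card (insert a (M \<inter> {l..<a})) = card (M \<inter> {l..<a}) + 1"
        using fin by (subst card_insert_disjoint) auto
      ultimately have "card N' = card (M \<inter> {l..<a}) + 1" by simp
      then have "card ?Q \<le> card (M \<inter> {l..<a}) + card ?R"
        using cN cM less.prems(7) by linarith
      then show ?thesis
        using a bN aM gap zQ right left by (intro exI[of _ a] exI[of _ b] exI[of _ l] exI[of _ h]) auto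
    next
      case F: False
      have "b \<notin> M'" using aM by (auto simp: M'_def)
      then have "M' \<subset> M" using bz by (auto simp: M'_def)
      then have 1: "card M' < card M" using fin by (rule psubset_card_mono[rotated])
      have 2: "\<forall>x\<in>M'. l \<le> x \<and> x \<le> a" using lh by (auto simp: M'_def)
      have 3: "card (M' - N') + 3 \<le> card N'" using cM cN less.prems(7) False by linarith
      have 4: "finite M'" using fin by (simp add: M'_def)
      obtain a' b' x y where h: "a' \<in> N'" "b' \<in> N'" "a' < b'" "\<forall>n\<in>N'. n \<le> a' \<or> b' \<le> n" "M' \<inter> {a'<..<b'} \<noteq> {}"
        "M' \<inter> {x..a'} \<subseteq> N'" "M' \<inter> {b'..y} \<subseteq> N'" "l \<le> x"
        "card (M' \<inter> {a'<..<b'}) \<le> card (M' \<inter> {x..<a'}) + card (M' \<inter> {b'<..y})"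
        using less.hyps[OF 1 4 N'M' l' 2 F 3] by blast
      have b'a: "b' \<le> a" using h(2) by (simp add: N'_def)
      have e: "M' \<inter> {a'<..<b'} = M \<inter> {a'<..<b'}" "M' \<inter> {x..a'} = M \<inter> {x..a'}"
        "M' \<inter> {x..<a'} = M \<inter> {x..<a'}" "M' \<inter> {b'..y} = M \<inter> {b'..min y a}" "M' \<inter> {b'<..y} = M \<inter> {b'<..min y a}"
        using b'a h(3) by (auto simp: M'_def)
      have N'N: "N' \<subseteq> N" by (auto simp: N'_def)
      have "\<forall>n\<in>N. n \<le> a' \<or> b' \<le> n"
      proof
        fix n assume n: "n \<in> N"
        show "n \<le> a' \<or> b' \<le> n" using h(4) n b'a by (cases "n \<le> a") (auto simp: N'_def)
      qed
      then show ?thesis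
        using h N'N unfolding e
        by (intro exI[of _ a'] exI[of _ b'] exI[of _ x] exI[of _ "min y a"] conjI)
          (assumption | rule subsetD[OF N'N] | rule subset_trans[OF _ N'N])+
    qed
  qed
qed

lemma admissible_card: "admissible V N \<Longrightarrow> 4 \<le> card V \<and> 3 \<le> card N"
proof -
  assume o: "admissible V N"
  then have "card N \<le> card (V - {0})" unfolding admissible_def by (intro card_mono) auto
  moreover have "card (V - {0}) = card V - 1" using o by (simp add: admissible_def)
  moreover have "card V + 2 \<le> 2 * card N" using o by (simp add: admissible_def)
  ultimately show ?thesis by linarith
qed

text \<open>
Remove a vertex at one end of the pocket together with that end itself, whose outer
neighbour in \<open>N\<close> becomes the new end. The excess of \<open>N\<close> and the surplus of adjacent
consecutive pairs stay the same. When the pocket has become empty, any remote triangulation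
will do.
\<close>

lemma primed_exists:
  assumes "admissible V N" "a \<in> N" "b \<in> N" "a < b" "\<And>n. n \<in> N \<Longrightarrow> n \<le> a \<or> b \<le> n"
    and "V \<inter> {x..a} \<subseteq> N" "V \<inter> {b..y} \<subseteq> N"
    and "card (V \<inter> {a<..<b}) \<le> card (V \<inter> {x..<a}) + card (V \<inter> {b<..y})"
    and "\<And>V' N'. admissible V' N' \<Longrightarrow> card V' + 2 * card (V \<inter> {a<..<b}) \<le> card V \<Longrightarrow> \<exists>U. remote V' N' U"
  shows "\<exists>U. primed V N a b U"
  using assms
proof (induction "card (V \<inter> {a<..<b})" arbitrary: V N a b)
  case 0
  have fin: "finite V" and NV: "N \<subseteq> V - {0}" using 0(2) by (auto simp: admissible_def)
  have "V \<inter> {a<..<b} = {}" using 0(1) fin by simp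
  then have c: "side V a b" using 0(3,4,5) NV by (fastforce simp: side_def)
  obtain U where "remote V N U" using 0(10)[OF 0(2)] 0(1) by auto
  then show ?case using primed_side[OF _ c fin] admissible_card[OF 0(2)] by fastforce
next
  case (Suc n)
  note o = Suc.prems(1) and aN = Suc.prems(2) and bN = Suc.prems(3) and ab = Suc.prems(4) and gap = Suc.prems(5)
    and left = Suc.prems(6) and right = Suc.prems(7) and runs = Suc.prems(8) and IHX = Suc.prems(9)
  have fin: "finite V" and NV: "N \<subseteq> V - {0}" and V0: "0 \<in> V" using o by (auto simp: admissible_def)
  have abV: "a \<in> V" "b \<in> V" "0 < a" "0 < b" using aN bN NV by auto
  have "V \<inter> {a<..<b} \<noteq> {}" using Suc.hyps(2) by (metis card.empty nat.simps(3))
  then obtain m where m: "m \<in> V" "a < m" "m < b" by auto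
  have "0 < card (V \<inter> {x..<a}) \<or> 0 < card (V \<inter> {b<..y})" using runs Suc.hyps(2) by linarith
  then have "V \<inter> {x..<a} \<noteq> {} \<or> V \<inter> {b<..y} \<noteq> {}" by (metis card.empty less_irrefl)
  then show ?case
  proof
    assume "V \<inter> {b<..y} \<noteq> {}"
    then obtain w where w: "w \<in> V" "b < w" "w \<le> y" by auto
    obtain d where d: "side V b d" "d \<le> w" using successor_exists[OF fin abV(2) w(1,2)] .
    obtain q where q: "side V q b" "m \<le> q" using predecessor_exists[OF fin abV(2) m(1,3)] .
    have qV: "q \<in> V" "a < q" "q < b" using q m by (auto simp: side_def)
    obtain c where c: "side V c q" "a \<le> c" using predecessor_exists[OF fin qV(1) abV(1) qV(2)] .
    have cV: "c \<in> V" "c < q" using c by (auto simp: side_def)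
    have dV: "d \<in> V" "b < d" using d by (auto simp: side_def)
    have dN: "d \<in> N" using right dV d(2) w(3) by auto
    have qN: "q \<notin> N" using gap[of q] qV by auto
    let ?V = "V - {q, b}" and ?N = "N - {b}"
    have o2: "admissible ?V ?N" by (rule admissible_delete[OF o bN qV(1) qN _ aN ab dN dV(2)]) (use qV in simp)
    have cd: "side ?V c d"
      unfolding side_def
    proof (intro conjI ballI)
      fix u assume "u \<in> ?V"
      then show "u \<le> c \<or> d \<le> u"
        using sideD[OF c(1), of u] sideD[OF q(1), of u] sideD[OF d(1), of u] by auto
    qed (use cV qV dV in auto)
    have Q: "?V \<inter> {a<..<d} = V \<inter> {a<..<b} - {q}" "?V \<inter> {x..<a} = V \<inter> {x..<a}" "?V \<inter> {d<..y} = V \<inter> {b<..y} - {d}"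
    proof -
      have 1: "u < b" if "u \<in> V" "u \<noteq> b" "u < d" for u using sideD[OF d(1) that(1)] that by auto
      have 2: "d < u" if "u \<in> V" "u \<noteq> d" "b < u" for u using sideD[OF d(1) that(1)] that by auto
      show "?V \<inter> {a<..<d} = V \<inter> {a<..<b} - {q}" using 1 dV(2) by force
      show "?V \<inter> {x..<a} = V \<inter> {x..<a}" using qV ab by auto
      show "?V \<inter> {d<..y} = V \<inter> {b<..y} - {d}" using 2 dV(2) qV(3) by force
    qed
    have n: "n = card (?V \<inter> {a<..<d})" unfolding Q using Suc.hyps(2) qV fin by simp
    have dy: "d \<in> V \<inter> {b<..y}" using dV d(2) w(3) by auto
    have cy: "card (V \<inter> {b<..y} - {d}) + 1 = card (V \<inter> {b<..y})"
      using card.remove[OF _ dy] fin by simp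
    have cV2: "card ?V + 2 = card V"
    proof -
      have "card {q, b} \<le> card V" using fin qV abV by (intro card_mono) auto
      then show ?thesis using qV abV fin by (subst card_Diff_subset) auto
    qed
    have "\<exists>U. primed ?V ?N a d U"
    proof (rule Suc.hyps(1)[OF n o2])
      show "a \<in> ?N" "d \<in> ?N" "a < d" using aN dN ab dV by auto
      show "v \<le> a \<or> d \<le> v" if "v \<in> ?N" for v
        using gap[of v] that sideD[OF d(1), of v] NV by auto
      show "?V \<inter> {x..a} \<subseteq> ?N" using left ab by auto
      show "?V \<inter> {d..y} \<subseteq> ?N" using right dV by auto
      show "card (?V \<inter> {a<..<d}) \<le> card (?V \<inter> {x..<a}) + card (?V \<inter> {d<..y})"
        using runs n cy Suc.hyps(2) unfolding Q by linarith
      show "\<exists>U. remote V' N' U" if "admissible V' N'" "card V' + 2 * card (?V \<inter> {a<..<d}) \<le> card ?V" for V' N'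
        by (rule IHX[OF that(1)]) (use that(2) n Suc.hyps(2) cV2 in linarith)
    qed
    then obtain U where U: "primed ?V ?N a d U" by blast
    have N2: "?N \<subseteq> ?V - {0}" using NV qN by blast
    have "\<exists>U'. primed (insert q (insert b ?V)) (insert b ?N) a b U'"
    proof (rule primed_grow[OF U, of a d a b b c q])
      show "v \<le> a \<or> d \<le> v" if "v \<in> ?N" for v
        using gap[of v] that sideD[OF d(1), of v] NV by auto
    qed (use cd c qV dV V0 N2 admissible_card[OF o2] aN dN ab fin abV cV in simp_all)
    moreover have "insert q (insert b ?V) = V" "insert b ?N = N" using qV abV bN by auto
    ultimately show ?thesis by simp
  next
    assume "V \<inter> {x..<a} \<noteq> {}"
    then obtain w where w: "w \<in> V" "w < a" "x \<le> w" by auto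
    obtain d where d: "side V d a" "w \<le> d" using predecessor_exists[OF fin abV(1) w(1,2)] .
    obtain q where q: "side V a q" "q \<le> m" using successor_exists[OF fin abV(1) m(1,2)] .
    have qV: "q \<in> V" "a < q" "q < b" using q m by (auto simp: side_def)
    obtain c where c: "side V q c" "c \<le> b" using successor_exists[OF fin qV(1) abV(2) qV(3)] .
    have cV: "c \<in> V" "q < c" using c by (auto simp: side_def)
    have dV: "d \<in> V" "d < a" using d by (auto simp: side_def)
    have dN: "d \<in> N" using left dV d(2) w(3) by auto
    have qN: "q \<notin> N" using gap[of q] qV by auto
    let ?V = "V - {q, a}" and ?N = "N - {a}"
    have o2: "admissible ?V ?N" by (rule admissible_delete[OF o aN qV(1) qN _ dN dV(2) bN ab]) (use qV in simp)
    have cd: "side ?V d c"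
      unfolding side_def
    proof (intro conjI ballI)
      fix u assume "u \<in> ?V"
      then show "u \<le> d \<or> c \<le> u"
        using sideD[OF c(1), of u] sideD[OF q(1), of u] sideD[OF d(1), of u] by auto
    qed (use cV qV dV in auto)
    have Q: "?V \<inter> {d<..<b} = V \<inter> {a<..<b} - {q}" "?V \<inter> {x..<d} = V \<inter> {x..<a} - {d}" "?V \<inter> {b<..y} = V \<inter> {b<..y}"
    proof -
      have 1: "a < u" if "u \<in> V" "u \<noteq> a" "d < u" for u using sideD[OF d(1) that(1)] that by auto
      have 2: "u < d" if "u \<in> V" "u \<noteq> d" "u < a" for u using sideD[OF d(1) that(1)] that by auto
      show "?V \<inter> {d<..<b} = V \<inter> {a<..<b} - {q}" using 1 dV(2) by force
      show "?V \<inter> {x..<d} = V \<inter> {x..<a} - {d}" using 2 dV(2) qV(2) by force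
      show "?V \<inter> {b<..y} = V \<inter> {b<..y}" using qV ab by auto
    qed
    have n: "n = card (?V \<inter> {d<..<b})" unfolding Q using Suc.hyps(2) qV fin by simp
    have dy: "d \<in> V \<inter> {x..<a}" using dV d(2) w(3) by auto
    have cy: "card (V \<inter> {x..<a} - {d}) + 1 = card (V \<inter> {x..<a})"
      using card.remove[OF _ dy] fin by simp
    have cV2: "card ?V + 2 = card V"
    proof -
      have "card {q, a} \<le> card V" using fin qV abV by (intro card_mono) auto
      then show ?thesis using qV abV fin by (subst card_Diff_subset) auto
    qed
    have "\<exists>U. primed ?V ?N d b U"
    proof (rule Suc.hyps(1)[OF n o2])
      show "b \<in> ?N" "d \<in> ?N" "d < b" using bN dN ab dV by auto
      show "v \<le> d \<or> b \<le> v" if "v \<in> ?N" for v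
        using gap[of v] that sideD[OF d(1), of v] NV by auto
      show "?V \<inter> {x..d} \<subseteq> ?N" using left dV by auto
      show "?V \<inter> {b..y} \<subseteq> ?N" using right ab by auto
      show "card (?V \<inter> {d<..<b}) \<le> card (?V \<inter> {x..<d}) + card (?V \<inter> {b<..y})"
        using runs n cy Suc.hyps(2) unfolding Q by linarith
      show "\<exists>U. remote V' N' U" if "admissible V' N'" "card V' + 2 * card (?V \<inter> {d<..<b}) \<le> card ?V" for V' N'
        by (rule IHX[OF that(1)]) (use that(2) n Suc.hyps(2) cV2 in linarith)
    qed
    then obtain U where U: "primed ?V ?N d b U" by blast
    have N2: "?N \<subseteq> ?V - {0}" using NV qN by blast
    have "\<exists>U'. primed (insert q (insert a ?V)) (insert a ?N) a b U'"
    proof (rule primed_grow[OF U, of b d a b a c q])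
      show "v \<le> d \<or> b \<le> v" if "v \<in> ?N" for v
        using gap[of v] that sideD[OF d(1), of v] NV by auto
    qed (use cd c qV dV V0 N2 admissible_card[OF o2] bN dN ab fin abV cV in simp_all)
    moreover have "insert q (insert a ?V) = V" "insert a ?N = N" using qV abV aN by auto
    ultimately show ?thesis by simp
  qed
qed

theorem remote_exists: "admissible V N \<Longrightarrow> \<exists>U. remote V N U"
proof (induction "card V" arbitrary: V N rule: less_induct)
  case less
  note o = less.prems
  have V: "finite V" "0 \<in> V" "N \<subseteq> V - {0}" "card V + 2 \<le> 2 * card N" using o by (auto simp: admissible_def)
  obtain l h where lh: "l \<in> N" "\<And>x. x \<in> V - {0} \<Longrightarrow> l \<le> x" "h \<in> N" "\<And>x. x \<in> V \<Longrightarrow> x \<le> h"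
    using o unfolding admissible_def by blast
  have finN: "finite N" using V finite_subset by blast
  show ?case
  proof (cases "N = V - {0}")
    case True
    have "l \<noteq> h"
    proof
      assume "l = h"
      have "N \<subseteq> {l}"
      proof
        fix u assume "u \<in> N"
        then have "u \<in> V - {0}" using V(3) by blast
        then show "u \<in> {l}" using lh(2)[of u] lh(4)[of u] \<open>l = h\<close> by auto
      qed
      then have "card N \<le> card {l}" by (intro card_mono) auto
      then show False using admissible_card[OF o] by simp
    qed
    then have lh2: "l < h" using lh(4)[of l] lh(1) V(3) by auto
    have lhV: "0 < l" "l \<in> V" "h \<in> V" using lh(1,3) V(3) by auto
    have "plane {{l, h}}" by (auto simp: plane_def crosses_iff)
    then obtain U where U: "triang V U" "{{l, h}} \<subseteq> U"
      using plane_extends[of V "{{l, h}}"] V(1) lh2 lhV by auto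
    then have "sealed V U"
      unfolding sealed_def by (intro exI[of _ l] exI[of _ h]) (use lh2 lhV lh(2,4) in auto)
    then show ?thesis using remote_fan[OF V(1,2) U(1) _ True] by blast
  next
    case False
    have c1: "card (V - {0}) = card V - 1" "card (V - {0} - N) = card (V - {0}) - card N"
      using V finN by (simp_all add: card_Diff_subset)
    have "card (V - {0} - N) + 3 \<le> card N" using c1 V(4) admissible_card[OF o] by linarith
    then obtain a b x y where p: "a \<in> N" "b \<in> N" "a < b" "\<forall>n\<in>N. n \<le> a \<or> b \<le> n"
      "(V - {0}) \<inter> {a<..<b} \<noteq> {}" "(V - {0}) \<inter> {x..a} \<subseteq> N" "(V - {0}) \<inter> {b..y} \<subseteq> N" "l \<le> x"
      "card ((V - {0}) \<inter> {a<..<b}) \<le> card ((V - {0}) \<inter> {x..<a}) + card ((V - {0}) \<inter> {b<..y})"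
    proof -
      have 1: "finite (V - {0})" using V(1) by simp
      have 2: "\<forall>x\<in>V - {0}. l \<le> x \<and> x \<le> h" using lh(2,4) by blast
      have 3: "V - {0} \<noteq> N" using False by blast
      from pocket_exists[OF 1 V(3) lh(1,3) 2 3 \<open>card (V - {0} - N) + 3 \<le> card N\<close>] show thesis
        by (elim exE conjE) (rule that; assumption)
    qed
    have l0: "0 < l" using lh(1) V(3) by auto
    have e: "(V - {0}) \<inter> {a<..<b} = V \<inter> {a<..<b}" "(V - {0}) \<inter> {x..a} = V \<inter> {x..a}" "(V - {0}) \<inter> {b..y} = V \<inter> {b..y}"
      "(V - {0}) \<inter> {x..<a} = V \<inter> {x..<a}" "(V - {0}) \<inter> {b<..y} = V \<inter> {b<..y}"
      using l0 p(3,8) by auto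
    have "\<exists>U. primed V N a b U"
    proof (rule primed_exists[OF o p(1-3), of x y])
      have "0 < card (V \<inter> {a<..<b})" using p(5) V(1) unfolding e by (simp add: card_gt_0_iff)
      then show "\<exists>U. remote V' N' U" if "admissible V' N'" "card V' + 2 * card (V \<inter> {a<..<b}) \<le> card V" for V' N'
      proof -
        have "card V' < card V" using that(2) \<open>0 < card (V \<inter> {a<..<b})\<close> by linarith
        then show ?thesis using less.hyps[OF _ that(1)] by blast
      qed
    qed (use p in \<open>auto simp: e\<close>)
    then obtain U \<alpha> where U: "triang V U" "sealed V U" "spread V a b \<alpha> U"
      "\<And>f. mono_retract V (V - {a<..<b}) f \<Longrightarrow> remote (V - {a<..<b}) N (edge_image f U)"
      unfolding primed_def by blast
    have "0 < a" using p(1) V(3) by auto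
    then have "remote V N U"
      using remote_collapse[OF V(1) U(1,2) p(1,2) _ p(3) _ U(3,4)] p(4) by blast
    then show ?thesis by blast
  qed
qed

section \<open>Flipping towards the fan\<close>

lemma nbrs_ends:
  assumes T: "triang V T" and fin: "finite V" and V0: "0 \<in> V" and n: "3 \<le> card V"
  shows "\<exists>l h. l \<in> nbrs T \<and> h \<in> nbrs T \<and> l < h \<and> (\<forall>x\<in>V - {0}. l \<le> x \<and> x \<le> h)"
proof -
  define l h where "l = Min (V - {0})" and "h = Max (V - {0})"
  have c: "card (V - {0}) = card V - 1" using V0 by simp
  have ne: "V - {0} \<noteq> {}"
  proof
    assume "V - {0} = {}"
    then have "card (V - {0}) = 0" by (simp only: card.empty)
    then show False using c n by linarith
  qed
  have l: "l \<in> V - {0}" and h: "h \<in> V - {0}" unfolding l_def h_def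
    using fin ne by (intro Min_in Max_in; simp)+
  have b: "l \<le> x \<and> x \<le> h" if "x \<in> V - {0}" for x unfolding l_def h_def using fin that by simp
  have "l \<noteq> h"
  proof
    assume "l = h"
    then have "V - {0} \<subseteq> {l}" using b by force
    then have "card (V - {0}) \<le> card {l}" by (intro card_mono) auto
    then show False using c n by simp
  qed
  then have lh: "l < h" using b[OF h] by simp
  have "x \<le> 0 \<or> l \<le> x" if "x \<in> V" for x using b[of x] that by (cases "x = 0") auto
  then have "side V 0 l" unfolding side_def using V0 l by auto
  then have "l \<in> nbrs T" using side_mem[OF T] by (simp add: nbrs_def)
  moreover have "x \<le> h" if "x \<in> V" for x using b[of x] that by (cases "x = 0") auto
  then have "{0, h} \<in> T" by (intro outer_mem[OF T V0]) (use h in auto)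
  ultimately have "l \<in> nbrs T \<and> h \<in> nbrs T \<and> l < h \<and> (\<forall>x\<in>V - {0}. l \<le> x \<and> x \<le> h)"
    using lh b by (simp add: nbrs_def)
  then show ?thesis by (intro exI)
qed

text \<open>
Some pocket is not empty, and the edge \<open>ab\<close> that closes it can be replaced by \<open>0p\<close>, where
\<open>p\<close> is the third vertex of the triangle below \<open>ab\<close>.
\<close>

lemma flip_towards_fan:
  assumes T: "triang V T" and fin: "finite V" and V0: "0 \<in> V" and n: "3 \<le> card V"
    and ne: "nbrs T \<noteq> V - {0}"
  obtains U p where "flip_step V T U" "p \<notin> nbrs T" "nbrs U = insert p (nbrs T)"
proof -
  have NV: "nbrs T \<subseteq> V - {0}" using nbrs_subset[OF T] .
  have finN: "finite (nbrs T)" using NV fin finite_subset by blast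
  obtain z where z: "z \<in> V" "z \<noteq> 0" "z \<notin> nbrs T" using ne NV by blast
  obtain l h where ends: "l \<in> nbrs T" "h \<in> nbrs T" "l < h" "\<forall>x\<in>V - {0}. l \<le> x \<and> x \<le> h"
    using nbrs_ends[OF T fin V0 n] by (elim exE conjE)
  note lh = ends(1,2) ends(4)[rule_format]
  have "l \<le> z" "z \<le> h" "l \<noteq> z" "z \<noteq> h" using lh z by auto
  then have lz: "l < z" "z < h" by simp_all
  define a b where "a = Max {x\<in>nbrs T. x < z}" and "b = Min {x\<in>nbrs T. z < x}"
  have "a \<in> {x\<in>nbrs T. x < z}" unfolding a_def by (rule Max_in) (use finN lh lz in auto)
  then have a: "a \<in> nbrs T" "a < z" by auto
  have "b \<in> {x\<in>nbrs T. z < x}" unfolding b_def by (rule Min_in) (use finN lh lz in auto)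
  then have b: "b \<in> nbrs T" "z < b" by auto
  have gap: "x \<le> a \<or> b \<le> x" if "x \<in> nbrs T" for x
  proof -
    have "x < z \<Longrightarrow> x \<le> a" unfolding a_def by (rule Max_ge) (use finN that in auto)
    moreover have "z < x \<Longrightarrow> b \<le> x" unfolding b_def by (rule Min_le) (use finN that in auto)
    moreover have "x \<noteq> z" using z that by auto
    ultimately show ?thesis by linarith
  qed
  have ab: "a < b" using a b by simp
  have abT: "{a, b} \<in> T" by (rule nbrs_chord[OF T a(1) b(1) ab gap])
  obtain p where p: "p \<in> V" "a < p" "p < b" "{a, p} \<in> T" "{p, b} \<in> T"
    using inner_apex[OF T fin abT ab z(1) a(2) b(2)] .
  have pN: "p \<notin> nbrs T" using gap[of p] p by auto
  have a0: "0 < a" using a NV by auto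
  let ?U = "insert {0, p} (T - {{a, b}})"
  have nc: "\<not> crosses {0, p} {s, t}" if st: "{s, t} \<in> T" "{s, t} \<noteq> {a, b}" "s < t" for s t
  proof
    assume "crosses {0, p} {s, t}"
    moreover have "0 < p" using p by simp
    ultimately have c: "0 < s" "s < p" "p < t" using st(3) by (auto simp: crosses_iff)
    have no: "\<not> crosses {a, p} {s, t}" "\<not> crosses {p, b} {s, t}" "\<not> crosses {0, a} {s, t}" "\<not> crosses {0, b} {s, t}"
      using plane_notcross[OF triangD(2)[OF T] _ st(1)] p a b by (auto simp: nbrs_def)
    have "\<not> a < s" using no(1) c by (auto simp: crosses_iff)
    moreover have "\<not> s < a" using no(3) c a0 p by (auto simp: crosses_iff)
    ultimately have "s = a" by simp
    moreover have "\<not> t < b" using no(2) c p \<open>s = a\<close> by (auto simp: crosses_iff)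
    moreover have "\<not> b < t" using no(4) c ab \<open>s = a\<close> by (auto simp: crosses_iff)
    ultimately show False using st(2) by simp
  qed
  have nc': "\<not> crosses {0, p} f" if f: "f \<in> T - {{a, b}}" for f
  proof -
    obtain s t where "f = {s, t}" "s < t" using triang_edge[OF T, of f] f by blast
    then show ?thesis using nc[of s t] f by simp
  qed
  have pl: "plane ?U" unfolding plane_def
  proof (intro ballI)
    fix e f assume ef: "e \<in> ?U" "f \<in> ?U"
    have self: "\<not> crosses {0, p} {0, p}" by (auto simp: crosses_iff)
    have "e = {0, p} \<or> e \<in> T - {{a, b}}" "f = {0, p} \<or> f \<in> T - {{a, b}}"
      using ef unfolding insert_iff .
    then show "\<not> crosses e f"
    proof (elim disjE)
      assume "e \<in> T - {{a, b}}" "f \<in> T - {{a, b}}"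
      then show ?thesis using plane_notcross[OF triangD(2)[OF T]] by blast
    next
      assume "e \<in> T - {{a, b}}" "f = {0, p}"
      then show ?thesis using nc'[of e] crosses_sym[of e] by simp
    qed (use self nc' in auto)
  qed
  have p0: "{0, p} \<notin> T" using pN by (simp add: nbrs_def)
  have finT: "finite T" using finite_triang[OF T fin] .
  have "card ?U = card (T - {{a, b}}) + 1" using p0 finT by simp
  then have cU: "card ?U = card T" using card.remove[OF finT abT] by simp
  have "?U \<subseteq> chords V" using triangD(1)[OF T] p V0 a0 by auto
  then have tU: "triang V ?U"
    using pl cU card_triang[OF T fin] n fin by (intro triang_of_card) auto
  have "flip_step V T ?U" unfolding flip_step_def using T tU by blast
  moreover have "nbrs ?U = insert p (nbrs T)"
    using a0 ab p by (auto simp: nbrs_def doubleton_eq_iff)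
  ultimately show thesis using that pN by blast
qed

lemma fan_unique:
  assumes T: "triang V T" "nbrs T = V - {0}" and U: "triang V U" "nbrs U = V - {0}"
  shows "T = U"
proof (rule triang_subset_eq[OF T(1) U(1)], rule subsetI)
  fix e assume e: "e \<in> T"
  obtain s t where st: "e = {s, t}" "s < t" "s \<in> V" "t \<in> V" using triang_edge[OF T(1) e] by blast
  show "e \<in> U"
  proof (cases "s = 0")
    case True
    then have "t \<in> nbrs U" using st U(2) by simp
    then show ?thesis using st True by (simp add: nbrs_def)
  next
    case False
    have "x \<le> s \<or> t \<le> x" if x: "x \<in> V" for x
    proof (rule ccontr)
      assume "\<not> ?thesis"
      then have c: "s < x" "x < t" by auto
      then have "x \<in> nbrs T" using T(2) x by simp
      then have "\<not> crosses {0, x} {s, t}"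
        using plane_notcross[OF triangD(2)[OF T(1)]] e st(1) by (auto simp: nbrs_def)
      then show False using c False by (auto simp: crosses_iff)
    qed
    then have "side V s t" using st by (auto simp: side_def)
    then show ?thesis using side_mem[OF U(1)] st(1) by simp
  qed
qed

lemma reach_trans: "reach V L T U \<Longrightarrow> reach V M U W \<Longrightarrow> reach V (L + M) T W"
  by (induction rule: reach.induct) (auto intro: reach.intros)

lemma reach_sym: "reach V L T U \<Longrightarrow> reach V L U T"
proof (induction rule: reach.induct)
  case (reach_refl T)
  then show ?case by (rule reach.reach_refl)
next
  case (reach_step T U L W)
  have "triang V T" using reach_step.hyps(1) by (simp add: flip_step_def)
  then have "reach V (Suc 0) U T"
    using reach.reach_step[OF flip_step_sym[OF reach_step.hyps(1)] reach.reach_refl] by simp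
  then show ?case using reach_trans[OF reach_step.IH] by fastforce
qed

lemma reach_fan:
  assumes "triang V T" "finite V" "0 \<in> V" "3 \<le> card V"
  shows "\<exists>L F. reach V L T F \<and> nbrs F = V - {0} \<and> L + card (nbrs T) + 1 = card V"
  using assms
proof (induction "card V - card (nbrs T)" arbitrary: T rule: less_induct)
  case less
  note T = less.prems(1) and fin = less.prems(2) and V0 = less.prems(3)
  have NV: "nbrs T \<subseteq> V - {0}" using nbrs_subset[OF T] .
  have finN: "finite (nbrs T)" using NV fin finite_subset by blast
  have cV: "card (V - {0}) + 1 = card V" using card.remove[OF fin V0] by simp
  show ?case
  proof (cases "nbrs T = V - {0}")
    case True
    then show ?thesis using cV reach.reach_refl[OF T] by (intro exI[of _ 0] exI[of _ T]) simp
  next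
    case False
    obtain U p where U: "flip_step V T U" "p \<notin> nbrs T" "nbrs U = insert p (nbrs T)"
      using flip_towards_fan[OF less.prems False] .
    have tU: "triang V U" using U(1) by (simp add: flip_step_def)
    have cU: "card (nbrs U) = card (nbrs T) + 1" using U(2,3) finN by simp
    have "nbrs T \<subset> V - {0}" using NV False by blast
    then have "card (nbrs T) < card (V - {0})" using fin by (intro psubset_card_mono) auto
    then have "card V - card (nbrs U) < card V - card (nbrs T)" using cU cV by linarith
    then obtain L F where "reach V L U F" "nbrs F = V - {0}" "L + card (nbrs U) + 1 = card V"
      using less.hyps[OF _ tU fin V0 less.prems(4)] by blast
    then show ?thesis
      using reach.reach_step[OF U(1)] cU by (intro exI[of _ "Suc L"] exI[of _ F]) auto
  qed
qed

text \<open>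
Both triangulations are flipped to the fan at \<open>0\<close>. In the second one \<open>0\<close> has at least two
neighbours, which gives the bound \<open>(n - 1 - card (nbrs T)) + (n - 3)\<close>.
\<close>

lemma reach_upper:
  assumes T: "triang V T" "triang V U" and V: "finite V" "0 \<in> V" "3 \<le> card V"
  shows "\<exists>L. reach V L T U \<and> L + card (nbrs T) + 4 \<le> 2 * card V"
proof -
  obtain L F where L: "reach V L T F" "nbrs F = V - {0}" "L + card (nbrs T) + 1 = card V"
    using reach_fan[OF T(1) V] by blast
  obtain M G where M: "reach V M U G" "nbrs G = V - {0}" "M + card (nbrs U) + 1 = card V"
    using reach_fan[OF T(2) V] by blast
  have "F = G" by (rule fan_unique) (use L M reach_triang in blast)+
  then have r: "reach V (L + M) T U" using reach_trans[OF L(1)] reach_sym[OF M(1)] by blast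
  obtain l h where lh: "l \<in> nbrs U" "h \<in> nbrs U" "l < h"
    using nbrs_ends[OF T(2) V] by (elim exE conjE)
  have "finite (nbrs U)" using nbrs_subset[OF T(2)] V(1) finite_subset by blast
  then have "card {l, h} \<le> card (nbrs U)" using lh by (intro card_mono) auto
  then have "2 \<le> card (nbrs U)" using lh(3) by simp
  then show ?thesis using r L(3) M(3) by (intro exI[of _ "L + M"]) linarith
qed

section \<open>Points in convex position\<close>

text \<open>
Twice the signed area of the triangle \<open>abc\<close>.
\<close>

definition orient :: "real^2 \<Rightarrow> real^2 \<Rightarrow> real^2 \<Rightarrow> real" where
  "orient a b c = (b$1 - a$1) * (c$2 - a$2) - (b$2 - a$2) * (c$1 - a$1)"

lemma orient_rotate: "orient b c a = orient a b c"
  and orient_swap: "orient b a c = - orient a b c"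
  and orient_swap': "orient a c b = - orient a b c"
  by (simp_all add: orient_def algebra_simps)

lemma orient_degenerate [simp]: "orient a a b = 0" "orient a b a = 0" "orient a b b = 0"
  by (simp_all add: orient_def)

lemma vec2_eq_iff: "x = y \<longleftrightarrow> x$1 = y$1 \<and> x$2 = y$2" for x y :: "real^2"
  by (auto simp: vec_eq_iff forall_2)

lemma orient_affine:
  "orient a b ((1 - t) *\<^sub>R c + t *\<^sub>R d) = (1 - t) * orient a b c + t * orient a b d"
  by (simp add: orient_def algebra_simps)

text \<open>
The areas of the three triangles with apex \<open>p\<close> are proportional to barycentric coordinates
of \<open>p\<close>.
\<close>

lemma in_triangle:
  assumes "orient p x y > 0" "orient p y z > 0" "orient p z x > 0"
  shows "p \<in> convex hull {x, y, z}"
proof -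
  define s where "s = orient p x y + orient p y z + orient p z x"
  have s: "s > 0" using assms by (simp add: s_def)
  have "s *\<^sub>R p = orient p y z *\<^sub>R x + orient p z x *\<^sub>R y + orient p x y *\<^sub>R z"
    unfolding vec2_eq_iff s_def by (simp add: orient_def algebra_simps)
  then have "(1 / s) *\<^sub>R (s *\<^sub>R p) = (1 / s) *\<^sub>R (orient p y z *\<^sub>R x + orient p z x *\<^sub>R y + orient p x y *\<^sub>R z)"
    by simp
  then have "p = (orient p y z / s) *\<^sub>R x + (orient p z x / s) *\<^sub>R y + (orient p x y / s) *\<^sub>R z"
    using s by (simp add: scaleR_add_right)
  moreover have "orient p y z / s + orient p z x / s + orient p x y / s = 1"
    using s by (simp add: add_divide_distrib[symmetric] s_def)
  ultimately show ?thesis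
    unfolding convex_hull_3 mem_Collect_eq using assms s
    by (intro exI[of _ "orient p y z / s"] exI[of _ "orient p z x / s"] exI[of _ "orient p x y / s"] conjI)
      (auto intro: less_imp_le)
qed

lemma orient_zero_between:
  assumes "orient a b c = 0"
  shows "a \<in> convex hull {b, c} \<or> b \<in> convex hull {a, c} \<or> c \<in> convex hull {a, b}"
proof -
  have "collinear {a, b, c}"
  proof (cases "a = b")
    case True
    then show ?thesis by simp
  next
    case False
    have "\<exists>t. c - a = t *\<^sub>R (b - a)"
    proof (cases "b$1 = a$1")
      case True
      then have "b$2 \<noteq> a$2" using False by (simp add: vec2_eq_iff)
      then show ?thesis using assms True
        by (intro exI[of _ "(c$2 - a$2) / (b$2 - a$2)"]) (simp add: vec2_eq_iff orient_def)
    next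
      case F: False
      define t where "t = (c$1 - a$1) / (b$1 - a$1)"
      have t: "c$1 - a$1 = t * (b$1 - a$1)" using F by (simp add: t_def)
      have "(b$1 - a$1) * (c$2 - a$2) = (b$1 - a$1) * (t * (b$2 - a$2))"
        using assms unfolding orient_def t by (simp add: algebra_simps)
      then have "c$2 - a$2 = t * (b$2 - a$2)" using F by simp
      then show ?thesis using t by (intro exI[of _ t]) (simp add: vec2_eq_iff)
    qed
    then obtain t where "c - a = t *\<^sub>R (b - a)" by blast
    then have "c = t *\<^sub>R b + (1 - t) *\<^sub>R a" by (simp add: algebra_simps)
    then have "collinear {b, c, a}" unfolding collinear_3_expand by blast
    then show ?thesis by (simp add: insert_commute)
  qed
  then show ?thesis
    unfolding collinear_between_cases between_mem_segment segment_convex_hull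
    by (auto simp: insert_commute)
qed

text \<open>
The signed areas give the parameters of the point in which the two lines meet.
\<close>

lemma segments_meet:
  assumes "orient a b c * orient a b d < 0" "orient c d a * orient c d b < 0"
  shows "open_segment a b \<inter> open_segment c d \<noteq> {}"
proof -
  define p q r s where "p = orient a b c" and "q = orient a b d" and "r = orient c d a" and "s = orient c d b"
  have pq: "p * q < 0" "r * s < 0" using assms by (simp_all add: p_def q_def r_def s_def)
  have D: "r - s = q - p" by (simp add: p_def q_def r_def s_def orient_def algebra_simps)
  have "p \<noteq> q" "r \<noteq> s" using pq by (auto simp: mult_less_0_iff)
  define l m where "l = p / (p - q)" and "m = r / (r - s)"
  have l: "0 < l" "l < 1" using pq(1) unfolding l_def
    by (auto simp: mult_less_0_iff divide_simps)
  have m: "0 < m" "m < 1" using pq(2) unfolding m_def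
    by (auto simp: mult_less_0_iff divide_simps)
  have "(p - q) *\<^sub>R (c - a) + p *\<^sub>R (d - c) + r *\<^sub>R (b - a) = 0"
    unfolding vec2_eq_iff p_def q_def r_def by (simp add: orient_def algebra_simps)
  then have "(1 / (p - q)) *\<^sub>R ((p - q) *\<^sub>R (c - a) + p *\<^sub>R (d - c) + r *\<^sub>R (b - a)) = 0" by simp
  then have "(c - a) + l *\<^sub>R (d - c) + (r / (p - q)) *\<^sub>R (b - a) = 0"
    using \<open>p \<noteq> q\<close> by (simp add: scaleR_add_right l_def)
  moreover have "r / (p - q) = - m" using D unfolding m_def by (simp add: minus_divide_right)
  ultimately have "(1 - l) *\<^sub>R c + l *\<^sub>R d = (1 - m) *\<^sub>R a + m *\<^sub>R b"
    by (simp add: algebra_simps)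
  moreover have "a \<noteq> b" "c \<noteq> d" using assms by auto
  then have "(1 - m) *\<^sub>R a + m *\<^sub>R b \<in> open_segment a b" "(1 - l) *\<^sub>R c + l *\<^sub>R d \<in> open_segment c d"
    using l m by (auto simp: in_segment)
  ultimately show ?thesis by auto
qed

text \<open>
The signed area is affine along \<open>cd\<close> and vanishes at the common point, which is not an end
point.
\<close>

lemma segments_cross_sides:
  assumes x: "x \<in> open_segment a b" "x \<in> open_segment c d" and ne: "\<not> (orient a b c = 0 \<and> orient a b d = 0)"
  shows "orient a b c * orient a b d < 0"
proof -
  obtain s where s: "x = (1 - s) *\<^sub>R a + s *\<^sub>R b" using x(1) by (auto simp: in_segment)
  obtain t where t: "0 < t" "t < 1" "x = (1 - t) *\<^sub>R c + t *\<^sub>R d" using x(2) by (auto simp: in_segment)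
  have "orient a b x = 0" using orient_affine[of a b s a b] s by simp
  then have e: "(1 - t) * orient a b c + t * orient a b d = 0" using orient_affine[of a b t c d] t(3) by simp
  show ?thesis
  proof (rule ccontr)
    assume "\<not> ?thesis"
    then have "orient a b c \<ge> 0 \<and> orient a b d \<ge> 0 \<or> orient a b c \<le> 0 \<and> orient a b d \<le> 0"
      by (auto simp: mult_less_0_iff not_less)
    then show False
    proof
      assume h: "orient a b c \<ge> 0 \<and> orient a b d \<ge> 0"
      then have "(1 - t) * orient a b c \<ge> 0" "t * orient a b d \<ge> 0" using t by auto
      then have "(1 - t) * orient a b c = 0" "t * orient a b d = 0" using e by linarith+
      then show False using t ne by auto
    next
      assume h: "orient a b c \<le> 0 \<and> orient a b d \<le> 0"
      then have "(1 - t) * orient a b c \<le> 0" "t * orient a b d \<le> 0" using t by (auto simp: mult_nonneg_nonpos)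
      then have "(1 - t) * orient a b c = 0" "t * orient a b d = 0" using e by linarith+
      then show False using t ne by auto
    qed
  qed
qed

text \<open>
The hypothesis that no point is in the convex hull of others entails that no three points
are collinear.
\<close>

locale pointed_convex_position =
  fixes S :: "(real^2) set" and v :: "real^2"
  assumes fin: "finite S" and v: "v \<in> S"
    and convex_position: "\<And>x A. x \<in> S \<Longrightarrow> A \<subseteq> S \<Longrightarrow> x \<notin> A \<Longrightarrow> x \<notin> convex hull A"
begin

lemma orient_nonzero:
  assumes "a \<in> S" "b \<in> S" "c \<in> S" "a \<noteq> b" "a \<noteq> c" "b \<noteq> c"
  shows "orient a b c \<noteq> 0"
  using orient_zero_between[of a b c] convex_position[of a "{b, c}"] convex_position[of b "{a, c}"]
    convex_position[of c "{a, b}"] assms by auto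

text \<open>
Otherwise \<open>v\<close> would lie inside the triangle \<open>xyz\<close>. Hence turning around \<open>v\<close> orders the other
points.
\<close>

lemma orient_trans:
  assumes "x \<in> S" "y \<in> S" "z \<in> S" "orient v x y > 0" "orient v y z > 0"
  shows "orient v x z > 0"
proof -
  have ne: "x \<noteq> v" "y \<noteq> v" "z \<noteq> v" using assms by auto
  have "v \<notin> convex hull {x, y, z}" using convex_position[OF v, of "{x, y, z}"] assms ne by auto
  then have "\<not> orient v z x > 0" using in_triangle assms(4,5) by blast
  then have "orient v x z \<ge> 0" using orient_swap'[of v x z] by simp
  moreover have "x \<noteq> z" using assms(4,5) orient_swap'[of v x y] by auto
  ultimately show ?thesis using orient_nonzero[OF v assms(1,3)] ne by simp
qed

text \<open>
The position of a point in the order around \<open>v\<close>; labels start from \<open>0\<close> at \<open>v\<close> itself.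
\<close>

definition idx :: "real^2 \<Rightarrow> nat" where
  "idx x = (if x = v then 0 else Suc (card {y \<in> S. orient v y x > 0}))"

lemma idx_v [simp]: "idx v = 0" by (simp add: idx_def)

lemma idx_less:
  assumes "x \<in> S" "y \<in> S" "orient v x y > 0"
  shows "idx x < idx y"
proof -
  have ne: "x \<noteq> v" "y \<noteq> v" using assms(3) by auto
  have "{z \<in> S. orient v z x > 0} \<subseteq> {z \<in> S. orient v z y > 0}" using orient_trans assms by blast
  moreover have "x \<in> {z \<in> S. orient v z y > 0}" "x \<notin> {z \<in> S. orient v z x > 0}" using assms by auto
  ultimately have "{z \<in> S. orient v z x > 0} \<subset> {z \<in> S. orient v z y > 0}" by blast
  then have "card {z \<in> S. orient v z x > 0} < card {z \<in> S. orient v z y > 0}"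
    using fin by (intro psubset_card_mono) auto
  then show ?thesis using ne by (simp add: idx_def)
qed

lemma idx_less_iff:
  assumes "x \<in> S" "y \<in> S" "x \<noteq> v"
  shows "idx x < idx y \<longleftrightarrow> orient v x y > 0"
proof
  assume l: "idx x < idx y"
  then have ne: "x \<noteq> y" "y \<noteq> v" by auto
  have "\<not> orient v y x > 0" using idx_less[OF assms(2,1)] l by auto
  then have "orient v x y \<ge> 0" using orient_swap'[of v x y] by simp
  then show "orient v x y > 0" using orient_nonzero[OF v assms(1,2)] ne assms(3) by simp
qed (use idx_less assms in blast)

lemma idx_inj: "inj_on idx S"
proof (rule inj_onI, rule ccontr)
  fix x y assume xy: "x \<in> S" "y \<in> S" "idx x = idx y" "x \<noteq> y"
  then have "x \<noteq> v" "y \<noteq> v" by (auto simp: idx_def split: if_splits)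
  then show False
    using orient_nonzero[OF v xy(1,2)] idx_less[OF xy(1,2)] idx_less[OF xy(2,1)] orient_swap'[of v x y] xy(3,4)
    by force
qed

lemma idx_eq_iff: "x \<in> S \<Longrightarrow> y \<in> S \<Longrightarrow> idx x = idx y \<longleftrightarrow> x = y"
  using idx_inj by (auto dest: inj_onD)

text \<open>
If \<open>abc\<close> were oriented the other way, then \<open>b\<close> would lie inside the triangle \<open>vac\<close>.
\<close>

lemma orient_idx:
  assumes S: "a \<in> S" "b \<in> S" "c \<in> S" and l: "idx a < idx b" "idx b < idx c"
  shows "orient a b c > 0"
proof (cases "a = v")
  case True
  have "b \<noteq> v" using l(1) by auto
  then show ?thesis using idx_less_iff[OF S(2,3)] l(2) True by simp
next
  case False
  have ne: "b \<noteq> v" "c \<noteq> v" "a \<noteq> b" "b \<noteq> c" "a \<noteq> c" using l by auto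
  have o: "orient v a b > 0" "orient v b c > 0"
    using idx_less_iff[OF S(1,2)] idx_less_iff[OF S(2,3)] l False ne by auto
  have "b \<notin> convex hull {v, a, c}" using convex_position[OF S(2), of "{v, a, c}"] S v ne by auto
  moreover have "orient b v a > 0" "orient b c v > 0"
    using o orient_rotate[of b v a] orient_rotate[of v a b] orient_rotate[of v b c] orient_rotate[of b c v] by simp_all
  ultimately have "\<not> orient b a c > 0" using in_triangle by blast
  then have "orient a b c \<ge> 0" using orient_swap[of b a c] by simp
  then show ?thesis using orient_nonzero[OF S] ne by simp
qed

lemma orient_sign:
  assumes S: "a \<in> S" "b \<in> S" "c \<in> S" and l: "idx a < idx b" and ne: "c \<noteq> a" "c \<noteq> b"
  shows "orient a b c < 0 \<longleftrightarrow> idx a < idx c \<and> idx c < idx b"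
proof -
  have "idx c \<noteq> idx a" "idx c \<noteq> idx b" using idx_eq_iff S ne by auto
  then consider "idx c < idx a" | "idx a < idx c" "idx c < idx b" | "idx b < idx c" by linarith
  then show ?thesis
  proof cases
    case 1
    then show ?thesis using orient_idx[OF S(3,1,2) 1 l] orient_rotate[of c a b] orient_rotate[of b c a] by simp
  next
    case 2
    then show ?thesis using orient_idx[OF S(1,3,2) 2] orient_swap'[of a c b] by simp
  next
    case 3
    then show ?thesis using orient_idx[OF S l 3] l by simp
  qed
qed

end

context pointed_convex_position
begin

definition labels :: "nat set" where "labels = idx ` S"

definition point_chords :: "(real^2) set set" where
  "point_chords = {e. e \<subseteq> S \<and> card e = 2}"

lemma point_chordsE:
  assumes "e \<in> point_chords"
  obtains a b where "e = {a, b}" "a \<in> S" "b \<in> S" "idx a < idx b"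
proof -
  obtain a b where ab: "e = {a, b}" "a \<noteq> b" "a \<in> S" "b \<in> S"
    using assms by (auto simp: point_chords_def card_2_iff)
  then have "idx a \<noteq> idx b" using idx_eq_iff by blast
  then show thesis using that[of a b] that[of b a] ab by (metis insert_commute linorder_neqE_nat)
qed

lemma finite_labels: "finite labels" using fin by (simp add: labels_def)

lemma card_labels: "card labels = card S" unfolding labels_def by (rule card_image[OF idx_inj])

lemma zero_labels: "0 \<in> labels" unfolding labels_def using v idx_v by (metis imageI)

lemma rel_interior_edge:
  "a \<noteq> b \<Longrightarrow> rel_interior (convex hull {a, b}) = open_segment a b" for a b :: "real^2"
  by (simp add: segment_convex_hull[symmetric] rel_interior_closed_segment)

text \<open>
Segments meet in their relative interiors exactly when each separates the ends of the other.
By \<open>orient_sign\<close>, the point \<open>c\<close> is on the negative side of \<open>ab\<close> exactly when its label lies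
between those of \<open>a\<close> and \<open>b\<close>.
\<close>

lemma edges_cross_iff:
  assumes e: "e \<in> point_chords" and f: "f \<in> point_chords"
  shows "edges_cross e f \<longleftrightarrow> crosses (idx ` e) (idx ` f)"
proof
  obtain a b where ab: "e = {a, b}" "a \<in> S" "b \<in> S" "idx a < idx b" using point_chordsE[OF e] .
  obtain c d where cd: "f = {c, d}" "c \<in> S" "d \<in> S" "idx c < idx d" using point_chordsE[OF f] .
  have ne: "a \<noteq> b" "c \<noteq> d" using ab cd by auto
  assume "edges_cross e f"
  then obtain x where x: "e \<noteq> f" "x \<in> open_segment a b" "x \<in> open_segment c d"
    using rel_interior_edge ne ab(1) cd(1) by (auto simp: edges_cross_def)
  have "\<not> (orient a b c = 0 \<and> orient a b d = 0)"
  proof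
    assume z: "orient a b c = 0 \<and> orient a b d = 0"
    have "c = a \<or> c = b" using orient_nonzero[OF ab(2,3) cd(2) ne(1)] z by auto
    moreover have "d = a \<or> d = b" using orient_nonzero[OF ab(2,3) cd(3) ne(1)] z by auto
    ultimately show False using x(1) ne ab(1) cd(1) by auto
  qed
  then have lt: "orient a b c * orient a b d < 0" using segments_cross_sides[OF x(2,3)] by blast
  then have n: "c \<noteq> a" "c \<noteq> b" "d \<noteq> a" "d \<noteq> b" by auto
  have n': "idx c \<noteq> idx a" "idx c \<noteq> idx b" "idx d \<noteq> idx a" "idx d \<noteq> idx b"
    using n idx_eq_iff ab cd by auto
  have "orient a b c < 0 \<and> \<not> orient a b d < 0 \<or> \<not> orient a b c < 0 \<and> orient a b d < 0"
    using lt by (auto simp: mult_less_0_iff)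
  then have "idx a < idx c \<and> idx c < idx b \<and> \<not> (idx a < idx d \<and> idx d < idx b) \<or>
      \<not> (idx a < idx c \<and> idx c < idx b) \<and> idx a < idx d \<and> idx d < idx b"
    unfolding orient_sign[OF ab(2,3) cd(2) ab(4) n(1,2)] orient_sign[OF ab(2,3) cd(3) ab(4) n(3,4)] by blast
  moreover have "idx d < idx a \<or> idx b < idx d" if "\<not> (idx a < idx d \<and> idx d < idx b)"
    using that n'(3,4) by linarith
  moreover have "idx c < idx a \<or> idx b < idx c" if "\<not> (idx a < idx c \<and> idx c < idx b)"
    using that n'(1,2) by linarith
  ultimately have "crosses {idx a, idx b} {idx c, idx d}"
    unfolding crosses_sorted(1)[OF ab(4)] by blast
  then show "crosses (idx ` e) (idx ` f)" using ab cd by simp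
next
  assume c: "crosses (idx ` e) (idx ` f)"
  have key: "open_segment a b \<inter> open_segment c d \<noteq> {}"
    if h: "a \<in> S" "b \<in> S" "c \<in> S" "d \<in> S" "idx a < idx c" "idx c < idx b" "idx b < idx d" for a b c d
  proof (rule segments_meet)
    have "orient a b c < 0" using orient_idx[OF h(1,3,2,5,6)] orient_swap'[of a c b] by simp
    moreover have "orient a b d > 0" by (rule orient_idx) (use h in auto)
    ultimately show "orient a b c * orient a b d < 0" by (simp add: mult_neg_pos)
    have "orient c d b < 0" using orient_idx[OF h(3,2,4,6,7)] orient_swap'[of c b d] by simp
    moreover have "orient c d a > 0"
      using orient_idx[of a c d] h orient_rotate[of c d a] by auto
    ultimately show "orient c d a * orient c d b < 0" by (simp add: mult_pos_neg)
  qed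
  obtain a b where ab: "e = {a, b}" "a \<in> S" "b \<in> S" "idx a < idx b" using point_chordsE[OF e] .
  obtain c' d where cd: "f = {c', d}" "c' \<in> S" "d \<in> S" "idx c' < idx d" using point_chordsE[OF f] .
  have "idx a < idx c' \<and> idx c' < idx b \<and> idx b < idx d \<or> idx c' < idx a \<and> idx a < idx d \<and> idx d < idx b"
    using c ab(1,4) cd(1,4) by (auto simp: crosses_iff)
  then have "open_segment a b \<inter> open_segment c' d \<noteq> {}"
    using key[of a b c' d] key[of c' d a b] ab cd by blast
  moreover have "a \<noteq> b" "c' \<noteq> d" using ab cd by auto
  moreover have "e \<noteq> f" using c by (auto simp: crosses_def doubleton_eq_iff)
  ultimately show "edges_cross e f"
    unfolding edges_cross_def using rel_interior_edge ab(1) cd(1) by simp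
qed

abbreviation idxT :: "(real^2) set set \<Rightarrow> nat set set" where
  "idxT T \<equiv> (`) idx ` T"

lemma idx_edge_inj: "inj_on ((`) idx) (Pow S)"
  using idx_inj by (meson inj_on_image_Pow)

lemma point_chords_Pow: "point_chords \<subseteq> Pow S" by (auto simp: point_chords_def)

lemma idx_edges: "idxT point_chords = chords labels"
proof (intro equalityI subsetI)
  fix e assume "e \<in> idxT point_chords"
  then obtain a b where "e = idx ` {a, b}" "a \<in> S" "b \<in> S" "idx a < idx b"
    using point_chordsE by (metis imageE)
  then show "e \<in> chords labels" by (simp add: labels_def)
next
  fix e assume "e \<in> chords labels"
  then obtain a b where ab: "e = {idx a, idx b}" "a \<in> S" "b \<in> S" "idx a \<noteq> idx b"
    by (auto simp: labels_def elim!: chordsE)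
  then have "{a, b} \<in> point_chords" by (auto simp: point_chords_def card_insert_if)
  then show "e \<in> idxT point_chords" using ab(1) by (intro image_eqI[of _ _ "{a, b}"]) auto
qed

definition maximal_plane :: "(real^2) set set \<Rightarrow> bool" where
  "maximal_plane T \<longleftrightarrow> T \<subseteq> point_chords \<and> pairwise (\<lambda>e f. \<not> edges_cross e f) T \<and>
     (\<forall>T'. T' \<subseteq> point_chords \<and> pairwise (\<lambda>e f. \<not> edges_cross e f) T' \<and> T \<subseteq> T' \<longrightarrow> T' = T)"

lemma plane_idx:
  assumes "T \<subseteq> point_chords"
  shows "plane (idxT T) \<longleftrightarrow> pairwise (\<lambda>e f. \<not> edges_cross e f) T"
proof -
  have "\<not> crosses (idx ` e) (idx ` e)" if "e \<in> T" for e
    using edges_cross_iff[of e e] that assms by (auto simp: edges_cross_def)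
  moreover have "edges_cross e f \<longleftrightarrow> crosses (idx ` e) (idx ` f)" if "e \<in> T" "f \<in> T" for e f
    using edges_cross_iff that assms by blast
  ultimately show ?thesis
    unfolding plane_def pairwise_def ball_simps by metis
qed

lemma idxT_subset_iff: "T \<subseteq> point_chords \<Longrightarrow> T' \<subseteq> point_chords \<Longrightarrow> idxT T \<subseteq> idxT T' \<longleftrightarrow> T \<subseteq> T'"
  by (rule inj_on_image_subset_iff[OF idx_edge_inj]) (use point_chords_Pow in auto)

lemma idxT_preimage:
  assumes "U \<subseteq> chords labels"
  obtains T where "T \<subseteq> point_chords" "idxT T = U"
  using assms unfolding idx_edges[symmetric] by (auto simp: subset_image_iff)

lemma triang_idx:
  assumes T: "T \<subseteq> point_chords"
  shows "maximal_plane T \<longleftrightarrow> triang labels (idxT T)"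
proof
  assume p: "maximal_plane T"
  have I: "idxT T \<subseteq> chords labels" using T unfolding idx_edges[symmetric] by blast
  have "plane (idxT T)" using p plane_idx[OF T] by (simp add: maximal_plane_def)
  then obtain U where U: "triang labels U" "idxT T \<subseteq> U" using plane_extends[OF finite_labels I] by blast
  obtain T' where T': "T' \<subseteq> point_chords" "idxT T' = U" using idxT_preimage[OF triangD(1)[OF U(1)]] .
  have "T \<subseteq> T'" using U(2) T' idxT_subset_iff[OF T T'(1)] by simp
  moreover have "pairwise (\<lambda>e f. \<not> edges_cross e f) T'"
    using plane_idx[OF T'(1)] triangD(2)[OF U(1)] T'(2) by simp
  ultimately have "T' = T" using p T'(1) unfolding maximal_plane_def by blast
  then show "triang labels (idxT T)" using U(1) T'(2) by simp
next
  assume t: "triang labels (idxT T)"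
  have "T' = T" if h: "T' \<subseteq> point_chords" "pairwise (\<lambda>e f. \<not> edges_cross e f) T'" "T \<subseteq> T'" for T'
  proof -
    have "plane (idxT T')" using plane_idx[OF h(1)] h(2) by simp
    moreover have "idxT T' \<subseteq> chords labels" using h(1) unfolding idx_edges[symmetric] by blast
    ultimately obtain U where U: "triang labels U" "idxT T' \<subseteq> U" using plane_extends[OF finite_labels] by blast
    have "idxT T \<subseteq> U" using U(2) h(3) by blast
    then have "idxT T = U" using triang_subset_eq[OF t U(1)] by simp
    then have "idxT T' \<subseteq> idxT T" using U(2) by simp
    then show ?thesis using idxT_subset_iff[OF h(1) T] h(3) by blast
  qed
  moreover have "pairwise (\<lambda>e f. \<not> edges_cross e f) T" using plane_idx[OF T] triangD(2)[OF t] by simp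
  ultimately show "maximal_plane T" using T unfolding maximal_plane_def by blast
qed

lemma first_last:
  assumes "3 \<le> card S"
  obtains l h where "l \<in> S - {v}" "h \<in> S - {v}" "idx l < idx h"
    "\<And>x. x \<in> S - {v} \<Longrightarrow> idx l \<le> idx x \<and> idx x \<le> idx h"
proof -
  obtain T where "triang labels T" using plane_extends[OF finite_labels, of "{}"] by (auto simp: plane_def)
  have n3: "3 \<le> card labels" using assms card_labels by simp
  obtain i j where ij: "i \<in> nbrs T" "j \<in> nbrs T" "i < j" "\<forall>x\<in>labels - {0}. i \<le> x \<and> x \<le> j"
    using nbrs_ends[OF \<open>triang labels T\<close> finite_labels zero_labels n3] by (elim exE conjE)
  have "i \<in> labels - {0}" "j \<in> labels - {0}" using nbrs_subset[OF \<open>triang labels T\<close>] ij by auto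
  then obtain l h where lh: "l \<in> S" "h \<in> S" "i = idx l" "j = idx h" "idx l \<noteq> 0" "idx h \<noteq> 0"
    by (auto simp: labels_def)
  have "idx l \<le> idx x \<and> idx x \<le> idx h" if "x \<in> S - {v}" for x
  proof -
    have "idx x \<noteq> 0" using that by (simp add: idx_def)
    then have "idx x \<in> labels - {0}" using that by (simp add: labels_def)
    then show ?thesis using ij(4) lh(3,4) by blast
  qed
  moreover have "l \<noteq> v" "h \<noteq> v" using lh by auto
  ultimately show thesis using that lh ij(3) by auto
qed

text \<open>
All the other points lie strictly on one side of the line through \<open>v\<close> and \<open>l\<close>; the factor
\<open>s\<close> is a sign that selects the side.
\<close>

lemma orient_pos_face:
  assumes l: "l \<in> S" "l \<noteq> v" and pos: "\<And>x. x \<in> S - {v, l} \<Longrightarrow> s * orient v l x > 0"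
  shows "convex hull {v, l} edge_of convex hull S"
proof -
  have "affine hull {v, l} \<inter> convex hull (S - {v, l}) = {}"
  proof -
    have "s * orient v l x > 0" if "x \<in> convex hull (S - {v, l})" for x
    proof -
      have "convex {x. s * orient v l x > 0}"
      proof (rule convexI)
        fix x y and p q :: real
        assume h: "x \<in> {x. s * orient v l x > 0}" "y \<in> {x. s * orient v l x > 0}" "0 \<le> p" "0 \<le> q" "p + q = 1"
        then have p: "p = 1 - q" by simp
        have "s * orient v l (p *\<^sub>R x + q *\<^sub>R y) = p * (s * orient v l x) + q * (s * orient v l y)"
          unfolding p orient_affine by (simp add: algebra_simps)
        also have "\<dots> > 0"
        proof (cases "q = 0")
          case True
          then show ?thesis using h(1) p by simp
        next
          case False
          have "0 \<le> p * (s * orient v l x)" by (rule mult_nonneg_nonneg[OF h(3)]) (use h(1) in simp)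
          moreover have "0 < q * (s * orient v l y)" by (rule mult_pos_pos) (use h(2,4) False in simp_all)
          ultimately show ?thesis by (rule add_nonneg_pos)
        qed
        finally show "p *\<^sub>R x + q *\<^sub>R y \<in> {x. s * orient v l x > 0}" by simp
      qed
      then have "convex hull (S - {v, l}) \<subseteq> {x. s * orient v l x > 0}"
        by (rule hull_minimal[rotated]) (use pos in auto)
      then show ?thesis using that by blast
    qed
    moreover have "orient v l x = 0" if x: "x \<in> affine hull {v, l}" for x
    proof -
      obtain p q where "x = p *\<^sub>R v + q *\<^sub>R l" "p + q = 1" using x unfolding affine_hull_2 by blast
      moreover from this have "p = 1 - q" by simp
      ultimately have "x = (1 - q) *\<^sub>R v + q *\<^sub>R l" by simp
      then show ?thesis using orient_affine[of v l q v l] by simp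
    qed
    ultimately show ?thesis by force
  qed
  then have "convex hull {v, l} face_of convex hull S"
    using face_of_convex_hulls[OF fin, of "{v, l}"] v l by blast
  moreover have "aff_dim (convex hull {v, l}) = 1"
    using l(2) by (simp add: aff_dim_convex_hull aff_dim_2)
  ultimately show ?thesis by (simp add: edge_of_def)
qed

end

section \<open>Convex polygons\<close>

lemma polygon_eq_hull:
  assumes "convex_polygon \<pi>"
  shows "\<pi> = convex hull (polygon_vertices \<pi>)"
  using assms Krein_Milman_Minkowski[of \<pi>] polytope_imp_compact polytope_imp_convex
  unfolding convex_polygon_def polygon_vertices_def by blast

lemma polygon_card:
  assumes "convex_polygon \<pi>"
  shows "3 \<le> card (polygon_vertices \<pi>)"
proof -
  have "aff_dim (polygon_vertices \<pi>) = 2"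
    using polygon_eq_hull[OF assms] assms aff_dim_convex_hull[of "polygon_vertices \<pi>"]
    by (simp add: convex_polygon_def)
  then show ?thesis using aff_dim_le_card[OF finite_polygon_vertices[OF assms]] by simp
qed

lemma polygon_pointed:
  assumes P: "convex_polygon \<pi>" and v: "v \<in> polygon_vertices \<pi>"
  shows "pointed_convex_position (polygon_vertices \<pi>) v"
proof
  fix x A assume x: "x \<in> polygon_vertices \<pi>" and A: "A \<subseteq> polygon_vertices \<pi>" "x \<notin> A"
  have sub: "convex hull A \<subseteq> \<pi>" using polygon_eq_hull[OF P] hull_mono[OF A(1)] by metis
  show "x \<notin> convex hull A"
  proof
    assume "x \<in> convex hull A"
    then have "x extreme_point_of (convex hull A)"
      using x sub unfolding polygon_vertices_def extreme_point_of_def by blast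
    then show False using extreme_point_of_convex_hull A(2) by blast
  qed
qed (use finite_polygon_vertices[OF P] v in auto)

locale pointed_polygon =
  fixes \<pi> :: "(real^2) set" and v :: "real^2"
  assumes polygon: "convex_polygon \<pi>" and apex: "v \<in> polygon_vertices \<pi>"

sublocale pointed_polygon \<subseteq> pointed_convex_position "polygon_vertices \<pi>" v
  using polygon_pointed polygon apex .

context pointed_polygon
begin

lemma edges_on_eq: "edges_on \<pi> = point_chords"
  by (simp add: edges_on_def point_chords_def)

lemma triangulation_sub: "triangulation_of T \<pi> \<Longrightarrow> T \<subseteq> point_chords"
  by (simp add: triangulation_of_def noncrossing_def edges_on_eq)

lemma triangulation_iff: "T \<subseteq> point_chords \<Longrightarrow> triangulation_of T \<pi> \<longleftrightarrow> triang labels (idxT T)"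
  unfolding triang_idx[symmetric] maximal_plane_def triangulation_of_def noncrossing_def edges_on_eq by blast

lemma triangulation_idx: "triangulation_of T \<pi> \<Longrightarrow> triang labels (idxT T)"
  using triangulation_iff triangulation_sub by blast

lemma triangulation_preimage:
  assumes "triang labels U"
  obtains T where "triangulation_of T \<pi>" "idxT T = U"
  using idxT_preimage[OF triangD(1)[OF assms]] triangulation_iff assms by metis

lemma flips_to_flip_step:
  assumes "flips_to \<pi> T T'"
  shows "flip_step labels (idxT T) (idxT T')"
proof -
  obtain e f where t: "triangulation_of T \<pi>" "triangulation_of T' \<pi>" and ef: "T' = insert f (T - {e})"
    using assms by (auto simp: flips_to_def)
  have "idxT T' \<subseteq> insert (idx ` f) (idxT T)" "idxT T \<subseteq> insert (idx ` e) (idxT T')"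
    using ef by auto
  then show ?thesis unfolding flip_step_def using triangulation_idx t by blast
qed

text \<open>
Maximality turns "at most one" into "exactly one": the two triangulations differ, so neither
is contained in the other. The removed edge is interior because every triangulation contains
the boundary.
\<close>

lemma flip_step_flips_to:
  assumes t: "triangulation_of T \<pi>" "triangulation_of T' \<pi>" and a: "flip_step labels (idxT T) (idxT T')" and ne: "T \<noteq> T'"
  shows "flips_to \<pi> T T'"
proof -
  note sub = triangulation_sub[OF t(1)] triangulation_sub[OF t(2)]
  obtain e f where ef: "idxT T' \<subseteq> insert f (idxT T)" "idxT T \<subseteq> insert e (idxT T')"
    using a by (auto simp: flip_step_def)
  have inj: "x = y" if "x \<in> point_chords" "y \<in> point_chords" "idx ` x = idx ` y" for x y
    using idx_edge_inj that point_chords_Pow by (meson inj_onD subsetD)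
  have one: "x = y" if "x \<in> A - B" "y \<in> A - B" "idxT A \<subseteq> insert g (idxT B)" "A \<subseteq> point_chords" "B \<subseteq> point_chords"
    for x y A B g
  proof -
    have "idx ` z = g" if z: "z \<in> A - B" for z
    proof (rule ccontr)
      assume "idx ` z \<noteq> g"
      then have "idx ` z \<in> idxT B" using z \<open>idxT A \<subseteq> insert g (idxT B)\<close> by blast
      then obtain w where "w \<in> B" "idx ` z = idx ` w" by blast
      then have "z = w" using inj z \<open>A \<subseteq> point_chords\<close> \<open>B \<subseteq> point_chords\<close> by blast
      then show False using z \<open>w \<in> B\<close> by blast
    qed
    then show ?thesis using inj that by (metis DiffD1 subsetD)
  qed
  have max: "\<not> T \<subseteq> T'" "\<not> T' \<subseteq> T" using t ne unfolding triangulation_of_def by blast+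
  obtain x where x: "x \<in> T - T'" using max by blast
  obtain y where y: "y \<in> T' - T" using max by blast
  have "T - T' = {x}" using x one[OF _ _ ef(2) sub] by blast
  moreover have "T' - T = {y}" using y one[OF _ _ ef(1) sub(2,1)] by blast
  ultimately have eq: "T' = insert y (T - {x})" by blast
  have "x \<in> interior_edges \<pi> T"
    using x boundary_edges_subset_triangulation[OF t(2)] unfolding interior_edges_def by blast
  moreover have "y \<in> edges_on \<pi>" using y sub edges_on_eq by blast
  moreover have "y \<noteq> x" using x y by blast
  ultimately show ?thesis unfolding flips_to_def using t eq by blast
qed

lemma flip_graph_simps [simp]:
  "pverts (flip_graph \<pi>) = {T. triangulation_of T \<pi>}"
  "parcs (flip_graph \<pi>) = {(T, T'). flips_to \<pi> T T'}"
  by (simp_all add: flip_graph_def)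

interpretation flips: pair_graph "flip_graph \<pi>"
  by (rule graph_flip_graph[OF polygon])

lemma walk_reach:
  assumes "flips.awalk T p T'"
  shows "reach labels (length p) (idxT T) (idxT T')"
  using assms
proof (induction p arbitrary: T)
  case Nil
  then have "T = T'" "triangulation_of T \<pi>" by (auto simp: flips.awalk_Nil_iff)
  then show ?case using reach_refl triangulation_idx by simp
next
  case (Cons e p)
  then have e: "e \<in> parcs (flip_graph \<pi>)" "T = fst e" "flips.awalk (snd e) p T'"
    by (auto simp: flips.awalk_Cons_iff)
  then have "flips_to \<pi> T (snd e)" by auto
  then show ?case using reach_step[OF flips_to_flip_step Cons.IH[OF e(3)]] by simp
qed

lemma reach_walk:
  assumes "reach labels L A B" "A = idxT T" "B = idxT T'" "triangulation_of T \<pi>" "triangulation_of T' \<pi>"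
  shows "\<exists>p. flips.awalk T p T' \<and> length p \<le> L"
  using assms
proof (induction arbitrary: T rule: reach.induct)
  case (reach_refl A)
  have "T = T'" using idxT_subset_iff triangulation_sub reach_refl.prems by (metis subset_antisym order_refl)
  then have "flips.awalk T [] T'" using reach_refl.prems by (simp add: flips.awalk_Nil_iff)
  then show ?case by (intro exI[of _ "[]"]) simp
next
  case (reach_step A U L B)
  have "triang labels U" using reach_step.hyps(1) by (simp add: flip_step_def)
  then obtain S where S: "triangulation_of S \<pi>" "idxT S = U" using triangulation_preimage by blast
  obtain p where p: "flips.awalk S p T'" "length p \<le> L"
    using reach_step.IH[OF S(2)[symmetric] reach_step.prems(2) S(1) reach_step.prems(4)] by blast
  show ?case
  proof (cases "S = T")
    case True
    then show ?thesis using p by (intro exI[of _ p]) simp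
  next
    case False
    then have "flips_to \<pi> T S"
      using flip_step_flips_to[OF reach_step.prems(3) S(1)] reach_step.hyps(1) reach_step.prems(1) S(2) by auto
    then have "flips.awalk T ((T, S) # p) T'"
      using p(1) reach_step.prems(3) by (simp add: flips.awalk_Cons_iff)
    then show ?thesis using p(2) by (intro exI[of _ "(T, S) # p"]) simp
  qed
qed

lemma awalk_cost_length: "flips.awalk_cost (\<lambda>_. 1) p = real (length p)"
  by (induction p) auto

lemma graph_distance_le:
  assumes "reach labels L (idxT T) (idxT T')" "triangulation_of T \<pi>" "triangulation_of T' \<pi>"
  shows "graph_distance (with_proj (flip_graph \<pi>)) T T' \<le> ereal (real L)"
proof -
  obtain p where p: "flips.awalk T p T'" "length p \<le> L" using reach_walk[OF assms(1) refl refl assms(2,3)] by blast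
  have "graph_distance (with_proj (flip_graph \<pi>)) T T' \<le> ereal (real (length p))"
    using flips.min_cost_le_walk_cost[OF p(1), of "\<lambda>_. 1"] unfolding graph_distance_def awalk_cost_length .
  also have "\<dots> \<le> ereal (real L)" using p(2) by simp
  finally show ?thesis .
qed

lemma graph_distance_ge:
  assumes "\<And>L. reach labels L (idxT T) (idxT T') \<Longrightarrow> c \<le> real L"
  shows "ereal c \<le> graph_distance (with_proj (flip_graph \<pi>)) T T'"
  unfolding graph_distance_def flips.\<mu>_def
proof (rule INF_greatest)
  fix p assume "p \<in> {p. flips.awalk T p T'}"
  then show "ereal c \<le> ereal (flips.awalk_cost (\<lambda>_. 1) p)"
    using assms[OF walk_reach] by (simp add: awalk_cost_length)
qed

text \<open>
Exactly two of the edges at \<open>v\<close> are boundary edges, those to the first and to the last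
vertex. Any other edge at \<open>v\<close> is crossed by the edge between these two.
\<close>

lemma card_interior_at_apex:
  assumes T: "triangulation_of T \<pi>"
  shows "card {e \<in> interior_edges \<pi> T. v \<in> e} + 2 = card (nbrs (idxT T))"
    and "\<exists>l\<in>nbrs (idxT T). \<exists>h\<in>nbrs (idxT T). \<forall>x\<in>labels - {0}. l \<le> x \<and> x \<le> h"
proof -
  let ?S = "polygon_vertices \<pi>"
  note sub = triangulation_sub[OF T] and t = triangulation_idx[OF T]
  obtain l h where lh: "l \<in> ?S - {v}" "h \<in> ?S - {v}" "idx l < idx h"
    "\<And>x. x \<in> ?S - {v} \<Longrightarrow> idx l \<le> idx x \<and> idx x \<le> idx h"
    using first_last[OF polygon_card[OF polygon]] by blast
  have edge_mem: "{v, x} \<in> point_chords" if "x \<in> ?S - {v}" for x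
    using that apex by (auto simp: point_chords_def card_insert_if)
  have "1 * orient v l x > 0" if x: "x \<in> ?S - {v, l}" for x
  proof -
    have "idx x \<noteq> idx l" using idx_eq_iff x lh(1) by blast
    then have "idx l < idx x" using lh(4)[of x] x by (simp add: order_less_le)
    then show ?thesis using idx_less_iff[of l x] x lh(1) by auto
  qed
  then have "convex hull {v, l} edge_of \<pi>"
    using orient_pos_face[of l 1] lh(1) polygon_eq_hull[OF polygon] by auto
  then have bl: "{v, l} \<in> boundary_edges \<pi>" using edge_mem[OF lh(1)] by (simp add: boundary_edges_def edges_on_eq)
  have "(-1) * orient v h x > 0" if x: "x \<in> ?S - {v, h}" for x
  proof -
    have "idx x \<noteq> idx h" using idx_eq_iff x lh(2) by blast
    then have "idx x < idx h" using lh(4)[of x] x by (simp add: order_less_le)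
    then have "orient v x h > 0" using idx_less_iff[of x h] x lh(2) by auto
    then show ?thesis using orient_swap'[of v x h] by simp
  qed
  then have "convex hull {v, h} edge_of \<pi>"
    using orient_pos_face[of h "-1"] lh(2) polygon_eq_hull[OF polygon] by auto
  then have bh: "{v, h} \<in> boundary_edges \<pi>" using edge_mem[OF lh(2)] by (simp add: boundary_edges_def edges_on_eq)
  have inner: "{v, x} \<notin> boundary_edges \<pi>" if x: "x \<in> ?S - {v, l, h}" for x
  proof
    assume b: "{v, x} \<in> boundary_edges \<pi>"
    have "idx x \<noteq> idx l" "idx x \<noteq> idx h" using idx_eq_iff x lh by blast+
    then have "idx l < idx x" "idx x < idx h" using lh(4)[of x] x by (simp_all add: order_less_le)
    moreover have "0 < idx l" using lh(1) by (simp add: idx_def)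
    ultimately have c: "crosses (idx ` {l, h}) (idx ` {v, x})" by (simp add: crosses_iff)
    have e: "{l, h} \<in> point_chords" using lh by (auto simp: point_chords_def card_insert_if)
    then have "edges_cross {l, h} {v, x}"
      using c edges_cross_iff edge_mem[of x] x by blast
    then show False using boundary_edge_not_crossed[OF b] e edges_on_eq by blast
  qed
  define X where "X = {x \<in> ?S. {v, x} \<in> T}"
  have vX: "v \<notin> X" using sub by (auto simp: X_def point_chords_def)
  have lX: "l \<in> X" "h \<in> X" using bl bh boundary_edges_subset_triangulation[OF T] lh by (auto simp: X_def)
  have finX: "finite X" using fin by (simp add: X_def)
  have nb: "nbrs (idxT T) = idx ` X"
  proof (intro equalityI subsetI)
    fix i assume "i \<in> nbrs (idxT T)"
    then obtain e where e: "e \<in> T" "{0, i} = idx ` e" by (auto simp: nbrs_def)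
    obtain a b where ab: "e = {a, b}" "a \<in> ?S" "b \<in> ?S" "idx a < idx b" using point_chordsE e(1) sub by (metis subsetD)
    then have "idx a = 0" "idx b = i" using e(2) by (auto simp: doubleton_eq_iff)
    then have "a = v" by (simp add: idx_def split: if_splits)
    then show "i \<in> idx ` X" using ab e(1) \<open>idx b = i\<close> by (auto simp: X_def)
  next
    fix i assume "i \<in> idx ` X"
    then obtain x where "x \<in> X" "i = idx x" by blast
    then show "i \<in> nbrs (idxT T)" unfolding nbrs_def X_def by (auto intro!: image_eqI[of _ _ "{v, x}"])
  qed
  have "{e \<in> interior_edges \<pi> T. v \<in> e} = (\<lambda>x. {v, x}) ` (X - {l, h})"
  proof (intro equalityI subsetI)
    fix e assume e: "e \<in> {e \<in> interior_edges \<pi> T. v \<in> e}"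
    then have eT: "e \<in> T" "e \<notin> boundary_edges \<pi>" "v \<in> e" by (auto simp: interior_edges_def)
    obtain a b where ab: "e = {a, b}" "a \<in> ?S" "b \<in> ?S" "idx a < idx b" using point_chordsE eT(1) sub by (metis subsetD)
    obtain x where x: "e = {v, x}" "x \<in> ?S"
    proof (cases "v = a")
      case True
      then show thesis using that[of b] ab by simp
    next
      case False
      then have "v = b" using eT(3) ab(1) by simp
      then show thesis using that[of a] ab insert_commute[of a b] by simp
    qed
    then have "x \<in> X" "x \<noteq> l" "x \<noteq> h" using eT bl bh by (auto simp: X_def)
    then show "e \<in> (\<lambda>x. {v, x}) ` (X - {l, h})" using x(1) by blast
  next
    fix e assume "e \<in> (\<lambda>x. {v, x}) ` (X - {l, h})"
    then obtain x where x: "x \<in> X" "x \<noteq> l" "x \<noteq> h" "e = {v, x}" by blast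
    then have "x \<in> ?S - {v, l, h}" using vX by (auto simp: X_def)
    then show "e \<in> {e \<in> interior_edges \<pi> T. v \<in> e}"
      using inner x by (auto simp: interior_edges_def X_def)
  qed
  moreover have "inj_on (\<lambda>x. {v, x}) (X - {l, h})" by (auto simp: inj_on_def doubleton_eq_iff)
  ultimately have "card {e \<in> interior_edges \<pi> T. v \<in> e} = card (X - {l, h})" by (simp add: card_image)
  moreover have "l \<noteq> h" using lh(3) by auto
  then have "card (X - {l, h}) + 2 = card X"
    using lX finX card_mono[of X "{l, h}"] by (subst card_Diff_subset) auto
  moreover have "card (nbrs (idxT T)) = card X"
    unfolding nb by (rule card_image, rule inj_on_subset[OF idx_inj]) (auto simp: X_def)
  ultimately show "card {e \<in> interior_edges \<pi> T. v \<in> e} + 2 = card (nbrs (idxT T))" by simp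
  have "idx l \<le> y \<and> y \<le> idx h" if y: "y \<in> labels - {0}" for y
  proof -
    obtain x where x: "x \<in> ?S" "y = idx x" using y by (auto simp: labels_def)
    then have "x \<noteq> v" using y by auto
    then show ?thesis using lh(4)[of x] x by simp
  qed
  then show "\<exists>l\<in>nbrs (idxT T). \<exists>h\<in>nbrs (idxT T). \<forall>x\<in>labels - {0}. l \<le> x \<and> x \<le> h"
    unfolding nb using lX by blast
qed

theorem eccentricity_apex:
  assumes T: "triangulation_of T \<pi>" and n: "card (polygon_vertices \<pi>) = n"
    and k: "card {e \<in> interior_edges \<pi> T. v \<in> e} + 3 + k = n" "2 * k + 4 \<le> n"
  shows "eccentricity (with_proj (flip_graph \<pi>)) T = ereal (real n - 3 + real k)"
proof (rule antisym)
  have cV: "card labels = n" using card_labels n by simp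
  note N = card_interior_at_apex[OF T] and t = triangulation_idx[OF T]
  have cN: "card (nbrs (idxT T)) + 1 + k = n" using N(1) k(1) by linarith
  have n3: "3 \<le> card labels" using cV polygon_card[OF polygon] n by simp
  show "eccentricity (with_proj (flip_graph \<pi>)) T \<le> ereal (real n - 3 + real k)"
    unfolding eccentricity_def
  proof (rule SUP_least)
    fix T' assume "T' \<in> verts (with_proj (flip_graph \<pi>))"
    then have T': "triangulation_of T' \<pi>" by simp
    obtain L where L: "reach labels L (idxT T) (idxT T')" "L + card (nbrs (idxT T)) + 4 \<le> 2 * card labels"
      using reach_upper[OF t triangulation_idx[OF T'] finite_labels zero_labels n3] by blast
    have "L + 3 \<le> n + k" using L(2) cN cV by linarith
    then have "real L \<le> real n - 3 + real k" by linarith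
    then show "graph_distance (with_proj (flip_graph \<pi>)) T T' \<le> ereal (real n - 3 + real k)"
      using graph_distance_le[OF L(1) T T'] by (meson ereal_less_eq(3) order_trans)
  qed
  have "admissible labels (nbrs (idxT T))"
    unfolding admissible_def
  proof (intro conjI)
    obtain l h where lh: "l \<in> nbrs (idxT T)" "h \<in> nbrs (idxT T)" "\<And>x. x \<in> labels - {0} \<Longrightarrow> l \<le> x \<and> x \<le> h"
      using N(2) by blast
    show "\<exists>l\<in>nbrs (idxT T). \<forall>x\<in>labels - {0}. l \<le> x" using lh by blast
    have "x \<le> h" if "x \<in> labels" for x using lh(3)[of x] that by (cases "x = 0") auto
    then show "\<exists>h\<in>nbrs (idxT T). \<forall>x\<in>labels. x \<le> h" using lh(2) by blast
    show "card labels + 2 \<le> 2 * card (nbrs (idxT T))" using cN cV k(2) by linarith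
  qed (use finite_labels zero_labels nbrs_subset[OF t] in auto)
  then obtain U where U: "remote labels (nbrs (idxT T)) U" using remote_exists by blast
  then have "triang labels U" by (simp add: remote_def)
  then obtain T' where T': "triangulation_of T' \<pi>" "idxT T' = U" using triangulation_preimage by blast
  have "ereal (real n - 3 + real k) \<le> graph_distance (with_proj (flip_graph \<pi>)) T T'"
  proof (rule graph_distance_ge)
    fix L assume "reach labels L (idxT T) (idxT T')"
    then have "2 * card labels \<le> L + 4 + card (nbrs (idxT T))" using U t T'(2) unfolding remote_def by blast
    then have "n + k \<le> L + 3" using cN cV by linarith
    then show "real n - 3 + real k \<le> real L" by linarith
  qed
  also have "\<dots> \<le> eccentricity (with_proj (flip_graph \<pi>)) T"
    unfolding eccentricity_def using T'(1) by (intro SUP_upper) simp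
  finally show "ereal (real n - 3 + real k) \<le> eccentricity (with_proj (flip_graph \<pi>)) T" .
qed

end

theorem theorem1p2:
  fixes \<pi> :: "(real^2) set" and n :: nat and T :: "(real^2) set set" and k :: int
  assumes "convex_polygon \<pi>"
    and "card (polygon_vertices \<pi>) = n"
    and "triangulation_of T \<pi>"
    and "real_of_int k \<le> real n / 2 - 2"
    and "\<exists>v \<in> polygon_vertices \<pi>. int (card {e \<in> interior_edges \<pi> T. v \<in> e}) = int n - 3 - k"
  shows "eccentricity (with_proj (flip_graph \<pi>)) T = ereal (real n - 3 + real_of_int k)"
proof -
  obtain v where at_v: "v \<in> polygon_vertices \<pi>"
    "int (card {e \<in> interior_edges \<pi> T. v \<in> e}) = int n - 3 - k" using assms(5) by blast
  interpret pointed_polygon \<pi> v by unfold_locales (use assms(1) at_v(1) in auto)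
  have "nbrs (idxT T) \<subseteq> labels - {0}" using nbrs_subset[OF triangulation_idx[OF assms(3)]] .
  then have "card (nbrs (idxT T)) \<le> card (labels - {0})" using finite_labels by (intro card_mono) auto
  also have "\<dots> + 1 = n" using card.remove[OF finite_labels zero_labels] card_labels assms(2) by simp
  finally have "card {e \<in> interior_edges \<pi> T. v \<in> e} + 3 \<le> n"
    using card_interior_at_apex(1)[OF assms(3)] by linarith
  \<comment> \<open>at most \<open>n - 3\<close> interior edges meet at \<open>v\<close>, so \<open>k\<close> is in fact a natural number\<close>
  then have "0 \<le> k" using at_v(2) by linarith
  then have k: "int (nat k) = k" by simp
  have "card {e \<in> interior_edges \<pi> T. v \<in> e} + 3 + nat k = n" using at_v(2) k by linarith
  moreover have "2 * k + 4 \<le> int n" using assms(4) by linarith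
  then have "2 * nat k + 4 \<le> n" using k by linarith
  ultimately have "eccentricity (with_proj (flip_graph \<pi>)) T = ereal (real n - 3 + real (nat k))"
    by (rule eccentricity_apex[OF assms(3,2)])
  moreover have "real (nat k) = real_of_int k" using \<open>0 \<le> k\<close> by simp
  ultimately show ?thesis by simp
qed

end
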